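(* There exists an $\mathrm{MCOQLS}(n)$ (a pair of orthogonal quantum Latin squares of order $n$, each with maximal cardinality $n^2$) in each of the following cases: (i) $n=q_1q_2k$, where each of $q_1,q_2$ is either an odd prime power at least $9$ or equal to $16$, and $k$ is a positive integer other than $2$ and $6$; (ii) $n=64m$, where $m$ is any positive integer.
   Context: A quantum Latin square of order $n$, denoted $\mathrm{QLS}(n)$, is an $n\times n$ array of unit column vectors in $\mathbb C^n$ such that each row and each column forms an orthonormal basis of $\mathbb C^n$. The cardinality of a $\mathrm{QLS}(n)$ is the number of distinct quantum states among its entries, where two unit vectors $|\phi\rangle$ and $e^{i\theta}|\phi\rangle$ ($\theta\in\mathbb R$) represent the same state (i.e. entries are counted up to a global phase). A $\mathrm{QLS}(n)$ has maximal cardinality if its cardinality is $n^2$. Two $\mathrm{QLS}(n)$s $P=(|p_{ij}\rangle)$ and $Q=(|q_{ij}\rangle)$ are orthogonal if $\{|p_{ij}\rangle\otimes|q_{ij}\rangle:0\le i,j\le n-1\}$ forms an orthonormal basis of $\mathbb C^n\otimes\mathbb C^n$ (of $n^2$ vectors, indexed by the cells $(i,j)$). An $\mathrm{MCOQLS}(n)$ is a pair of orthogonal $\mathrm{QLS}(n)$s, each with maximal cardinality. *)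

theory Defs
  imports
    "HOL-Number_Theory.Prime_Powers"
    "Jordan_Normal_Form.VS_Connect"
begin

text \<open>
  Vectors of \<open>\<complex>\<^sup>N\<close> are elements of \<^term>\<open>carrier_vec N :: complex vec set\<close>. The basis is
  indexed by cells rather than given as a set, so distinct cells must carry orthogonal vectors;
  \<open>vectorspace.basis\<close> then says that the image of the family is a vector space basis.
\<close>

definition orthonormal_basis :: "nat \<Rightarrow> 'i set \<Rightarrow> ('i \<Rightarrow> complex vec) \<Rightarrow> bool" where
  "orthonormal_basis N I f \<longleftrightarrow>
     (\<forall>i\<in>I. f i \<in> carrier_vec N) \<and>
     (\<forall>i\<in>I. \<forall>j\<in>I. f i \<bullet>c f j = (if i = j then 1 else 0)) \<and>
     vectorspace.basis class_ring (module_vec TYPE(complex) N) (f ` I)"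

definition is_QLS :: "nat \<Rightarrow> (nat \<Rightarrow> nat \<Rightarrow> complex vec) \<Rightarrow> bool" where
  "is_QLS n P \<longleftrightarrow>
     (\<forall>i<n. \<forall>j<n. P i j \<in> carrier_vec n \<and> P i j \<bullet>c P i j = 1) \<and>
     (\<forall>i<n. orthonormal_basis n {..<n} (\<lambda>j. P i j)) \<and>
     (\<forall>j<n. orthonormal_basis n {..<n} (\<lambda>i. P i j))"

definition same_state :: "(complex vec \<times> complex vec) set" where
  "same_state = {(v, w). \<exists>\<theta>::real. w = cis \<theta> \<cdot>\<^sub>v v}"

definition QLS_entries :: "nat \<Rightarrow> (nat \<Rightarrow> nat \<Rightarrow> complex vec) \<Rightarrow> complex vec set" where
  "QLS_entries n P = {P i j | i j. i < n \<and> j < n}"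

definition QLS_cardinality :: "nat \<Rightarrow> (nat \<Rightarrow> nat \<Rightarrow> complex vec) \<Rightarrow> nat" where
  "QLS_cardinality n P = card (QLS_entries n P // same_state)"

text \<open>
  The Kronecker product, which identifies \<open>\<complex>\<^sup>a \<otimes> \<complex>\<^sup>b\<close> with \<open>\<complex>\<^sup>a\<^sup>b\<close> by sending
  \<open>e\<^sub>i \<otimes> e\<^sub>j\<close> to \<open>e\<^sub>k\<close>, where \<open>k = i b + j\<close>.
\<close>

definition tensor_vec :: "complex vec \<Rightarrow> complex vec \<Rightarrow> complex vec" where
  "tensor_vec v w =
     vec (dim_vec v * dim_vec w) (\<lambda>k. v $ (k div dim_vec w) * w $ (k mod dim_vec w))"

definition orthogonal_QLS ::
    "nat \<Rightarrow> (nat \<Rightarrow> nat \<Rightarrow> complex vec) \<Rightarrow> (nat \<Rightarrow> nat \<Rightarrow> complex vec) \<Rightarrow> bool" where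
  "orthogonal_QLS n P Q \<longleftrightarrow>
     orthonormal_basis (n * n) ({..<n} \<times> {..<n}) (\<lambda>(i, j). tensor_vec (P i j) (Q i j))"

definition is_MCOQLS ::
    "nat \<Rightarrow> (nat \<Rightarrow> nat \<Rightarrow> complex vec) \<Rightarrow> (nat \<Rightarrow> nat \<Rightarrow> complex vec) \<Rightarrow> bool" where
  "is_MCOQLS n P Q \<longleftrightarrow>
     is_QLS n P \<and> is_QLS n Q \<and> orthogonal_QLS n P Q \<and>
     QLS_cardinality n P = n\<^sup>2 \<and> QLS_cardinality n Q = n\<^sup>2"

end

theory Submission
  imports Defs "HOL-Library.Product_Plus" "HOL-Library.Nat_Bijection"
begin

text \<open>
  A pair of orthogonal arrays of order \<open>a b\<close> is composed from two ingredients, each of which is a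
  single array of unit vectors with orthonormal rows and columns, accompanied by Latin squares.
  A Latin square \<open>K\<close> is a mate of an array if any two different cells with the same symbol of \<open>K\<close>
  carry orthogonal vectors.

  The ingredient of order \<open>b\<close> (\<open>two_mates\<close>) is a sequence of arrays \<open>m\<^sup>g\<close> with two common mates \<open>L\<close> and \<open>L'\<close>,
  which together determine the cell; no ray occurs twice in the whole sequence. The ingredient of
  order \<open>a\<close> (\<open>blocked\<close>) is an array \<open>x\<close> with a mate \<open>K\<close> whose symbols are divided into blocks of at least
  two symbols; no ray of \<open>x\<close> occurs twice among the cells whose symbols lie in one block. For a cell \<open>c\<close> of the
  first array and a cell \<open>w\<close> of the second one put
    \<open>P = x c \<otimes> m\<^sup>g w\<close>, where \<open>g\<close> is the block of \<open>K c\<close>, and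
    \<open>Q = \<Sum>\<^sub>y U y (K c) e\<^sub>y \<otimes> (e\<^sub>s + z c \<one>)\<close>, where \<open>s = l\<^sub>y w\<close>.
  Here \<open>U\<close> is unitary and has nonzero entries exactly inside the blocks, \<open>\<one>\<close> is the vector of
  ones, the map \<open>e\<^sub>s \<mapsto> e\<^sub>s + z c \<one>\<close> is a unitary that multiplies \<open>\<one>\<close> by a phase depending
  injectively on \<open>c\<close>, and \<open>l\<^sub>y\<close> is \<open>L\<close> for one representative \<open>y\<close> of each block and \<open>L'\<close> for all other \<open>y\<close>.
  The vector \<open>Q\<close> shows \<open>L w\<close>, \<open>L' w\<close> and the phase, hence its ray determines the cell. As for orthogonality,
  consider two cells \<open>(c, w)\<close> and \<open>(c', w')\<close>. Different blocks make \<open>Q\<close> orthogonal. In one block, if \<open>w\<close> and \<open>w'\<close> are different and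
  agree under \<open>L\<close> or under \<open>L'\<close>, then \<open>P\<close> is orthogonal because of these mates. In all other cases the second factors of \<open>Q\<close> have an inner
  product that does not depend on \<open>y\<close>, so that the sum over \<open>y\<close> is a multiple of an entry of \<open>U\<^sup>* U\<close>: it vanishes if the
  symbols of \<open>K\<close> differ, and if they agree with \<open>c \<noteq> c'\<close>, the mate \<open>K\<close> makes \<open>P\<close> orthogonal. For \<open>c = c'\<close> the inner product
  of the second factors is that of two standard basis vectors.
  This is \<open>composition\<close>.

  Two mates of order \<open>q\<close> come from the characters \<open>\<chi>\<close> of an abelian group of order \<open>q\<close>: the cell \<open>(a, d)\<close>
  carries the vector with entries \<open>\<chi> a (\<pi> y) \<chi> d y\<close>, up to normalisation. Suppose that \<open>T\<close> is self-adjoint and that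
  \<open>\<pi>\<close> and \<open>\<pi> + T\<close> are bijections. On cells with equal value of \<open>d - T a\<close> the inner product is the sum
  of a nontrivial character over the values of \<open>\<pi> + T\<close>, which is zero (\<open>phase_two_mates\<close>). A phase in one coordinate
  gives the sequence. For primes \<open>p \<ge> 11\<close> and for \<open>p\<^sup>h\<close> with \<open>p \<ge> 5\<close> and \<open>h \<ge> 2\<close> the bijections multiply by
  one constant on a part of the group and by another one on the rest (\<open>mated_prime\<close>,
  \<open>mated_prime_power\<close>); orders 9, 27 and 16 are tables, and higher powers of 3 are tensor products.

  An array with two mates is blocked, with a single block. A pair of orthogonal Latin squares of
  order \<open>k\<close> turns a blocked array of order \<open>a\<close> into one of order \<open>a k\<close> (\<open>blocked_inflate\<close>), and such a pair
  exists for every positive \<open>k\<close> except 2 and 6 by the theorem of Bose, Shrikhande and Parker (\<open>mols_exist\<close>). This gives the orders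
  \<open>q1 q2 k\<close>. For \<open>64 m\<close> with \<open>m\<close> neither 2 nor 6, an explicit pair of order 64, whose signs are
  \<open>\<xi> \<cdot> t + \<zeta> \<cdot> t\<^sup>5\<close> and \<open>\<xi> \<cdot> \<omega> t + \<zeta> \<cdot> t\<^sup>5\<close> over the field with 64 elements,
  is multiplied by orthogonal Latin squares of order \<open>m\<close>
  (\<open>MCOQLS_64_mols\<close>). The two remaining orders are \<open>128 = 8 \<cdot> 16\<close> and \<open>384 = (8 \<cdot> 3) \<cdot> 16\<close>, where \<open>blocked_8\<close>
  supplies the factor 8.
\<close>

section \<open>Arrays of vectors indexed by finite sets\<close>

definition ip :: "'x set \<Rightarrow> ('x \<Rightarrow> complex) \<Rightarrow> ('x \<Rightarrow> complex) \<Rightarrow> complex" where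
  "ip X f g = (\<Sum>x\<in>X. f x * cnj (g x))"

definition same_ray :: "'x set \<Rightarrow> ('x \<Rightarrow> complex) \<Rightarrow> ('x \<Rightarrow> complex) \<Rightarrow> bool" where
  "same_ray X f g \<longleftrightarrow> (\<exists>\<theta>::real. \<forall>x\<in>X. g x = cis \<theta> * f x)"

text \<open>
  The vector at row \<open>i\<close> and column \<open>j\<close> is the value at the pair \<open>(i, j)\<close>, and a vector is the function of its coordinates on
  a finite set. Products of index sets then replace all index arithmetic.
\<close>

definition qarray :: "'r set \<Rightarrow> 'x set \<Rightarrow> ('r \<times> 'r \<Rightarrow> 'x \<Rightarrow> complex) \<Rightarrow> bool" where
  "qarray R X p \<longleftrightarrow>
     (\<forall>c \<in> R \<times> R. ip X (p c) (p c) = 1) \<and>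
     (\<forall>c \<in> R \<times> R. \<forall>d \<in> R \<times> R. c \<noteq> d \<longrightarrow> fst c = fst d \<or> snd c = snd d \<longrightarrow> ip X (p c) (p d) = 0)"

definition mc_pair ::
    "nat \<Rightarrow> 'r set \<Rightarrow> 'x set \<Rightarrow> 'y set \<Rightarrow>
     ('r \<times> 'r \<Rightarrow> 'x \<Rightarrow> complex) \<Rightarrow> ('r \<times> 'r \<Rightarrow> 'y \<Rightarrow> complex) \<Rightarrow> bool" where
  "mc_pair n R X Y p q \<longleftrightarrow>
     finite R \<and> finite X \<and> finite Y \<and> card R = n \<and> card X = n \<and> card Y = n \<and>
     qarray R X p \<and> qarray R Y q \<and>
     (\<forall>c \<in> R \<times> R. \<forall>d \<in> R \<times> R. c \<noteq> d \<longrightarrow> ip X (p c) (p d) = 0 \<or> ip Y (q c) (q d) = 0) \<and>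
     (\<forall>c \<in> R \<times> R. \<forall>d \<in> R \<times> R. same_ray X (p c) (p d) \<longrightarrow> c = d) \<and>
     (\<forall>c \<in> R \<times> R. \<forall>d \<in> R \<times> R. same_ray Y (q c) (q d) \<longrightarrow> c = d)"

text \<open>
  The Gram matrix of the family is the identity; hence the matrix with these rows has nonzero
  determinant, and its rows are linearly independent.
\<close>

lemma orthonormal_family_basis:
  fixes f :: "'i \<Rightarrow> complex vec"
  assumes "finite I" "card I = N" "\<And>i. i \<in> I \<Longrightarrow> f i \<in> carrier_vec N"
    and on: "\<And>i j. i \<in> I \<Longrightarrow> j \<in> I \<Longrightarrow> f i \<bullet>c f j = (if i = j then 1 else 0)"
  shows "orthonormal_basis N I f"
proof -
  interpret vec_space "TYPE(complex)" N .
  obtain \<iota> where b: "bij_betw \<iota> {..<N} I"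
    using assms(1,2) by (metis ex_bij_betw_nat_finite atLeast0LessThan)
  define A where "A = mat_of_rows N (map (\<lambda>k. f (\<iota> k)) [0..<N])"
  (* The conjugates of the rows are the columns of the inverse. *)
  define B where "B = mat_of_cols N (map (\<lambda>k. conjugate (f (\<iota> k))) [0..<N])"
  have \<iota>: "k < N \<Longrightarrow> \<iota> k \<in> I" for k using b by (auto simp: bij_betw_def)
  have dim: "k < N \<Longrightarrow> dim_vec (f (\<iota> k)) = N" for k using \<iota> assms(3) by fastforce
  have A: "A \<in> carrier_mat N N" and B: "B \<in> carrier_mat N N" by (auto simp: A_def B_def)
  have inj: "i < N \<Longrightarrow> j < N \<Longrightarrow> \<iota> i = \<iota> j \<longleftrightarrow> i = j" for i j
    using b by (auto simp: bij_betw_def inj_on_def)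
  have rowA: "i < N \<Longrightarrow> row A i = f (\<iota> i)" for i
    unfolding A_def by (rule mat_of_rows_row[THEN trans]) (use \<iota> assms(3) in auto)
  have colB: "j < N \<Longrightarrow> col B j = conjugate (f (\<iota> j))" for j
    unfolding B_def by (rule col_mat_of_cols[THEN trans]) (use \<iota> assms(3) in auto)
  have "A * B = 1\<^sub>m N"
    by (rule eq_matI) (use A B in \<open>auto simp: rowA colB on \<iota> inj\<close>)
  then have "det A * det B = 1" using det_mult[OF A B] by simp
  then have "det A \<noteq> 0" by auto
  with A have li: "lin_indpt (set (rows A))" by (rule det_not_0_imp_lin_indpt_rows)
  have rows: "set (rows A) = f ` I"
  proof -
    have "rows A = map (\<lambda>k. f (\<iota> k)) [0..<N]"
      using A by (auto simp: rows_def intro!: map_cong rowA)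
    then show ?thesis using b by (auto simp: bij_betw_def image_image)
  qed
  have "inj_on f I"
  proof (rule inj_onI)
    fix i j assume "i \<in> I" "j \<in> I" "f i = f j"
    then show "i = j" using on[of i j] on[of i i] by (auto split: if_splits)
  qed
  then have "basis (f ` I)"
    using li assms(1,2,3) by (intro dim_li_is_basis) (auto simp: rows dim_is_n card_image)
  then show ?thesis
    unfolding orthonormal_basis_def using on assms(3) by auto
qed

lemma ip_reindex: "bij_betw h X Y \<Longrightarrow> ip X (\<lambda>x. f (h x)) (\<lambda>x. g (h x)) = ip Y f g"
  unfolding ip_def by (rule sum.reindex_bij_betw)

lemma ip_tensor:
  "ip (X \<times> Y) (\<lambda>(x, y). f x * g y) (\<lambda>(x, y). f' x * g' y) = ip X f f' * ip Y g g'"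
  by (simp add: ip_def sum_product sum.cartesian_product mult_ac split_def)

text \<open>
  The enumerations \<open>\<rho>\<close> and \<open>\<xi>\<close> translate the index sets to the initial segments of the natural numbers.
\<close>

definition vec_array ::
    "nat \<Rightarrow> (nat \<Rightarrow> 'r) \<Rightarrow> (nat \<Rightarrow> 'x) \<Rightarrow> ('r \<times> 'r \<Rightarrow> 'x \<Rightarrow> complex) \<Rightarrow> nat \<Rightarrow> nat \<Rightarrow> complex vec" where
  "vec_array n \<rho> \<xi> p i j = vec n (\<lambda>k. p (\<rho> i, \<rho> j) (\<xi> k))"

lemma vec_array_ip:
  assumes "bij_betw \<xi> {..<n} X"
  shows "vec_array n \<rho> \<xi> p i j \<bullet>c vec_array n \<rho> \<xi> p i' j' = ip X (p (\<rho> i, \<rho> j)) (p (\<rho> i', \<rho> j'))"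
  unfolding vec_array_def ip_reindex[OF assms, symmetric]
  by (simp add: scalar_prod_def ip_def atLeast0LessThan)

lemma vec_array_QLS:
  assumes \<rho>: "bij_betw \<rho> {..<n} R" and \<zeta>: "bij_betw \<zeta> {..<n} Z" and "qarray R Z a"
  shows "is_QLS n (vec_array n \<rho> \<zeta> a)"
proof -
  have \<rho>R: "i < n \<Longrightarrow> \<rho> i \<in> R" for i using \<rho> by (auto simp: bij_betw_def)
  have \<rho>inj: "i < n \<Longrightarrow> j < n \<Longrightarrow> \<rho> i = \<rho> j \<longleftrightarrow> i = j" for i j
    using \<rho> by (auto simp: bij_betw_def inj_on_def)
  have q0: "\<And>c d. c \<in> R \<times> R \<Longrightarrow> d \<in> R \<times> R \<Longrightarrow> c \<noteq> d \<Longrightarrow> fst c = fst d \<or> snd c = snd d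
      \<Longrightarrow> ip Z (a c) (a d) = 0"
    using assms(3) unfolding qarray_def by blast
  have norm: "ip Z (a (\<rho> i, \<rho> j)) (a (\<rho> i, \<rho> j)) = 1" if "i < n" "j < n" for i j
    using assms(3) \<rho>R that unfolding qarray_def by blast
  have row: "ip Z (a (\<rho> i, \<rho> j)) (a (\<rho> i, \<rho> j')) = 0" if "i < n" "j < n" "j' < n" "j \<noteq> j'" for i j j'
  proof -
    have "(\<rho> i, \<rho> j) \<noteq> (\<rho> i, \<rho> j')" using that \<rho>inj by auto
    then show ?thesis using \<rho>R that by (intro q0) auto
  qed
  have col: "ip Z (a (\<rho> i, \<rho> j)) (a (\<rho> i', \<rho> j)) = 0" if "i < n" "i' < n" "j < n" "i \<noteq> i'" for i i' j
  proof -
    have "(\<rho> i, \<rho> j) \<noteq> (\<rho> i', \<rho> j)" using that \<rho>inj by auto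
    then show ?thesis using \<rho>R that by (intro q0) auto
  qed
  have car: "vec_array n \<rho> \<zeta> a i j \<in> carrier_vec n" for i j by (simp add: vec_array_def)
  show ?thesis
    unfolding is_QLS_def
    by (intro conjI allI impI orthonormal_family_basis)
       (simp_all add: car vec_array_ip[OF \<zeta>] norm row col)
qed

lemma vec_array_cardinality:
  assumes \<rho>: "bij_betw \<rho> {..<n} R" and \<zeta>: "bij_betw \<zeta> {..<n} Z"
    and ray: "\<And>c d. c \<in> R \<times> R \<Longrightarrow> d \<in> R \<times> R \<Longrightarrow> same_ray Z (a c) (a d) \<Longrightarrow> c = d"
  shows "QLS_cardinality n (vec_array n \<rho> \<zeta> a) = n\<^sup>2"
proof -
  have \<rho>R: "i < n \<Longrightarrow> \<rho> i \<in> R" for i using \<rho> by (auto simp: bij_betw_def)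
  have \<rho>inj: "i < n \<Longrightarrow> j < n \<Longrightarrow> \<rho> i = \<rho> j \<longleftrightarrow> i = j" for i j
    using \<rho> by (auto simp: bij_betw_def inj_on_def)
  let ?c = "\<lambda>(i, j). same_state `` {vec_array n \<rho> \<zeta> a i j}"
  have "QLS_entries n (vec_array n \<rho> \<zeta> a) // same_state = ?c ` ({..<n} \<times> {..<n})"
    by (fastforce simp: QLS_entries_def quotient_def)
  moreover have "inj_on ?c ({..<n} \<times> {..<n})"
  proof (rule inj_onI, clarify)
    fix i j i' j' assume l: "i < n" "j < n" "i' < n" "j' < n"
      and eq: "same_state `` {vec_array n \<rho> \<zeta> a i j} = same_state `` {vec_array n \<rho> \<zeta> a i' j'}"
    have "vec_array n \<rho> \<zeta> a i' j' = cis 0 \<cdot>\<^sub>v vec_array n \<rho> \<zeta> a i' j'" by (auto simp: vec_array_def)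
    then have "(vec_array n \<rho> \<zeta> a i' j', vec_array n \<rho> \<zeta> a i' j') \<in> same_state"
      unfolding same_state_def by blast
    with eq have "(vec_array n \<rho> \<zeta> a i j, vec_array n \<rho> \<zeta> a i' j') \<in> same_state" by blast
    then obtain \<theta> where \<theta>: "vec_array n \<rho> \<zeta> a i' j' = cis \<theta> \<cdot>\<^sub>v vec_array n \<rho> \<zeta> a i j"
      unfolding same_state_def by blast
    have "a (\<rho> i', \<rho> j') (\<zeta> k) = cis \<theta> * a (\<rho> i, \<rho> j) (\<zeta> k)" if "k < n" for k
      using arg_cong[OF \<theta>, of "\<lambda>v. v $ k"] that by (simp add: vec_array_def)
    then have "same_ray Z (a (\<rho> i, \<rho> j)) (a (\<rho> i', \<rho> j'))"
      unfolding same_ray_def using \<zeta> by (auto simp: bij_betw_def)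
    then have "(\<rho> i, \<rho> j) = (\<rho> i', \<rho> j')" using l \<rho>R by (intro ray) auto
    then show "i = i' \<and> j = j'" using \<rho>inj l by auto
  qed
  ultimately show ?thesis
    by (simp add: QLS_cardinality_def card_image power2_eq_square)
qed

lemma mc_pair_imp_MCOQLS:
  assumes "mc_pair n R X Y p q"
  shows "\<exists>P Q. is_MCOQLS n P Q"
proof -
  have fin: "finite R" "finite X" "finite Y" and card: "card R = n" "card X = n" "card Y = n"
    and qp: "qarray R X p" and qq: "qarray R Y q"
    and orth: "\<And>c d. c \<in> R \<times> R \<Longrightarrow> d \<in> R \<times> R \<Longrightarrow> c \<noteq> d \<Longrightarrow> ip X (p c) (p d) = 0 \<or> ip Y (q c) (q d) = 0"
    and rp: "\<And>c d. c \<in> R \<times> R \<Longrightarrow> d \<in> R \<times> R \<Longrightarrow> same_ray X (p c) (p d) \<Longrightarrow> c = d"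
    and rq: "\<And>c d. c \<in> R \<times> R \<Longrightarrow> d \<in> R \<times> R \<Longrightarrow> same_ray Y (q c) (q d) \<Longrightarrow> c = d"
    using assms unfolding mc_pair_def by blast+
  obtain \<rho> where \<rho>: "bij_betw \<rho> {..<n} R" using fin card by (metis ex_bij_betw_nat_finite atLeast0LessThan)
  obtain \<xi> where \<xi>: "bij_betw \<xi> {..<n} X" using fin card by (metis ex_bij_betw_nat_finite atLeast0LessThan)
  obtain \<eta> where \<eta>: "bij_betw \<eta> {..<n} Y" using fin card by (metis ex_bij_betw_nat_finite atLeast0LessThan)
  have \<rho>R: "i < n \<Longrightarrow> \<rho> i \<in> R" for i using \<rho> by (auto simp: bij_betw_def)
  have \<rho>inj: "i < n \<Longrightarrow> j < n \<Longrightarrow> \<rho> i = \<rho> j \<longleftrightarrow> i = j" for i j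
    using \<rho> by (auto simp: bij_betw_def inj_on_def)
  have tens: "tensor_vec (vec_array n \<rho> \<xi> p i j) (vec_array n \<rho> \<eta> q i j) \<bullet>c tensor_vec (vec_array n \<rho> \<xi> p i' j') (vec_array n \<rho> \<eta> q i' j')
      = ip X (p (\<rho> i, \<rho> j)) (p (\<rho> i', \<rho> j')) * ip Y (q (\<rho> i, \<rho> j)) (q (\<rho> i', \<rho> j'))" for i j i' j'
  proof -
    have n0: "n = 0 \<or> n > 0" by auto
    let ?h = "\<lambda>k. (\<xi> (k div n), \<eta> (k mod n))"
    have lt: "a * n + b < n * n" if "a < n" "b < n" for a b
      using that mult_le_mono1[of "Suc a" n n] by simp
    have bh: "bij_betw ?h {..<n*n} (X \<times> Y)"
    proof -
      have "bij_betw (\<lambda>k. (k div n, k mod n)) {..<n*n} ({..<n} \<times> {..<n})"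
        by (rule bij_betw_byWitness[where f' = "\<lambda>(a, b). a * n + b"])
           (use n0 lt in \<open>auto simp: less_mult_imp_div_less\<close>)
      moreover have "bij_betw (map_prod \<xi> \<eta>) ({..<n} \<times> {..<n}) (X \<times> Y)"
        using \<xi> \<eta> by (rule bij_betw_map_prod)
      ultimately show ?thesis
        using bij_betw_trans by (fastforce simp: comp_def)
    qed
    have "tensor_vec (vec_array n \<rho> \<xi> p i j) (vec_array n \<rho> \<eta> q i j) \<bullet>c tensor_vec (vec_array n \<rho> \<xi> p i' j') (vec_array n \<rho> \<eta> q i' j')
       = ip {..<n*n} (\<lambda>k. case ?h k of (x, y) \<Rightarrow> p (\<rho> i, \<rho> j) x * q (\<rho> i, \<rho> j) y)
           (\<lambda>k. case ?h k of (x, y) \<Rightarrow> p (\<rho> i', \<rho> j') x * q (\<rho> i', \<rho> j') y)"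
    proof -
      have "k div n < n \<and> k mod n < n" if "k < n * n" for k
        using that n0 by (auto simp: less_mult_imp_div_less)
      then show ?thesis
        by (auto simp: tensor_vec_def scalar_prod_def ip_def vec_array_def atLeast0LessThan intro!: sum.cong)
    qed
    also have "\<dots> = ip (X \<times> Y) (\<lambda>(x, y). p (\<rho> i, \<rho> j) x * q (\<rho> i, \<rho> j) y)
          (\<lambda>(x, y). p (\<rho> i', \<rho> j') x * q (\<rho> i', \<rho> j') y)"
      by (rule ip_reindex[OF bh])
    finally show ?thesis by (simp only: ip_tensor)
  qed
  have "orthogonal_QLS n (vec_array n \<rho> \<xi> p) (vec_array n \<rho> \<eta> q)"
    unfolding orthogonal_QLS_def
  proof (rule orthonormal_family_basis, goal_cases)
    case (4 c d)
    obtain i j i' j' where cd: "c = (i, j)" "d = (i', j')" by fastforce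
    show ?case
    proof (cases "c = d")
      case True
      then show ?thesis using 4 qp qq \<rho>R by (auto simp: cd tens qarray_def)
    next
      case False
      with 4 have "(\<rho> i, \<rho> j) \<noteq> (\<rho> i', \<rho> j')" by (auto simp: cd \<rho>inj)
      then show ?thesis using False 4 orth[of "(\<rho> i, \<rho> j)" "(\<rho> i', \<rho> j')"] \<rho>R by (auto simp: cd tens)
    qed
  qed (auto simp: tensor_vec_def vec_array_def)
  then have "is_MCOQLS n (vec_array n \<rho> \<xi> p) (vec_array n \<rho> \<eta> q)"
    unfolding is_MCOQLS_def
    using vec_array_QLS[OF \<rho> \<xi> qp] vec_array_QLS[OF \<rho> \<eta> qq]
      vec_array_cardinality[OF \<rho> \<xi> rp] vec_array_cardinality[OF \<rho> \<eta> rq] by blast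
  then show ?thesis by blast
qed

text \<open>
  The angles lie in \<open>(0, 1]\<close>, so no two of them differ by a nonzero multiple of \<open>2 \<pi>\<close>. This supplies
  arbitrarily many pairwise different phases.
\<close>

lemma cis_reciprocal_inj:
  assumes "cis (1 / (real g + 1)) = cis (1 / (real h + 1))"
  shows "g = h"
proof -
  let ?x = "1 / (real g + 1)" and ?y = "1 / (real h + 1)"
  have b: "0 < ?x" "?x \<le> 1" "0 < ?y" "?y \<le> 1" by simp_all
  have "cis (?x - ?y) = cis ?x * cnj (cis ?y)" by (simp add: cis_cnj cis_mult)
  also have "\<dots> = 1" unfolding assms by (simp add: cis_cnj cis_mult)
  finally have "cos (?x - ?y) = 1" by (simp add: complex_eq_iff)
  then obtain j :: int where j: "?x - ?y = of_int j * 2 * pi" by (auto simp: cos_one_2pi_int)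
  have "\<bar>?x - ?y\<bar> < 1" using b by linarith
  then have "\<bar>of_int j\<bar> * (2 * pi) < 1" unfolding j by (simp add: abs_mult)
  have "j = 0"
  proof (rule ccontr)
    assume "j \<noteq> 0"
    then have "1 \<le> \<bar>of_int j :: real\<bar>" by linarith
    then have "1 * (2 * pi) \<le> \<bar>of_int j\<bar> * (2 * pi)" by (rule mult_right_mono) simp
    then show False using \<open>\<bar>of_int j\<bar> * (2 * pi) < 1\<close> pi_ge_two by linarith
  qed
  with j have "inverse (real g + 1) = inverse (real h + 1)" by (simp add: inverse_eq_divide)
  then show ?thesis by simp
qed

section \<open>Latin squares, mates and tensor products\<close>

definition latin :: "'r set \<Rightarrow> 's set \<Rightarrow> ('r \<times> 'r \<Rightarrow> 's) \<Rightarrow> bool" where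
  "latin R S K \<longleftrightarrow> finite S \<and> card S = card R \<and> (\<forall>c \<in> R \<times> R. K c \<in> S) \<and>
     (\<forall>c \<in> R \<times> R. \<forall>d \<in> R \<times> R. c \<noteq> d \<longrightarrow> fst c = fst d \<or> snd c = snd d \<longrightarrow> K c \<noteq> K d)"

definition mate :: "'r set \<Rightarrow> 'x set \<Rightarrow> ('r \<times> 'r \<Rightarrow> 'x \<Rightarrow> complex) \<Rightarrow> ('r \<times> 'r \<Rightarrow> 's) \<Rightarrow> bool" where
  "mate R X x K \<longleftrightarrow>
     (\<forall>c \<in> R \<times> R. \<forall>d \<in> R \<times> R. c \<noteq> d \<longrightarrow> K c = K d \<longrightarrow> ip X (x c) (x d) = 0)"

text \<open>
  A coordinate where the second factor does not vanish shows that the first factors are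
  proportional; equal norms make the factor of proportionality a phase.
\<close>

lemma same_ray_tensor:
  assumes "same_ray (X \<times> Y) (\<lambda>(x, y). f x * g y) (\<lambda>(x, y). f' x * g' y)"
    and "ip X f f = 1" "ip X f' f' = 1" "ip Y g g = 1" "ip Y g' g' = 1"
  shows "same_ray X f f' \<and> same_ray Y g g'"
proof -
  have half: "same_ray X f f'"
    if r: "same_ray (X \<times> Y) (\<lambda>(x, y). f x * g y) (\<lambda>(x, y). f' x * g' y)"
      and n: "ip X f f = 1" "ip X f' f' = 1" "ip Y g' g' = 1"
    for X :: "'c set" and Y :: "'d set" and f f' g g'
  proof -
    obtain \<theta> where \<theta>: "\<And>x y. x \<in> X \<Longrightarrow> y \<in> Y \<Longrightarrow> f' x * g' y = cis \<theta> * (f x * g y)"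
      using r unfolding same_ray_def by fastforce
    have "\<exists>y\<in>Y. g' y \<noteq> 0"
    proof (rule ccontr)
      assume "\<not> ?thesis"
      then have "ip Y g' g' = 0" by (simp add: ip_def)
      then show False using n by simp
    qed
    then obtain y where y: "y \<in> Y" "g' y \<noteq> 0" by blast
    define t where "t = cis \<theta> * g y / g' y"
    have t: "f' x = t * f x" if "x \<in> X" for x
      using \<theta>[OF that y(1)] y(2) by (simp add: t_def field_simps)
    have "ip X f' f' = t * cnj t * ip X f f"
      by (simp add: ip_def sum_distrib_left t algebra_simps cong: sum.cong)
    then have "complex_of_real ((cmod t)\<^sup>2) = 1"
      using n by (simp only: complex_norm_square) simp
    then have "(cmod t)\<^sup>2 = 1" by (simp only: of_real_eq_1_iff)
    then have "cmod t = 1" by (simp add: abs_square_eq_1)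
    then have "t = cis (Arg t)" using rcis_cmod_Arg[of t] by (simp add: rcis_def)
    then show ?thesis using t unfolding same_ray_def by metis
  qed
  have "same_ray (Y \<times> X) (\<lambda>(y, x). g y * f x) (\<lambda>(y, x). g' y * f' x)"
    using assms(1) by (auto simp: same_ray_def mult.commute)
  then show ?thesis
    using half[OF assms(1-3,5)] half[of Y X g f g' f'] assms(2-5) by blast
qed

text \<open>
  The cells of a product array are pairs of a row and a column that are themselves pairs; they are
  regrouped into the cells of the two factors.
\<close>

definition pr1 :: "('a \<times> 'b) \<times> ('a \<times> 'b) \<Rightarrow> 'a \<times> 'a" where
  "pr1 c = (fst (fst c), fst (snd c))"

definition pr2 :: "('a \<times> 'b) \<times> ('a \<times> 'b) \<Rightarrow> 'b \<times> 'b" where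
  "pr2 c = (snd (fst c), snd (snd c))"

definition tensor_array :: "('r \<times> 'r \<Rightarrow> 'x \<Rightarrow> complex) \<Rightarrow> ('s \<times> 's \<Rightarrow> 'y \<Rightarrow> complex) \<Rightarrow>
    ('r \<times> 's) \<times> ('r \<times> 's) \<Rightarrow> 'x \<times> 'y \<Rightarrow> complex" where
  "tensor_array u v c = (\<lambda>(x, y). u (pr1 c) x * v (pr2 c) y)"

lemma pr_mem:
  assumes "c \<in> (A \<times> B) \<times> (A \<times> B)"
  shows "pr1 c \<in> A \<times> A" "pr2 c \<in> B \<times> B"
  using assms by (auto simp: pr1_def pr2_def)

lemma pr_eq_iff: "c = d \<longleftrightarrow> pr1 c = pr1 d \<and> pr2 c = pr2 d"
  by (auto simp: pr1_def pr2_def prod_eq_iff)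

lemma pr_line:
  assumes "fst c = fst d \<or> snd c = snd d"
  shows "fst (pr1 c) = fst (pr1 d) \<or> snd (pr1 c) = snd (pr1 d)"
    "fst (pr2 c) = fst (pr2 d) \<or> snd (pr2 c) = snd (pr2 d)"
  using assms by (auto simp: pr1_def pr2_def)

lemma latinD:
  assumes "latin R S J" "c \<in> R \<times> R" "d \<in> R \<times> R" "c \<noteq> d" "fst c = fst d \<or> snd c = snd d"
  shows "J c \<noteq> J d"
  using assms unfolding latin_def by blast

lemma latin_mem: "latin R S J \<Longrightarrow> c \<in> R \<times> R \<Longrightarrow> J c \<in> S"
  unfolding latin_def by blast

lemma mateD:
  assumes "mate R X v J" "c \<in> R \<times> R" "d \<in> R \<times> R" "c \<noteq> d" "J c = J d"
  shows "ip X (v c) (v d) = 0"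
  using assms unfolding mate_def by blast

lemma qarray_orthogonal:
  assumes "qarray R X v" "c \<in> R \<times> R" "d \<in> R \<times> R" "c \<noteq> d" "fst c = fst d \<or> snd c = snd d"
  shows "ip X (v c) (v d) = 0"
  using assms unfolding qarray_def by blast

lemma qarray_norm: "qarray R X v \<Longrightarrow> c \<in> R \<times> R \<Longrightarrow> ip X (v c) (v c) = 1"
  unfolding qarray_def by blast

lemma ip_tensor_array:
  "ip (X \<times> Y) (tensor_array u v c) (tensor_array u' v' d) =
    ip X (u (pr1 c)) (u' (pr1 d)) * ip Y (v (pr2 c)) (v' (pr2 d))"
  unfolding tensor_array_def by (rule ip_tensor)

lemma latin_product:
  assumes J: "latin A S J" and H: "latin B T H"
  shows "latin (A \<times> B) (S \<times> T) (\<lambda>c. (J (pr1 c), H (pr2 c)))"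
  unfolding latin_def
proof (intro conjI ballI impI)
  fix c d assume cd: "c \<in> (A \<times> B) \<times> (A \<times> B)" "d \<in> (A \<times> B) \<times> (A \<times> B)" "c \<noteq> d" "fst c = fst d \<or> snd c = snd d"
  show "(J (pr1 c), H (pr2 c)) \<noteq> (J (pr1 d), H (pr2 d))"
  proof (cases "pr1 c = pr1 d")
    case True
    then have "pr2 c \<noteq> pr2 d" using cd(3) pr_eq_iff by blast
    then have "H (pr2 c) \<noteq> H (pr2 d)" by (rule latinD[OF H pr_mem(2)[OF cd(1)] pr_mem(2)[OF cd(2)] _ pr_line(2)[OF cd(4)]])
    then show ?thesis by simp
  next
    case False
    then have "J (pr1 c) \<noteq> J (pr1 d)" by (rule latinD[OF J pr_mem(1)[OF cd(1)] pr_mem(1)[OF cd(2)] _ pr_line(1)[OF cd(4)]])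
    then show ?thesis by simp
  qed
next
  fix c assume c: "c \<in> (A \<times> B) \<times> (A \<times> B)"
  show "(J (pr1 c), H (pr2 c)) \<in> S \<times> T"
    using latin_mem[OF J pr_mem(1)[OF c]] latin_mem[OF H pr_mem(2)[OF c]] by simp
qed (use J H in \<open>simp_all add: latin_def card_cartesian_product\<close>)

lemma mate_product:
  assumes J: "mate A X u J" and H: "mate B Y v H"
  shows "mate (A \<times> B) (X \<times> Y) (tensor_array u v) (\<lambda>c. (J (pr1 c), H (pr2 c)))"
  unfolding mate_def
proof (intro ballI impI)
  fix c d assume cd: "c \<in> (A \<times> B) \<times> (A \<times> B)" "d \<in> (A \<times> B) \<times> (A \<times> B)" "c \<noteq> d"
    "(J (pr1 c), H (pr2 c)) = (J (pr1 d), H (pr2 d))"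
  have "pr1 c \<noteq> pr1 d \<or> pr2 c \<noteq> pr2 d" using cd(3) by (simp only: pr_eq_iff de_Morgan_conj)
  moreover have "J (pr1 c) = J (pr1 d)" "H (pr2 c) = H (pr2 d)" using cd(4) by simp_all
  ultimately have "ip X (u (pr1 c)) (u (pr1 d)) = 0 \<or> ip Y (v (pr2 c)) (v (pr2 d)) = 0"
    using mateD[OF J pr_mem(1)[OF cd(1)] pr_mem(1)[OF cd(2)]] mateD[OF H pr_mem(2)[OF cd(1)] pr_mem(2)[OF cd(2)]]
    by metis
  then show "ip (X \<times> Y) (tensor_array u v c) (tensor_array u v d) = 0" by (auto simp: ip_tensor_array)
qed

lemma qarray_product:
  assumes u: "qarray A X u" and v: "qarray B Y v"
  shows "qarray (A \<times> B) (X \<times> Y) (tensor_array u v)"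
  unfolding qarray_def
proof (intro conjI ballI impI)
  fix c assume c: "c \<in> (A \<times> B) \<times> (A \<times> B)"
  show "ip (X \<times> Y) (tensor_array u v c) (tensor_array u v c) = 1"
    using qarray_norm[OF u pr_mem(1)[OF c]] qarray_norm[OF v pr_mem(2)[OF c]] by (simp add: ip_tensor_array)
next
  fix c d assume cd: "c \<in> (A \<times> B) \<times> (A \<times> B)" "d \<in> (A \<times> B) \<times> (A \<times> B)" "c \<noteq> d" "fst c = fst d \<or> snd c = snd d"
  have "pr1 c \<noteq> pr1 d \<or> pr2 c \<noteq> pr2 d" using cd(3) by (simp only: pr_eq_iff de_Morgan_conj)
  then have "ip X (u (pr1 c)) (u (pr1 d)) = 0 \<or> ip Y (v (pr2 c)) (v (pr2 d)) = 0"
    using qarray_orthogonal[OF u pr_mem(1)[OF cd(1)] pr_mem(1)[OF cd(2)] _ pr_line(1)[OF cd(4)]]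
      qarray_orthogonal[OF v pr_mem(2)[OF cd(1)] pr_mem(2)[OF cd(2)] _ pr_line(2)[OF cd(4)]]
    by metis
  then show "ip (X \<times> Y) (tensor_array u v c) (tensor_array u v d) = 0" by (auto simp: ip_tensor_array)
qed

lemma same_ray_tensor_array:
  assumes "qarray A X u" "qarray A X u'" "qarray B Y v" "qarray B Y v'"
    and "c \<in> (A \<times> B) \<times> (A \<times> B)" "d \<in> (A \<times> B) \<times> (A \<times> B)"
    and "same_ray (X \<times> Y) (tensor_array u v c) (tensor_array u' v' d)"
  shows "same_ray X (u (pr1 c)) (u' (pr1 d)) \<and> same_ray Y (v (pr2 c)) (v' (pr2 d))"
  using assms(7) unfolding tensor_array_def
  by (rule same_ray_tensor) (use assms in \<open>auto intro: qarray_norm pr_mem\<close>)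

definition basis_array :: "('r \<times> 'r \<Rightarrow> 'x) \<Rightarrow> 'r \<times> 'r \<Rightarrow> 'x \<Rightarrow> complex" where
  "basis_array A c t = (if t = A c then 1 else 0)"

lemma ip_basis:
  assumes "finite X" "A c \<in> X"
  shows "ip X (basis_array A c) (basis_array A d) = (if A c = A d then 1 else 0)"
proof -
  have "ip X (basis_array A c) (basis_array A d) = (\<Sum>t\<in>X. if t = A c then if A c = A d then 1 else 0 else 0)"
    unfolding ip_def by (rule sum.cong) (auto simp: basis_array_def)
  then show ?thesis using assms by (simp add: sum.delta)
qed

lemma basis_array_qarray:
  assumes "latin R X A"
  shows "qarray R X (basis_array A)"
proof -
  have X: "finite X" using assms unfolding latin_def by blast
  show ?thesis
    unfolding qarray_def
    using latinD[OF assms] latin_mem[OF assms] by (simp add: ip_basis[OF X] del: split_paired_All)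
qed

text \<open>
  An orthogonal Latin square is a mate in the above sense: a pair of orthogonal Latin squares is
  the special case of an array of standard basis vectors.
\<close>

lemma basis_array_mate:
  assumes A: "latin R X A" and AB: "inj_on (\<lambda>c. (A c, B c)) (R \<times> R)"
  shows "mate R X (basis_array A) B"
  unfolding mate_def
proof (intro ballI impI)
  have X: "finite X" using A unfolding latin_def by blast
  fix c d assume cd: "c \<in> R \<times> R" "d \<in> R \<times> R" "c \<noteq> d" "B c = B d"
  then have "A c \<noteq> A d" using inj_onD[OF AB, of c d] by auto
  then show "ip X (basis_array A c) (basis_array A d) = 0"
    using latin_mem[OF A cd(1)] by (simp add: ip_basis[OF X])
qed

lemma same_ray_basis:
  assumes "A c \<in> X" "same_ray X (basis_array A c) (basis_array A d)"
  shows "A c = A d"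
proof -
  obtain \<theta> where "basis_array A d (A c) = cis \<theta> * basis_array A c (A c)"
    using assms unfolding same_ray_def by blast
  then show ?thesis by (auto simp: basis_array_def split: if_splits)
qed

section \<open>Composing a blocked array with two mates\<close>

text \<open>
  The block of a symbol \<open>s\<close> is numbered by \<open>h s\<close>. The last condition separates rays only inside a
  block, because in the composition the numbers of the blocks select different members of a family without common rays.
\<close>

definition blocked :: "'r set \<Rightarrow> 'x set \<Rightarrow> 's set \<Rightarrow> ('r \<times> 'r \<Rightarrow> 'x \<Rightarrow> complex) \<Rightarrow>
    ('r \<times> 'r \<Rightarrow> 's) \<Rightarrow> ('s \<Rightarrow> nat) \<Rightarrow> bool" where
  "blocked R X S x K h \<longleftrightarrow>
     finite R \<and> finite X \<and> card X = card R \<and> qarray R X x \<and> latin R S K \<and> mate R X x K \<and>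
     (\<forall>k\<in>S. \<exists>y\<in>S. y \<noteq> k \<and> h y = h k) \<and>
     (\<forall>c \<in> R \<times> R. \<forall>d \<in> R \<times> R. h (K c) = h (K d) \<longrightarrow> same_ray X (x c) (x d) \<longrightarrow> c = d)"

definition two_mates :: "'r set \<Rightarrow> 'x set \<Rightarrow> 's set \<Rightarrow> (nat \<Rightarrow> 'r \<times> 'r \<Rightarrow> 'x \<Rightarrow> complex) \<Rightarrow>
    ('r \<times> 'r \<Rightarrow> 's) \<Rightarrow> ('r \<times> 'r \<Rightarrow> 's) \<Rightarrow> bool" where
  "two_mates R X S m L L' \<longleftrightarrow>
     finite R \<and> finite X \<and> card X = card R \<and> latin R S L \<and> latin R S L' \<and>
     inj_on (\<lambda>c. (L c, L' c)) (R \<times> R) \<and>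
     (\<forall>g. qarray R X (m g) \<and> mate R X (m g) L \<and> mate R X (m g) L') \<and>
     (\<forall>g g'. \<forall>c \<in> R \<times> R. \<forall>d \<in> R \<times> R. same_ray X (m g c) (m g' d) \<longrightarrow> g = g' \<and> c = d)"

text \<open>
  On a block of \<open>n\<close> symbols this is the identity plus \<open>(\<i> - 1) / n\<close> times the all-ones matrix. It multiplies the
  all-ones vector by \<open>\<i>\<close> and fixes the orthogonal complement, so it is unitary; and no entry
  vanishes. A real reflection would not do, since its diagonal is zero for \<open>n = 2\<close>.
\<close>

definition block_mix :: "'s set \<Rightarrow> ('s \<Rightarrow> nat) \<Rightarrow> 's \<Rightarrow> 's \<Rightarrow> complex" where
  "block_mix S h y k = (if y = k then 1 else 0) +
     (if h y = h k then (\<i> - 1) / of_nat (card {y\<in>S. h y = h k}) else 0)"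

lemma block_mix_unitary:
  assumes "finite S" and k: "k \<in> S" "k' \<in> S"
  shows "(\<Sum>y\<in>S. block_mix S h y k * cnj (block_mix S h y k')) = (if k = k' then 1 else 0)"
    and "h y = h k \<Longrightarrow> block_mix S h y k \<noteq> 0"
    and "h y \<noteq> h k \<Longrightarrow> block_mix S h y k = 0"
proof -
  let ?U = "block_mix S h"
  define B where "B = {y\<in>S. h y = h k}"
  have B: "finite B" "card B > 0" "S \<inter> B = B" using assms by (auto simp: card_gt_0_iff B_def)
  define w :: complex where "w = (\<i> - 1) / of_nat (card B)"
  have w: "of_nat (card B) * (w * cnj w) + w + cnj w = 0"
    using B(2) by (simp add: w_def field_simps)
  show "(\<Sum>y\<in>S. ?U y k * cnj (?U y k')) = (if k = k' then 1 else 0)"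
  proof (cases "h k = h k'")
    case False
    then have "?U y k * cnj (?U y k') = 0" for y by (auto simp: block_mix_def)
    then show ?thesis using False by auto
  next
    case True
    have kB: "k \<in> B" "k' \<in> B" using True k by (auto simp: B_def)
    have U: "?U y k = (if y = k then 1 else 0) + (if y \<in> B then w else 0)"
      "?U y k' = (if y = k' then 1 else 0) + (if y \<in> B then w else 0)" if "y \<in> S" for y
      using that True by (simp_all add: block_mix_def w_def B_def)
    have "?U y k * cnj (?U y k') = (if y = k then if k = k' then 1 else 0 else 0)
          + (if y = k then cnj w else 0) + (if y = k' then w else 0)
          + (if y \<in> B then w * cnj w else 0)" if "y \<in> S" for y
      unfolding U[OF that] using kB by (cases "y = k"; cases "y = k'"; cases "y \<in> B") (auto simp: algebra_simps)
    then have "(\<Sum>y\<in>S. ?U y k * cnj (?U y k')) =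
       (\<Sum>y\<in>S. (if y = k then if k = k' then 1 else 0 else 0) + (if y = k then cnj w else 0)
          + (if y = k' then w else 0) + (if y \<in> B then w * cnj w else 0))"
      by (rule sum.cong[OF refl])
    also have "\<dots> = (if k = k' then 1 else 0) + cnj w + w + of_nat (card B) * (w * cnj w)"
      using k assms(1) B by (simp add: sum.distrib sum.If_cases)
    finally show ?thesis using w by (simp add: algebra_simps)
  qed
  show "h y = h k \<Longrightarrow> ?U y k \<noteq> 0"
    using B(2) by (auto simp: block_mix_def complex_eq_iff B_def)
  show "h y \<noteq> h k \<Longrightarrow> ?U y k = 0" by (auto simp: block_mix_def)
qed

text \<open>
  The arrays \<open>p\<close> and \<open>q\<close> are the arrays \<open>P\<close> and \<open>Q\<close> described at the beginning. Order at least 3 is what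
  makes the multiple of the all-ones vector visible in \<open>q\<close>.
\<close>

theorem composition:
  fixes x :: "'r \<times> 'r \<Rightarrow> 'x \<Rightarrow> complex" and K :: "'r \<times> 'r \<Rightarrow> 's"
    and m :: "nat \<Rightarrow> 't \<times> 't \<Rightarrow> 'z \<Rightarrow> complex"
  assumes bl: "blocked R X S x K h" and tm: "two_mates R' X' S' m L L'" and b: "card R' \<ge> 3"
  shows "\<exists>P Q. is_MCOQLS (card R * card R') P Q"
proof -
  have fin: "finite R" "finite X" "finite S" "finite R'" "finite X'" "finite S'"
    and card: "card X = card R" "card S = card R" "card X' = card R'" "card S' = card R'"
    using bl tm by (auto simp: blocked_def two_mates_def latin_def)
  have xq: "qarray R X x" and xK: "mate R X x K" and Kl: "latin R S K"
    and two: "\<And>k. k \<in> S \<Longrightarrow> \<exists>y\<in>S. y \<noteq> k \<and> h y = h k"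
    and xray: "\<And>c d. c \<in> R \<times> R \<Longrightarrow> d \<in> R \<times> R \<Longrightarrow> h (K c) = h (K d) \<Longrightarrow> same_ray X (x c) (x d) \<Longrightarrow> c = d"
    using bl unfolding blocked_def by blast+
  have mq: "\<And>g. qarray R' X' (m g)" and mL: "\<And>g. mate R' X' (m g) L" and mL': "\<And>g. mate R' X' (m g) L'"
    and Ll: "latin R' S' L" and Ll': "latin R' S' L'"
    and LL: "inj_on (\<lambda>c. (L c, L' c)) (R' \<times> R')"
    and mray: "\<And>g g' c d. c \<in> R' \<times> R' \<Longrightarrow> d \<in> R' \<times> R' \<Longrightarrow> same_ray X' (m g c) (m g' d) \<Longrightarrow> g = g' \<and> c = d"
    using tm unfolding two_mates_def by blast+
  have KS: "c \<in> R \<times> R \<Longrightarrow> K c \<in> S" for c using Kl unfolding latin_def by blast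
  have LS: "w \<in> R' \<times> R' \<Longrightarrow> L w \<in> S'" "w \<in> R' \<times> R' \<Longrightarrow> L' w \<in> S'" for w
    using Ll Ll' unfolding latin_def by blast+
  define U where "U = block_mix S h"
  note U = block_mix_unitary[OF fin(3), of _ _ h, folded U_def]
  define rep where "rep v = (SOME y. y \<in> S \<and> h y = v)" for v
  have rep: "rep (h k) \<in> S \<and> h (rep (h k)) = h k" if "k \<in> S" for k
    unfolding rep_def by (rule someI[of _ k]) (use that in simp)
  (* A block has at least two symbols, so both L and L' are used in it. *)
  define l where "l y w = (if y = rep (h y) then L w else L' w)" for y w
  have lS: "w \<in> R' \<times> R' \<Longrightarrow> l y w \<in> S'" for y w using LS by (auto simp: l_def)
  obtain e :: "'r \<times> 'r \<Rightarrow> nat" where e: "inj_on e (R \<times> R)"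
    using fin(1) finite_imp_inj_to_nat_seg by (metis finite_cartesian_product)
  define u where "u c = cis (1 / (real (e c) + 1))" for c
  have u1: "u c * cnj (u c) = 1" for c by (simp add: u_def cis_cnj cis_mult)
  have uinj: "c = d" if "c \<in> R \<times> R" "d \<in> R \<times> R" "u c = u d" for c d
  proof -
    have "e c = e d" using that cis_reciprocal_inj by (simp add: u_def)
    then show ?thesis using e that by (auto dest: inj_onD)
  qed
  let ?b = "of_nat (card R') :: complex"
  (* With this value, e_s \<mapsto> e_s + z c \<one> multiplies the vector of ones by the phase u c. *)
  define z where "z c = (u c - 1) / ?b" for c
  define p where "p = (\<lambda>((i, r), (j, s)) (a, a'). x (i, j) a * m (h (K (i, j))) (r, s) a')"
  define q where "q = (\<lambda>((i, r), (j, s)) (y, t).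
     U y (K (i, j)) * ((if t = l y (r, s) then 1 else 0) + z (i, j)))"
  have ipp: "ip (X \<times> X') (p ((i, r), (j, s))) (p ((i', r'), (j', s'))) =
      ip X (x (i, j)) (x (i', j')) * ip X' (m (h (K (i, j))) (r, s)) (m (h (K (i', j'))) (r', s'))"
    for i r j s i' r' j' s'
    by (simp add: p_def ip_tensor)
  have ipq: "ip (S \<times> S') (q ((i, r), (j, s))) (q ((i', r'), (j', s'))) =
     (\<Sum>y\<in>S. U y (K (i, j)) * cnj (U y (K (i', j'))) *
        ((if l y (r, s) = l y (r', s') then 1 else 0) + (u (i, j) * cnj (u (i', j')) - 1) / ?b))"
    if "(r, s) \<in> R' \<times> R'" "(r', s') \<in> R' \<times> R'" for i r j s i' r' j' s'
  proof -
    have G: "(\<Sum>t\<in>S'. ((if t = k then 1 else 0) + z c) * cnj ((if t = k' then 1 else 0) + z c')) =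
       (if k = k' then 1 else 0) + (u c * cnj (u c') - 1) / ?b"
      if "k \<in> S'" "k' \<in> S'" for k k' c c'
    proof -
      have "(\<Sum>t\<in>S'. ((if t = k then 1 else 0) + z c) * cnj ((if t = k' then 1 else 0) + z c')) =
        (\<Sum>t\<in>S'. (if t = k then if k = k' then 1 else 0 else 0) + (if t = k then cnj (z c') else 0)
           + (if t = k' then z c else 0) + z c * cnj (z c'))"
        by (rule sum.cong) (auto simp: algebra_simps)
      also have "\<dots> = (if k = k' then 1 else 0) + cnj (z c') + z c + ?b * (z c * cnj (z c'))"
        using that fin card by (simp add: sum.distrib)
      finally have "(\<Sum>t\<in>S'. ((if t = k then 1 else 0) + z c) * cnj ((if t = k' then 1 else 0) + z c')) =
        (if k = k' then 1 else 0) + (cnj (z c') + z c + ?b * (z c * cnj (z c')))"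
        by (simp only: add.assoc)
      moreover have "cnj (z c') + z c + ?b * (z c * cnj (z c')) = (u c * cnj (u c') - 1) / ?b"
        using b by (simp add: z_def field_simps)
      ultimately show ?thesis by simp
    qed
    have "ip (S \<times> S') (q ((i, r), (j, s))) (q ((i', r'), (j', s'))) =
       (\<Sum>y\<in>S. \<Sum>t\<in>S'. U y (K (i, j)) * cnj (U y (K (i', j'))) *
          (((if t = l y (r, s) then 1 else 0) + z (i, j)) * cnj ((if t = l y (r', s') then 1 else 0) + z (i', j'))))"
      unfolding ip_def q_def sum.cartesian_product by (rule sum.cong) (simp_all add: mult_ac split_def)
    also have "\<dots> = (\<Sum>y\<in>S. U y (K (i, j)) * cnj (U y (K (i', j'))) *
        ((if l y (r, s) = l y (r', s') then 1 else 0) + (u (i, j) * cnj (u (i', j')) - 1) / ?b))"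
      by (rule sum.cong[OF refl]) (simp only: sum_distrib_left[symmetric] G[OF lS[OF that(1)] lS[OF that(2)]])
    finally show ?thesis .
  qed
  define \<gamma> where "\<gamma> c d = (u c * cnj (u d) - 1) / ?b" for c d
  note ipq = ipq[folded \<gamma>_def]
  have \<gamma>0: "\<gamma> c c = 0" for c by (simp add: \<gamma>_def u1)
  have Usum: "(\<Sum>y\<in>S. U y k * cnj (U y k') * g) = (if k = k' then g else 0)"
    if "k \<in> S" "k' \<in> S" for k k' g
    using U(1)[OF that] by (simp add: sum_distrib_right[symmetric])
  have q_same: "ip (S \<times> S') (q ((i, r), (j, s))) (q ((i', r), (j', s)))
      = (if K (i, j) = K (i', j') then 1 + \<gamma> (i, j) (i', j') else 0)"
    if "(r, s) \<in> R' \<times> R'" "(i, j) \<in> R \<times> R" "(i', j') \<in> R \<times> R" for i r j s i' j'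
    using Usum KS that by (simp add: ipq[OF that(1) that(1)])
  have q_diff: "ip (S \<times> S') (q ((i, r), (j, s))) (q ((i', r'), (j', s')))
      = (if K (i, j) = K (i', j') then \<gamma> (i, j) (i', j') else 0)"
    if "(r, s) \<in> R' \<times> R'" "(r', s') \<in> R' \<times> R'" "(i, j) \<in> R \<times> R" "(i', j') \<in> R \<times> R"
      "L (r, s) \<noteq> L (r', s')" "L' (r, s) \<noteq> L' (r', s')" for i r j s i' r' j' s'
  proof -
    have "l y (r, s) \<noteq> l y (r', s')" for y using that by (simp add: l_def)
    then show ?thesis using Usum KS that by (simp add: ipq[OF that(1,2)])
  qed
  have q_block: "ip (S \<times> S') (q ((i, r), (j, s))) (q ((i', r'), (j', s'))) = 0"
    if "(r, s) \<in> R' \<times> R'" "(r', s') \<in> R' \<times> R'" "(i, j) \<in> R \<times> R" "(i', j') \<in> R \<times> R"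
      "h (K (i, j)) \<noteq> h (K (i', j'))" for i r j s i' r' j' s'
  proof -
    have "U y (K (i, j)) * cnj (U y (K (i', j'))) = 0" for y
      using U(3)[OF KS[OF that(3)] KS[OF that(4)]] U(3)[OF KS[OF that(4)] KS[OF that(3)]] that(5)
      by (cases "h y = h (K (i, j))") simp_all
    then show ?thesis by (simp add: ipq[OF that(1,2)])
  qed
  have pq: "qarray (R \<times> R') (X \<times> X') p"
    unfolding qarray_def
  proof (intro conjI ballI impI, goal_cases)
    case (1 c)
    then show ?case using qarray_norm[OF xq] qarray_norm[OF mq] by (auto simp: ipp)
  next
    case (2 c d)
    obtain i r j s where c_eq: "c = ((i, r), (j, s))" by (metis surj_pair)
    obtain i' r' j' s' where d_eq: "d = ((i', r'), (j', s'))" by (metis surj_pair)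
    note cd = c_eq d_eq
    show ?case
    proof (cases "(i, j) = (i', j')")
      case True
      then show ?thesis using 2 qarray_orthogonal[OF mq, of "(r, s)" "(r', s')"] by (auto simp: cd ipp)
    next
      case False
      then show ?thesis using 2 qarray_orthogonal[OF xq, of "(i, j)" "(i', j')"] by (auto simp: cd ipp)
    qed
  qed
  have qq: "qarray (R \<times> R') (S \<times> S') q"
    unfolding qarray_def
  proof (intro conjI ballI impI, goal_cases)
    case (1 c)
    then show ?case using q_same by (auto simp: \<gamma>0)
  next
    case (2 c d)
    obtain i r j s where c_eq: "c = ((i, r), (j, s))" by (metis surj_pair)
    obtain i' r' j' s' where d_eq: "d = ((i', r'), (j', s'))" by (metis surj_pair)
    note cd = c_eq d_eq
    have K: "(i, j) = (i', j') \<or> K (i, j) \<noteq> K (i', j')"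
      using 2 latinD[OF Kl, of "(i, j)" "(i', j')"] by (auto simp: cd)
    show ?case
    proof (cases "(r, s) = (r', s')")
      case True
      then show ?thesis using 2 K q_same[of r s i j i' j'] by (auto simp: cd)
    next
      case False
      then have "L (r, s) \<noteq> L (r', s')" "L' (r, s) \<noteq> L' (r', s')"
        using 2 latinD[OF Ll, of "(r, s)" "(r', s')"] latinD[OF Ll', of "(r, s)" "(r', s')"] by (auto simp: cd)
      then show ?thesis using 2 K q_diff[of r s r' s' i j i' j'] by (auto simp: cd \<gamma>0)
    qed
  qed
  have cross: "ip (X \<times> X') (p c) (p d) = 0 \<or> ip (S \<times> S') (q c) (q d) = 0"
    if c: "c \<in> (R \<times> R') \<times> (R \<times> R')" and d: "d \<in> (R \<times> R') \<times> (R \<times> R')" and "c \<noteq> d" for c d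
  proof -
    obtain i r j s where c_eq: "c = ((i, r), (j, s))" by (metis surj_pair)
    obtain i' r' j' s' where d_eq: "d = ((i', r'), (j', s'))" by (metis surj_pair)
    note cd = c_eq d_eq
    have mem: "(r, s) \<in> R' \<times> R'" "(r', s') \<in> R' \<times> R'" "(i, j) \<in> R \<times> R" "(i', j') \<in> R \<times> R"
      using c d by (auto simp: cd)
    consider (a) "(i, j) \<noteq> (i', j')" "K (i, j) = K (i', j')"
      | (b) "(r, s) = (r', s')" "K (i, j) \<noteq> K (i', j')"
      | (c) "(r, s) \<noteq> (r', s')" "(i, j) = (i', j') \<or> K (i, j) \<noteq> K (i', j')"
          "L (r, s) \<noteq> L (r', s')" "L' (r, s) \<noteq> L' (r', s')"
      | (d) "h (K (i, j)) \<noteq> h (K (i', j'))"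
      | (e) "(r, s) \<noteq> (r', s')" "h (K (i, j)) = h (K (i', j'))" "L (r, s) = L (r', s') \<or> L' (r, s) = L' (r', s')"
      using \<open>c \<noteq> d\<close> by (auto simp: cd)
    then show ?thesis
    proof cases
      case a
      then show ?thesis using mateD[OF xK mem(3,4)] by (simp add: cd ipp)
    next
      case b
      then show ?thesis using q_same[OF mem(1,3,4)] by (simp add: cd)
    next
      case c
      then show ?thesis using q_diff[OF mem c(3,4)] by (auto simp: cd \<gamma>0)
    next
      case d
      then show ?thesis using q_block[OF mem] by (simp add: cd)
    next
      case e
      then show ?thesis using mateD[OF mL mem(1,2)] mateD[OF mL' mem(1,2)] by (auto simp: cd ipp)
    qed
  qed
  have pray: "c = d"
    if c: "c \<in> (R \<times> R') \<times> (R \<times> R')" and d: "d \<in> (R \<times> R') \<times> (R \<times> R')"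
      and ray: "same_ray (X \<times> X') (p c) (p d)" for c d
  proof -
    obtain i r j s where c_eq: "c = ((i, r), (j, s))" by (metis surj_pair)
    obtain i' r' j' s' where d_eq: "d = ((i', r'), (j', s'))" by (metis surj_pair)
    note cd = c_eq d_eq
    have mem: "(r, s) \<in> R' \<times> R'" "(r', s') \<in> R' \<times> R'" "(i, j) \<in> R \<times> R" "(i', j') \<in> R \<times> R"
      using c d by (auto simp: cd)
    have "same_ray X (x (i, j)) (x (i', j')) \<and>
        same_ray X' (m (h (K (i, j))) (r, s)) (m (h (K (i', j'))) (r', s'))"
      using ray mem by (intro same_ray_tensor qarray_norm[OF xq] qarray_norm[OF mq]) (simp_all add: cd p_def)
    then show ?thesis using mray[OF mem(1,2)] xray[OF mem(3,4)] by (auto simp: cd)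
  qed
  have qray: "c = d"
    if c: "c \<in> (R \<times> R') \<times> (R \<times> R')" and d: "d \<in> (R \<times> R') \<times> (R \<times> R')"
      and ray: "same_ray (S \<times> S') (q c) (q d)" for c d
  proof -
    obtain i r j s where c_eq: "c = ((i, r), (j, s))" by (metis surj_pair)
    obtain i' r' j' s' where d_eq: "d = ((i', r'), (j', s'))" by (metis surj_pair)
    note cd = c_eq d_eq
    have mem: "(r, s) \<in> R' \<times> R'" "(r', s') \<in> R' \<times> R'" "(i, j) \<in> R \<times> R" "(i', j') \<in> R \<times> R"
      using c d by (auto simp: cd)
    let ?k = "K (i, j)" and ?k' = "K (i', j')"
    obtain \<theta> where \<theta>: "\<And>y t. y \<in> S \<Longrightarrow> t \<in> S' \<Longrightarrow>
        U y ?k' * ((if t = l y (r', s') then 1 else 0) + z (i', j')) =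
        cis \<theta> * (U y ?k * ((if t = l y (r, s) then 1 else 0) + z (i, j)))"
      using ray unfolding same_ray_def cd q_def by fastforce
    have eq: "l y (r, s) = l y (r', s') \<and> z (i, j) = z (i', j')" if y: "y \<in> S" "h y = h ?k" for y
    proof -
      have U0: "U y ?k \<noteq> 0" using U(2)[OF KS KS] mem y by blast
      let ?l = "l y (r, s)" and ?l' = "l y (r', s')"
      have l: "?l \<in> S'" "?l' \<in> S'" using lS mem by auto
      (* A third coordinate t exists since the order is at least 3; there only the multiple of \<one> is visible. *)
      have "\<not> S' \<subseteq> {?l, ?l'}"
      proof
        assume "S' \<subseteq> {?l, ?l'}"
        then have "card S' \<le> card {?l, ?l'}" by (intro card_mono) auto
        also have "\<dots> \<le> 2" by (simp add: card_insert_if)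
        finally show False using card b by simp
      qed
      then obtain t where t: "t \<in> S'" "t \<noteq> ?l" "t \<noteq> ?l'" by blast
      have ll: "?l = ?l'"
      proof (rule ccontr)
        assume ne: "?l \<noteq> ?l'"
        have "cis \<theta> * (U y ?k * (1 + z (i, j))) = cis \<theta> * (U y ?k * z (i, j))"
          using \<theta>[OF y(1) l(1)] \<theta>[OF y(1) t(1)] t ne by simp
        then show False using U0 by simp
      qed
      have e1: "U y ?k' * (1 + z (i', j')) = cis \<theta> * (U y ?k * (1 + z (i, j)))"
        using \<theta>[OF y(1) l(1)] ll by simp
      have e2: "U y ?k' * z (i', j') = cis \<theta> * (U y ?k * z (i, j))"
        using \<theta>[OF y(1) t(1)] t by simp
      have "U y ?k' = cis \<theta> * U y ?k" using e1 e2 by (simp add: algebra_simps)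
      then show ?thesis using e2 U0 ll by simp
    qed
    have "rep (h ?k) \<in> S" "h (rep (h ?k)) = h ?k" using rep KS mem by blast+
    then have L1: "L (r, s) = L (r', s')" and z1: "z (i, j) = z (i', j')"
      using eq[of "rep (h ?k)"] by (simp_all add: l_def)
    obtain y where y: "y \<in> S" "y \<noteq> rep (h ?k)" "h y = h ?k"
      using two[of "rep (h ?k)"] rep[OF KS[OF mem(3)]] by auto
    then have "L' (r, s) = L' (r', s')"
      using eq[of y] by (simp add: l_def)
    with L1 have "(r, s) = (r', s')"
      by (intro inj_onD[OF LL _ mem(1,2)]) simp
    moreover have "u (i, j) = u (i', j')" using z1 b by (simp add: z_def)
    then have "(i, j) = (i', j')" by (rule uinj[OF mem(3,4)])
    ultimately show ?thesis by (simp add: cd)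
  qed
  have "mc_pair (card R * card R') (R \<times> R') (X \<times> X') (S \<times> S') p q"
    unfolding mc_pair_def
  proof (intro conjI ballI impI pq qq)
    show "ip (X \<times> X') (p c) (p d) = 0 \<or> ip (S \<times> S') (q c) (q d) = 0"
      if "c \<in> (R \<times> R') \<times> (R \<times> R')" "d \<in> (R \<times> R') \<times> (R \<times> R')" "c \<noteq> d" for c d
      using that by (rule cross)
    show "c = d" if "c \<in> (R \<times> R') \<times> (R \<times> R')" "d \<in> (R \<times> R') \<times> (R \<times> R')"
      "same_ray (X \<times> X') (p c) (p d)" for c d
      using that by (rule pray)
    show "c = d" if "c \<in> (R \<times> R') \<times> (R \<times> R')" "d \<in> (R \<times> R') \<times> (R \<times> R')"
      "same_ray (S \<times> S') (q c) (q d)" for c d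
      using that by (rule qray)
  qed (use fin card in \<open>simp_all add: card_cartesian_product\<close>)
  then show ?thesis by (rule mc_pair_imp_MCOQLS)
qed
text \<open>
  The carriers are initial segments of the natural numbers, so that orders can be multiplied by induction without a change of type.
\<close>

definition mated :: "nat \<Rightarrow> bool" where
  "mated q \<longleftrightarrow> (\<exists>m L L'. two_mates {..<q} {..<q} ({..<q} :: nat set) (m :: nat \<Rightarrow> nat \<times> nat \<Rightarrow> nat \<Rightarrow> complex) L L')"

lemma two_mates_imp_mated:
  assumes t: "two_mates R X S m L L'"
  shows "mated (card R)"
proof -
  let ?q = "card R" and ?I = "{..<card R}"
  have fin: "finite R" "finite X" "finite S" and card: "card X = ?q" "card S = ?q"
    and LS: "\<And>c. c \<in> R \<times> R \<Longrightarrow> L c \<in> S" "\<And>c. c \<in> R \<times> R \<Longrightarrow> L' c \<in> S"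
    and lat: "\<And>c d. c \<in> R \<times> R \<Longrightarrow> d \<in> R \<times> R \<Longrightarrow> c \<noteq> d \<Longrightarrow> fst c = fst d \<or> snd c = snd d \<Longrightarrow> L c \<noteq> L d"
      "\<And>c d. c \<in> R \<times> R \<Longrightarrow> d \<in> R \<times> R \<Longrightarrow> c \<noteq> d \<Longrightarrow> fst c = fst d \<or> snd c = snd d \<Longrightarrow> L' c \<noteq> L' d"
    and LL: "inj_on (\<lambda>c. (L c, L' c)) (R \<times> R)"
    and qa: "\<And>g. qarray R X (m g)" and ma: "\<And>g. mate R X (m g) L" "\<And>g. mate R X (m g) L'"
    and ray: "\<And>g g' c d. c \<in> R \<times> R \<Longrightarrow> d \<in> R \<times> R \<Longrightarrow> same_ray X (m g c) (m g' d) \<Longrightarrow> g = g' \<and> c = d"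
    using t unfolding two_mates_def latin_def by blast+
  have q0: "ip X (m g c) (m g d) = 0"
    if "c \<in> R \<times> R" "d \<in> R \<times> R" "c \<noteq> d" "fst c = fst d \<or> snd c = snd d" for g c d
    using qa[of g] that unfolding qarray_def by blast
  have m0: "ip X (m g c) (m g d) = 0" if "mate R X (m g) J" "c \<in> R \<times> R" "d \<in> R \<times> R" "c \<noteq> d" "J c = J d"
    for g J c d
    using that unfolding mate_def by blast
  obtain \<rho> where \<rho>: "bij_betw \<rho> ?I R" using fin by (metis ex_bij_betw_nat_finite atLeast0LessThan)
  obtain \<xi> where \<xi>: "bij_betw \<xi> ?I X" using fin card by (metis ex_bij_betw_nat_finite atLeast0LessThan)
  obtain \<sigma> where \<sigma>: "bij_betw \<sigma> S ?I" using fin card by (metis ex_bij_betw_finite_nat atLeast0LessThan)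
  define f where "f c = (\<rho> (fst c), \<rho> (snd c))" for c
  have f: "f c \<in> R \<times> R" if "c \<in> ?I \<times> ?I" for c using \<rho> that by (auto simp: f_def bij_betw_def)
  have \<rho>i: "\<rho> i = \<rho> j \<longleftrightarrow> i = j" if "i \<in> ?I" "j \<in> ?I" for i j
    using \<rho> that by (auto simp: bij_betw_def inj_on_def)
  have fi: "fst (f c) = fst (f d) \<longleftrightarrow> fst c = fst d" "snd (f c) = snd (f d) \<longleftrightarrow> snd c = snd d" "f c = f d \<longleftrightarrow> c = d"
    if "c \<in> ?I \<times> ?I" "d \<in> ?I \<times> ?I" for c d
    using that \<rho>i by (auto simp: f_def prod_eq_iff)
  have \<sigma>i: "\<sigma> s = \<sigma> s' \<longleftrightarrow> s = s'" if "s \<in> S" "s' \<in> S" for s s'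
    using \<sigma> that by (auto simp: bij_betw_def inj_on_def)
  have \<sigma>I: "\<sigma> s \<in> ?I" if "s \<in> S" for s using \<sigma> that by (auto simp: bij_betw_def)
  define M where "M g c k = m g (f c) (\<xi> k)" for g c k
  have ipM: "ip ?I (M g c) (M g d) = ip X (m g (f c)) (m g (f d))" for g c d
    unfolding M_def by (rule ip_reindex[OF \<xi>])
  have rayM: "same_ray X (m g (f c)) (m g' (f d))" if r: "same_ray ?I (M g c) (M g' d)" for g g' c d
  proof -
    obtain \<theta> where "\<And>k. k \<in> ?I \<Longrightarrow> M g' d k = cis \<theta> * M g c k" using r unfolding same_ray_def by blast
    moreover have "X = \<xi> ` ?I" using \<xi> by (simp add: bij_betw_def)
    ultimately show ?thesis unfolding same_ray_def M_def by blast
  qed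
  have "two_mates ?I ?I ?I M (\<lambda>c. \<sigma> (L (f c))) (\<lambda>c. \<sigma> (L' (f c)))"
    unfolding two_mates_def
  proof (intro conjI allI ballI impI)
    show "latin ?I ?I (\<lambda>c. \<sigma> (L (f c)))" "latin ?I ?I (\<lambda>c. \<sigma> (L' (f c)))"
      unfolding latin_def using lat LS f fi \<sigma>i \<sigma>I by (simp_all del: lessThan_iff)
    show "inj_on (\<lambda>c. (\<sigma> (L (f c)), \<sigma> (L' (f c)))) (?I \<times> ?I)"
    proof (rule inj_onI)
      fix c d assume "c \<in> ?I \<times> ?I" "d \<in> ?I \<times> ?I" "(\<sigma> (L (f c)), \<sigma> (L' (f c))) = (\<sigma> (L (f d)), \<sigma> (L' (f d)))"
      moreover from this have "f c = f d"
        by (intro inj_onD[OF LL, of "f c" "f d"]) (use f LS \<sigma>i in auto)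
      ultimately show "c = d" using fi(3) by blast
    qed
    show "qarray ?I ?I (M g)" for g
      unfolding qarray_def ipM
    proof (intro conjI ballI impI)
      fix c assume "c \<in> ?I \<times> ?I"
      then show "ip X (m g (f c)) (m g (f c)) = 1"
        using qa[of g] f unfolding qarray_def by blast
    next
      fix c d assume c: "c \<in> ?I \<times> ?I" "d \<in> ?I \<times> ?I" and "c \<noteq> d" "fst c = fst d \<or> snd c = snd d"
      then have "f c \<noteq> f d" "fst (f c) = fst (f d) \<or> snd (f c) = snd (f d)" by (simp_all only: fi[OF c] not_False_eq_True)
      then show "ip X (m g (f c)) (m g (f d)) = 0"
        by (rule q0[OF f[OF c(1)] f[OF c(2)]])
    qed
    have mM: "mate ?I ?I (M g) (\<lambda>c. \<sigma> (J (f c)))"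
      if J: "mate R X (m g) J" and JS: "\<And>c. c \<in> R \<times> R \<Longrightarrow> J c \<in> S" for g J
      unfolding mate_def ipM
    proof (intro ballI impI)
      fix c d assume c: "c \<in> ?I \<times> ?I" "d \<in> ?I \<times> ?I" and "c \<noteq> d" "\<sigma> (J (f c)) = \<sigma> (J (f d))"
      then have "f c \<noteq> f d" "J (f c) = J (f d)" using fi(3)[OF c] \<sigma>i[OF JS[OF f[OF c(1)]] JS[OF f[OF c(2)]]] by simp_all
      then show "ip X (m g (f c)) (m g (f d)) = 0"
        by (rule m0[OF J f[OF c(1)] f[OF c(2)]])
    qed
    show "mate ?I ?I (M g) (\<lambda>c. \<sigma> (L (f c)))" "mate ?I ?I (M g) (\<lambda>c. \<sigma> (L' (f c)))" for g
      using LS by (intro mM ma; blast)+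
    fix g g' c d assume c: "c \<in> ?I \<times> ?I" "d \<in> ?I \<times> ?I" "same_ray ?I (M g c) (M g' d)"
    then have "g = g' \<and> f c = f d" by (intro ray f rayM)
    then show "g = g'" "c = d" using fi(3)[OF c(1,2)] by blast+
  qed simp_all
  then show ?thesis unfolding mated_def by blast
qed

text \<open>
  Only the first factor has to vary with the index of the sequence.
\<close>

lemma mated_product:
  assumes "mated a" "mated b"
  shows "mated (a * b)"
proof -
  let ?A = "{..<a}" and ?B = "{..<b}"
  obtain m and L L' :: "nat \<times> nat \<Rightarrow> nat" where t: "two_mates ?A ?A ?A (m :: nat \<Rightarrow> nat \<times> nat \<Rightarrow> nat \<Rightarrow> complex) L L'"
    using assms(1) unfolding mated_def by blast
  obtain u and K K' :: "nat \<times> nat \<Rightarrow> nat" where s: "two_mates ?B ?B ?B (u :: nat \<Rightarrow> nat \<times> nat \<Rightarrow> nat \<Rightarrow> complex) K K'"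
    using assms(2) unfolding mated_def by blast
  have t': "latin ?A ?A L" "latin ?A ?A L'" "inj_on (\<lambda>c. (L c, L' c)) (?A \<times> ?A)"
    "\<And>k. qarray ?A ?A (m k)" "\<And>k. mate ?A ?A (m k) L" "\<And>k. mate ?A ?A (m k) L'"
    "\<And>k k' c d. c \<in> ?A \<times> ?A \<Longrightarrow> d \<in> ?A \<times> ?A \<Longrightarrow> same_ray ?A (m k c) (m k' d) \<Longrightarrow> k = k' \<and> c = d"
    using t unfolding two_mates_def by blast+
  have s': "latin ?B ?B K" "latin ?B ?B K'" "inj_on (\<lambda>c. (K c, K' c)) (?B \<times> ?B)"
    "\<And>k. qarray ?B ?B (u k)" "\<And>k. mate ?B ?B (u k) K" "\<And>k. mate ?B ?B (u k) K'"
    "\<And>k k' c d. c \<in> ?B \<times> ?B \<Longrightarrow> d \<in> ?B \<times> ?B \<Longrightarrow> same_ray ?B (u k c) (u k' d) \<Longrightarrow> k = k' \<and> c = d"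
    using s unfolding two_mates_def by blast+
  have "two_mates (?A \<times> ?B) (?A \<times> ?B) (?A \<times> ?B) (\<lambda>k. tensor_array (m k) (u 0))
      (\<lambda>c. (L (pr1 c), K (pr2 c))) (\<lambda>c. (L' (pr1 c), K' (pr2 c)))"
    unfolding two_mates_def
  proof (intro conjI allI ballI impI latin_product mate_product qarray_product t'(1,2,4-6) s'(1,2,4-6))
    show "inj_on (\<lambda>c. ((L (pr1 c), K (pr2 c)), (L' (pr1 c), K' (pr2 c)))) ((?A \<times> ?B) \<times> (?A \<times> ?B))"
    proof (rule inj_onI)
      fix c d assume cd: "c \<in> (?A \<times> ?B) \<times> (?A \<times> ?B)" "d \<in> (?A \<times> ?B) \<times> (?A \<times> ?B)"
        "((L (pr1 c), K (pr2 c)), (L' (pr1 c), K' (pr2 c))) = ((L (pr1 d), K (pr2 d)), (L' (pr1 d), K' (pr2 d)))"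
      have "pr1 c = pr1 d" by (rule inj_onD[OF t'(3) _ pr_mem(1)[OF cd(1)] pr_mem(1)[OF cd(2)]]) (use cd in simp)
      moreover have "pr2 c = pr2 d" by (rule inj_onD[OF s'(3) _ pr_mem(2)[OF cd(1)] pr_mem(2)[OF cd(2)]]) (use cd in simp)
      ultimately show "c = d" by (simp only: pr_eq_iff)
    qed
    fix k k' c d assume cd: "c \<in> (?A \<times> ?B) \<times> (?A \<times> ?B)" "d \<in> (?A \<times> ?B) \<times> (?A \<times> ?B)"
      and r: "same_ray (?A \<times> ?B) (tensor_array (m k) (u 0) c) (tensor_array (m k') (u 0) d)"
    have "same_ray ?A (m k (pr1 c)) (m k' (pr1 d)) \<and> same_ray ?B (u 0 (pr2 c)) (u 0 (pr2 d))"
      by (rule same_ray_tensor_array[OF t'(4) t'(4) s'(4) s'(4) cd r])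
    then have "k = k' \<and> pr1 c = pr1 d" "pr2 c = pr2 d"
      using t'(7)[OF pr_mem(1)[OF cd(1)] pr_mem(1)[OF cd(2)]] s'(7)[OF pr_mem(2)[OF cd(1)] pr_mem(2)[OF cd(2)]] by blast+
    then show "k = k'" "c = d" by (simp_all only: pr_eq_iff)
  qed (simp_all add: card_cartesian_product)
  from two_mates_imp_mated[OF this] show ?thesis by (simp add: card_cartesian_product)
qed

lemma blocked_imp_MCOQLS:
  assumes b: "blocked R X S x K h" and "mated q" "q \<ge> 3"
  shows "\<exists>P Q. is_MCOQLS (card R * q) P Q"
proof -
  let ?A = "{..<q}"
  obtain m and L L' :: "nat \<times> nat \<Rightarrow> nat" where t: "two_mates ?A ?A ?A (m :: nat \<Rightarrow> nat \<times> nat \<Rightarrow> nat \<Rightarrow> complex) L L'"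
    using assms(2) unfolding mated_def by blast
  show ?thesis using composition[OF b t] assms(3) by simp
qed

section \<open>Two mates from characters of an abelian group\<close>

definition grid :: "int \<Rightarrow> int \<Rightarrow> (int \<times> int) set" where
  "grid m n = {0..<m} \<times> {0..<n}"

definition red :: "int \<Rightarrow> int \<Rightarrow> int \<times> int \<Rightarrow> int \<times> int" where
  "red m n y = (fst y mod m, snd y mod n)"

text \<open>
  The group is \<open>\<int>\<^sub>m \<times> \<int>\<^sub>n\<close>, represented by residues, and the character with label \<open>a\<close> sends \<open>y\<close> to
  the power of a primitive \<open>m n\<close>-th root of unity with this exponent. Exponents of
  characters become linear integer expressions, and equality of characters becomes divisibility by \<open>m n\<close>.
\<close>

definition pairing :: "int \<Rightarrow> int \<Rightarrow> int \<times> int \<Rightarrow> int \<times> int \<Rightarrow> int" where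
  "pairing m n a y = n * (fst a * fst y) + m * (snd a * snd y)"

definition root_pow :: "int \<Rightarrow> int \<Rightarrow> complex" where
  "root_pow N k = cis (2 * pi * of_int k / of_int N)"

lemma root_pow_add: "root_pow N (j + k) = root_pow N j * root_pow N k"
  by (simp add: root_pow_def cis_mult add_divide_distrib distrib_left)

lemma cnj_root_pow: "cnj (root_pow N k) = root_pow N (- k)"
  by (simp add: root_pow_def cis_cnj)

lemma root_pow_eq_1_iff:
  assumes "N > 0"
  shows "root_pow N k = 1 \<longleftrightarrow> N dvd k"
proof
  assume "root_pow N k = 1"
  then have "cos (2 * pi * of_int k / of_int N) = 1" by (simp add: root_pow_def complex_eq_iff)
  then obtain j :: int where "2 * pi * of_int k / of_int N = of_int j * 2 * pi"
    by (auto simp: cos_one_2pi_int)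
  then have "of_int k = (of_int (N * j) :: real)" using assms by (simp add: field_simps)
  then show "N dvd k" by (simp only: of_int_eq_iff) simp
next
  assume "N dvd k"
  then obtain j where "k = N * j" by auto
  then have "2 * pi * of_int k / of_int N = 2 * pi * of_int j" using assms by simp
  then show "root_pow N k = 1" by (simp add: root_pow_def cis_multiple_2pi)
qed

lemma root_pow_eq_iff:
  assumes "N > 0"
  shows "root_pow N j = root_pow N k \<longleftrightarrow> N dvd j - k"
proof -
  have "root_pow N j = root_pow N (j - k) * root_pow N k"
    using root_pow_add[of N "j - k" k] by simp
  moreover have "root_pow N k \<noteq> 0" by (simp add: root_pow_def)
  ultimately show ?thesis using root_pow_eq_1_iff[OF assms, of "j - k"] by simp
qed

lemma root_pow_power_N: "N > 0 \<Longrightarrow> root_pow (int N) k ^ N = 1"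
  unfolding root_pow_def DeMoivre by (simp add: cis_multiple_2pi)

lemma pairing_red_right: "m * n dvd pairing m n a (red m n y) - pairing m n a y"
proof -
  have "pairing m n a (red m n y) - pairing m n a y
      = (m * n) * (- fst a * (fst y div m) - snd a * (snd y div n))"
    by (simp add: pairing_def red_def minus_mult_div_eq_mod[symmetric] algebra_simps)
  then show ?thesis by simp
qed

lemma pairing_commute: "pairing m n a y = pairing m n y a"
  by (simp add: pairing_def mult.commute)

lemma pairing_red_left: "m * n dvd pairing m n (red m n a) y - pairing m n a y"
  using pairing_red_right[of m n y a] by (simp add: pairing_commute)

lemma pairing_add: "pairing m n a (y + z) = pairing m n a y + pairing m n a z"
  by (simp add: pairing_def algebra_simps)

lemma pairing_diff_left: "pairing m n (a - b) y = pairing m n a y - pairing m n b y"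
  by (simp add: pairing_def algebra_simps)

lemma red_eq_iff: "red m n y = red m n z \<longleftrightarrow> m dvd fst y - fst z \<and> n dvd snd y - snd z"
  by (simp add: red_def mod_eq_dvd_iff)

lemma red_grid: "m > 0 \<Longrightarrow> n > 0 \<Longrightarrow> red m n y \<in> grid m n"
  by (simp add: red_def grid_def)

lemma red_id: "y \<in> grid m n \<Longrightarrow> red m n y = y"
  by (auto simp: red_def grid_def)

lemma grid_eq_iff:
  assumes "y \<in> grid m n" "z \<in> grid m n"
  shows "y = z \<longleftrightarrow> m dvd fst y - fst z \<and> n dvd snd y - snd z"
  using red_eq_iff[of m n y z] red_id[OF assms(1)] red_id[OF assms(2)] by simp

lemma finite_grid: "finite (grid m n)" by (simp add: grid_def)

lemma card_grid: "m > 0 \<Longrightarrow> n > 0 \<Longrightarrow> card (grid m n) = nat (m * n)"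
  by (simp add: grid_def card_cartesian_product nat_mult_distrib)

text \<open>
  A translation by an element where the character is not 1 multiplies the sum by a factor other
  than 1, but it only permutes the summands.
\<close>

lemma sum_root_pairing:
  assumes mn: "m > 0" "n > 0" and a: "\<not> (m dvd fst a \<and> n dvd snd a)"
  shows "(\<Sum>y\<in>grid m n. root_pow (m * n) (pairing m n a y)) = 0"
proof -
  let ?s = "\<Sum>y\<in>grid m n. root_pow (m * n) (pairing m n a y)"
  have "\<exists>z. \<not> m * n dvd pairing m n a z"
  proof (cases "m dvd fst a")
    case False
    have "pairing m n a (1, 0) = fst a * n" by (simp add: pairing_def)
    then have "\<not> m * n dvd pairing m n a (1, 0)" using mn False by simp
    then show ?thesis by blast
  next
    case True
    have "pairing m n a (0, 1) = m * snd a" by (simp add: pairing_def)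
    then have "\<not> m * n dvd pairing m n a (0, 1)" using mn a True by simp
    then show ?thesis by blast
  qed
  then obtain z where z: "\<not> m * n dvd pairing m n a z" by blast
  let ?t = "\<lambda>y. red m n (y + z)"
  have "inj_on ?t (grid m n)"
    by (rule inj_onI) (simp add: red_eq_iff grid_eq_iff)
  moreover have "?t ` grid m n \<subseteq> grid m n" using mn by (auto intro: red_grid)
  ultimately have "bij_betw ?t (grid m n) (grid m n)"
    using endo_inj_surj[OF finite_grid] by (simp add: bij_betw_def)
  then have "?s = (\<Sum>y\<in>grid m n. root_pow (m * n) (pairing m n a (?t y)))"
    by (rule sum.reindex_bij_betw[symmetric])
  also have "\<dots> = (\<Sum>y\<in>grid m n. root_pow (m * n) (pairing m n a z) * root_pow (m * n) (pairing m n a y))"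
  proof (rule sum.cong[OF refl])
    fix y
    have "root_pow (m * n) (pairing m n a (?t y)) = root_pow (m * n) (pairing m n a (y + z))"
      using mn pairing_red_right by (simp add: root_pow_eq_iff)
    then show "root_pow (m * n) (pairing m n a (?t y)) =
        root_pow (m * n) (pairing m n a z) * root_pow (m * n) (pairing m n a y)"
      by (simp add: pairing_add root_pow_add mult.commute)
  qed
  also have "\<dots> = root_pow (m * n) (pairing m n a z) * ?s" by (simp add: sum_distrib_left)
  finally have "(1 - root_pow (m * n) (pairing m n a z)) * ?s = 0" by (simp add: algebra_simps)
  moreover have "root_pow (m * n) (pairing m n a z) \<noteq> 1" using z mn by (simp add: root_pow_eq_1_iff)
  ultimately show ?thesis by simp
qed

text \<open>
  The index \<open>g\<close> only changes the phase of the coordinate \<open>z\<close>, by the angle \<open>1 / (m n (g + 1))\<close>. Inner products inside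
  one array do not see this phase; and since all other factors are \<open>m n\<close>-th roots of unity, the \<open>m n\<close>-th power of
  the coordinate still shows \<open>g\<close>.
\<close>

definition phase_array ::
    "int \<Rightarrow> int \<Rightarrow> (int \<times> int \<Rightarrow> int \<times> int) \<Rightarrow> int \<times> int \<Rightarrow> nat \<Rightarrow>
     (int \<times> int) \<times> (int \<times> int) \<Rightarrow> int \<times> int \<Rightarrow> complex" where
  "phase_array m n \<pi> z g c y =
     (if y = z then cis (1 / (of_int (m * n) * (real g + 1))) else 1) *
     root_pow (m * n) (pairing m n (fst c) (\<pi> y) + pairing m n (snd c) y) / of_real (sqrt (of_int (m * n)))"

definition shifted :: "int \<Rightarrow> int \<Rightarrow> (int \<times> int \<Rightarrow> int \<times> int) \<Rightarrow> (int \<times> int) \<times> (int \<times> int) \<Rightarrow> int \<times> int" where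
  "shifted m n T c = red m n (snd c - T (fst c))"

lemma ip_phase_array:
  assumes mn: "m > 0" "n > 0"
  shows "ip (grid m n) (phase_array m n \<pi> z g c) (phase_array m n \<pi> z g d) =
    (\<Sum>y\<in>grid m n. root_pow (m * n) (pairing m n (fst c - fst d) (\<pi> y) + pairing m n (snd c - snd d) y))
      / of_int (m * n)"
proof -
  have s: "complex_of_real (sqrt (of_int (m * n))) * complex_of_real (sqrt (of_int (m * n))) = of_int (m * n)"
    using mn by (simp only: of_real_mult[symmetric]) simp
  have "phase_array m n \<pi> z g c y * cnj (phase_array m n \<pi> z g d y) =
     root_pow (m * n) (pairing m n (fst c - fst d) (\<pi> y) + pairing m n (snd c - snd d) y) / of_int (m * n)" for y
  proof -
    let ?u = "if y = z then cis (1 / (of_int (m * n) * (real g + 1))) else 1"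
    let ?r = "root_pow (m * n)"
    let ?k = "\<lambda>c. pairing m n (fst c) (\<pi> y) + pairing m n (snd c) y"
    let ?s = "complex_of_real (sqrt (of_int (m * n)))"
    have "phase_array m n \<pi> z g c y * cnj (phase_array m n \<pi> z g d y) =
       (?u * ?r (?k c) / ?s) * cnj (?u * ?r (?k d) / ?s)"
      by (simp only: phase_array_def)
    also have "\<dots> = (?u * cnj ?u) * (?r (?k c) * cnj (?r (?k d))) / (?s * ?s)"
      by simp
    also have "?u * cnj ?u = 1" by (simp add: cis_cnj cis_mult)
    also have "?r (?k c) * cnj (?r (?k d)) = ?r (?k c + - ?k d)"
      unfolding cnj_root_pow by (rule root_pow_add[symmetric])
    also have "?k c + - ?k d = pairing m n (fst c - fst d) (\<pi> y) + pairing m n (snd c - snd d) y"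
      by (simp add: pairing_diff_left)
    finally show ?thesis by (simp only: s mult_1)
  qed
  then show ?thesis by (simp add: ip_def sum_divide_distrib)
qed

lemma phase_array_qarray:
  assumes mn: "m > 0" "n > 0" and \<pi>: "bij_betw \<pi> (grid m n) (grid m n)"
  shows "qarray (grid m n) (grid m n) (phase_array m n \<pi> z g)"
  unfolding qarray_def
proof (intro conjI ballI impI)
  fix c
  have "root_pow (m * n) 0 = 1" by (simp add: root_pow_def)
  moreover have "of_nat (nat (m * n)) = (of_int (m * n) :: complex)" using mn by simp
  ultimately show "ip (grid m n) (phase_array m n \<pi> z g c) (phase_array m n \<pi> z g c) = 1"
    using mn by (simp add: ip_phase_array pairing_def card_grid)
next
  fix c d assume cd: "c \<in> grid m n \<times> grid m n" "d \<in> grid m n \<times> grid m n" "c \<noteq> d" "fst c = fst d \<or> snd c = snd d"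
  show "ip (grid m n) (phase_array m n \<pi> z g c) (phase_array m n \<pi> z g d) = 0"
  proof (cases "fst c = fst d")
    case True
    then have "snd c \<noteq> snd d" using cd by (auto simp: prod_eq_iff)
    then have "\<not> (m dvd fst (snd c - snd d) \<and> n dvd snd (snd c - snd d))"
      using cd grid_eq_iff[of "snd c" m n "snd d"] by auto
    from sum_root_pairing[OF mn this] show ?thesis
      using True by (simp add: ip_phase_array[OF mn] pairing_def)
  next
    case False
    then have "\<not> (m dvd fst (fst c - fst d) \<and> n dvd snd (fst c - fst d))"
      using cd grid_eq_iff[of "fst c" m n "fst d"] by auto
    from sum_root_pairing[OF mn this]
    have "(\<Sum>y\<in>grid m n. root_pow (m * n) (pairing m n (fst c - fst d) (\<pi> y))) = 0"
      using sum.reindex_bij_betw[OF \<pi>, of "\<lambda>y. root_pow (m * n) (pairing m n (fst c - fst d) y)"] by simp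
    then show ?thesis using False cd by (simp add: ip_phase_array[OF mn] pairing_def)
  qed
qed

lemma shifted_latin:
  assumes mn: "m > 0" "n > 0" and inj: "inj_on (\<lambda>a. red m n (T a)) (grid m n)"
  shows "latin (grid m n) (grid m n) (shifted m n T)"
  unfolding latin_def
proof (intro conjI ballI impI)
  fix c d assume cd: "c \<in> grid m n \<times> grid m n" "d \<in> grid m n \<times> grid m n" "c \<noteq> d" "fst c = fst d \<or> snd c = snd d"
  show "shifted m n T c \<noteq> shifted m n T d"
  proof
    assume eq: "shifted m n T c = shifted m n T d"
    have "c = d"
    proof (cases "fst c = fst d")
      case True
      with eq have "red m n (snd c) = red m n (snd d)" by (simp add: shifted_def red_eq_iff)
      then have "snd c = snd d" using cd by (auto simp: red_id)
      with True show ?thesis by (rule prod_eqI)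
    next
      case False
      then have s: "snd c = snd d" using cd by blast
      with eq have "red m n (T (fst d)) = red m n (T (fst c))" by (simp add: shifted_def red_eq_iff)
      then have "fst d = fst c" by (rule inj_onD[OF inj]) (use cd in auto)
      with False show ?thesis by simp
    qed
    with cd show False by simp
  qed
qed (use mn in \<open>auto simp: finite_grid shifted_def intro: red_grid\<close>)

text \<open>
  If \<open>d - T a\<close> agrees on two cells, then the differences \<open>\<alpha>\<close> and \<open>\<delta>\<close> of the labels satisfy \<open>\<delta> = T \<alpha>\<close>. Since \<open>T\<close> is
  self-adjoint, \<open>\<langle>\<alpha>, \<pi> y\<rangle> + \<langle>\<delta>, y\<rangle> = \<langle>\<alpha>, \<pi> y + T y\<rangle>\<close>, and the bijection \<open>\<pi> + T\<close> turns the inner product into the full sum of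
  the nontrivial character \<open>\<alpha>\<close>.
\<close>

lemma phase_array_mate:
  assumes mn: "m > 0" "n > 0" and T: "\<And>a y. pairing m n a (T y) = pairing m n (T a) y"
    and bij: "bij_betw (\<lambda>y. red m n (\<pi> y + T y)) (grid m n) (grid m n)"
  shows "mate (grid m n) (grid m n) (phase_array m n \<pi> z g) (shifted m n T)"
  unfolding mate_def
proof (intro ballI impI)
  fix c d assume cd: "c \<in> grid m n \<times> grid m n" "d \<in> grid m n \<times> grid m n" "c \<noteq> d"
    and eq: "shifted m n T c = shifted m n T d"
  let ?r = "root_pow (m * n)" and ?f = "\<lambda>y. red m n (\<pi> y + T y)"
  let ?a = "fst c - fst d" and ?d = "snd c - snd d"
  have N: "m * n > 0" using mn by simp
  have "\<not> (m dvd fst ?a \<and> n dvd snd ?a)"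
  proof
    assume "m dvd fst ?a \<and> n dvd snd ?a"
    then have 1: "fst c = fst d" using cd grid_eq_iff[of "fst c" m n "fst d"] by auto
    with eq have "red m n (snd c) = red m n (snd d)" by (simp add: shifted_def red_eq_iff)
    then have "snd c = snd d" using cd by (auto simp: red_id)
    with 1 cd show False by (simp add: prod_eq_iff)
  qed
  from sum_root_pairing[OF mn this]
  have 0: "(\<Sum>y\<in>grid m n. ?r (pairing m n ?a (?f y))) = 0"
    using sum.reindex_bij_betw[OF bij, of "\<lambda>y. ?r (pairing m n ?a y)"] by simp
  have "?r (pairing m n ?a (\<pi> y) + pairing m n ?d y) = ?r (pairing m n ?a (?f y))" for y
  proof -
    have *: "m * n dvd pairing m n (snd c - T (fst c)) y - pairing m n (snd d - T (fst d)) y"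
    proof -
      have "m * n dvd (pairing m n (red m n (snd d - T (fst d))) y - pairing m n (snd d - T (fst d)) y)
          - (pairing m n (red m n (snd c - T (fst c))) y - pairing m n (snd c - T (fst c)) y)"
        by (intro dvd_diff pairing_red_left)
      then show ?thesis using eq by (simp add: shifted_def)
    qed
    have "pairing m n ?a (\<pi> y) + pairing m n ?d y - pairing m n ?a (?f y) =
        (pairing m n (snd c - T (fst c)) y - pairing m n (snd d - T (fst d)) y)
        - (pairing m n ?a (?f y) - pairing m n ?a (\<pi> y + T y))"
      by (simp add: pairing_diff_left pairing_add T)
    also have "m * n dvd \<dots>" by (intro dvd_diff * pairing_red_right)
    finally show ?thesis using N by (simp add: root_pow_eq_iff)
  qed
  then show "ip (grid m n) (phase_array m n \<pi> z g c) (phase_array m n \<pi> z g d) = 0"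
    using 0 by (simp add: ip_phase_array[OF mn])
qed

text \<open>
  The hypothesis \<open>sep\<close> says that the graph of \<open>\<pi>\<close> generates the square of the group; it separates the cells of
  one array. Coordinate 0 always has the same value, so proportional vectors are equal.
\<close>

theorem phase_two_mates:
  assumes mn: "m > 0" "n > 0" and z: "z \<in> grid m n" "z \<noteq> 0"
    and \<pi>: "bij_betw \<pi> (grid m n) (grid m n)" "\<pi> 0 = 0"
    and T: "\<And>a y. pairing m n a (T y) = pairing m n (T a) y" "\<And>a y. pairing m n a (T' y) = pairing m n (T' a) y"
    and bij: "bij_betw (\<lambda>y. red m n (\<pi> y + T y)) (grid m n) (grid m n)"
      "bij_betw (\<lambda>y. red m n (\<pi> y + T' y)) (grid m n) (grid m n)"
    and inj: "inj_on (\<lambda>a. red m n (T a)) (grid m n)" "inj_on (\<lambda>a. red m n (T' a)) (grid m n)"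
      "inj_on (\<lambda>a. red m n (T a - T' a)) (grid m n)"
    and sep: "\<And>a d. (\<And>y. y \<in> grid m n \<Longrightarrow> m * n dvd pairing m n a (\<pi> y) + pairing m n d y) \<Longrightarrow>
      red m n a = 0 \<and> red m n d = 0"
  shows "two_mates (grid m n) (grid m n) (grid m n) (phase_array m n \<pi> z) (shifted m n T) (shifted m n T')"
  unfolding two_mates_def
proof (intro conjI allI ballI impI)
  let ?N = "m * n" and ?G = "grid m n"
  have N: "?N > 0" using mn by simp
  show "inj_on (\<lambda>c. (shifted m n T c, shifted m n T' c)) (?G \<times> ?G)"
  proof (rule inj_onI)
    fix c d assume cd: "c \<in> ?G \<times> ?G" "d \<in> ?G \<times> ?G"
      and eq: "(shifted m n T c, shifted m n T' c) = (shifted m n T d, shifted m n T' d)"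
    have 1: "m dvd fst (snd c - T (fst c)) - fst (snd d - T (fst d))"
      "n dvd snd (snd c - T (fst c)) - snd (snd d - T (fst d))"
      "m dvd fst (snd c - T' (fst c)) - fst (snd d - T' (fst d))"
      "n dvd snd (snd c - T' (fst c)) - snd (snd d - T' (fst d))"
      using eq by (simp_all only: shifted_def red_eq_iff prod.inject)
    have "red m n (T (fst c) - T' (fst c)) = red m n (T (fst d) - T' (fst d))"
      unfolding red_eq_iff using dvd_diff[OF 1(3,1)] dvd_diff[OF 1(4,2)] by (simp add: algebra_simps)
    then have f: "fst c = fst d" by (rule inj_onD[OF inj(3)]) (use cd in auto)
    then have "red m n (snd c) = red m n (snd d)" using 1 by (simp add: red_eq_iff)
    then have "snd c = snd d" using cd by (auto simp: red_id)
    with f show "c = d" by (rule prod_eqI)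
  qed
next
  let ?N = "m * n" and ?G = "grid m n"
  have N: "?N > 0" using mn by simp
  fix g h c d assume cd: "c \<in> ?G \<times> ?G" "d \<in> ?G \<times> ?G"
    and "same_ray ?G (phase_array m n \<pi> z g c) (phase_array m n \<pi> z h d)"
  then obtain \<theta> where \<theta>: "\<And>y. y \<in> ?G \<Longrightarrow> phase_array m n \<pi> z h d y = cis \<theta> * phase_array m n \<pi> z g c y"
    unfolding same_ray_def by blast
  have s: "complex_of_real (sqrt (of_int ?N)) \<noteq> 0" using mn by simp
  have "0 \<in> ?G" using mn by (simp add: grid_def zero_prod_def)
  have at0: "phase_array m n \<pi> z g c 0 = 1 / of_real (sqrt (of_int ?N))" for g c
    using z(2) \<pi>(2) by (simp add: phase_array_def pairing_def root_pow_def)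
  have "cis \<theta> = 1" using \<theta>[OF \<open>0 \<in> ?G\<close>] s unfolding at0 by simp
  let ?u = "\<lambda>y g. if y = z then cis (1 / (of_int ?N * (real g + 1))) else 1"
  let ?k = "\<lambda>c y. pairing m n (fst c) (\<pi> y) + pairing m n (snd c) y"
  have e: "?u y h * root_pow ?N (?k d y) = ?u y g * root_pow ?N (?k c y)" if "y \<in> ?G" for y
  proof -
    have "?u y h * root_pow ?N (?k d y) / of_real (sqrt (of_int ?N)) = ?u y g * root_pow ?N (?k c y) / of_real (sqrt (of_int ?N))"
      using \<theta>[OF that] \<open>cis \<theta> = 1\<close> by (simp only: phase_array_def mult_1)
    then show ?thesis using s by (simp only: divide_cancel_right) simp
  qed
  have "cis (1 / (real h + 1)) = cis (1 / (real g + 1))"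
  proof -
    obtain K where K: "?N = int K" "K > 0" using N by (metis zero_less_imp_eq_int)
    have c: "cis (1 / (of_int ?N * (real g + 1))) ^ K = cis (1 / (real g + 1))" for g
      using K(2) by (simp add: K(1) DeMoivre)
    have "(?u z h * root_pow ?N (?k d z)) ^ K = (?u z g * root_pow ?N (?k c z)) ^ K"
      by (simp only: e[OF z(1)])
    then show ?thesis
      using root_pow_power_N[OF K(2)] c by (simp only: power_mult_distrib K(1) if_True) simp
  qed
  then show gh: "g = h" using cis_reciprocal_inj by blast
  have "red m n (fst d - fst c) = 0 \<and> red m n (snd d - snd c) = 0"
  proof (rule sep)
    fix y assume "y \<in> ?G"
    from e[OF this] have "root_pow ?N (?k d y) = root_pow ?N (?k c y)" using gh by (simp split: if_splits)
    then have "?N dvd ?k d y - ?k c y" using N by (simp add: root_pow_eq_iff)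
    then show "?N dvd pairing m n (fst d - fst c) (\<pi> y) + pairing m n (snd d - snd c) y"
      by (simp add: pairing_diff_left algebra_simps)
  qed
  then have "fst d = fst c" "snd d = snd c"
    using cd grid_eq_iff[of "fst d" m n "fst c"] grid_eq_iff[of "snd d" m n "snd c"]
    by (auto simp: red_def prod_eq_iff dvd_eq_mod_eq_0)
  then show "c = d" by (simp add: prod_eq_iff)
qed (use mn \<pi> T bij inj in \<open>auto intro: finite_grid phase_array_qarray phase_array_mate shifted_latin\<close>)

section \<open>Multiplications by two constants\<close>

definition scale :: "int \<Rightarrow> int \<times> int \<Rightarrow> int \<times> int" where
  "scale s y = (s * fst y, s * snd y)"

lemma red_scale_cancel:
  assumes "coprime s m" "coprime s n" "y \<in> grid m n" "z \<in> grid m n" "red m n (scale s y) = red m n (scale s z)"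
  shows "y = z"
proof -
  have "m dvd s * (fst y - fst z)" "n dvd s * (snd y - snd z)"
    using assms(5) by (simp_all add: red_eq_iff scale_def right_diff_distrib)
  then have "m dvd fst y - fst z" "n dvd snd y - snd z"
    using assms(1,2) by (simp_all add: coprime_dvd_mult_right_iff coprime_commute)
  then show ?thesis using assms(3,4) by (simp add: grid_eq_iff)
qed

text \<open>
  Both constants are units, so a collision could only occur between a point \<open>y\<close> of \<open>S\<close> and a point \<open>z\<close> outside.
  Then \<open>k t y = t z\<close>, hence \<open>z = k y\<close>, which lies in \<open>S\<close>.
\<close>

lemma two_scalings_bij:
  assumes mn: "m > 0" "n > 0" and S: "\<And>y. y \<in> S \<Longrightarrow> y \<in> grid m n \<Longrightarrow> red m n (scale k y) \<in> S"
    and t: "coprime t m" "coprime t n" and k: "coprime k m" "coprime k n"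
  shows "bij_betw (\<lambda>y. red m n (scale (if y \<in> S then k * t else t) y)) (grid m n) (grid m n)"
    (is "bij_betw ?f ?G ?G")
proof -
  have mixed: "y \<notin> S \<or> z \<in> S" if "y \<in> ?G" "z \<in> ?G" "red m n (scale (k * t) y) = red m n (scale t z)" for y z
  proof -
    have s: "red m n (scale t (red m n (scale k y))) = red m n (scale (k * t) y)"
      by (simp add: red_def scale_def mod_mult_right_eq ac_simps)
    have "red m n (scale k y) = z"
      by (rule red_scale_cancel[of t m n]) (use that mn t s in \<open>auto intro: red_grid\<close>)
    then show ?thesis using S that(1) by blast
  qed
  have kt: "coprime (k * t) m" "coprime (k * t) n" using t k by simp_all
  have "inj_on ?f ?G"
  proof (rule inj_onI)
    fix y z assume yz: "y \<in> ?G" "z \<in> ?G" and eq: "?f y = ?f z"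
    consider "y \<in> S" "z \<in> S" | "y \<notin> S" "z \<notin> S" | "y \<in> S" "z \<notin> S" | "y \<notin> S" "z \<in> S" by blast
    then show "y = z"
    proof cases
      case 1
      then show ?thesis using eq by (intro red_scale_cancel[OF kt yz]) simp
    next
      case 2
      then show ?thesis using eq by (intro red_scale_cancel[OF t yz]) simp
    next
      case 3
      then show ?thesis using eq mixed[OF yz] by simp
    next
      case 4
      then show ?thesis using eq mixed[OF yz(2,1)] by simp
    qed
  qed
  moreover have "?f ` ?G \<subseteq> ?G" using mn by (auto intro: red_grid)
  ultimately show ?thesis using endo_inj_surj[OF finite_grid] by (simp add: bij_betw_def)
qed

lemma pairing_scale: "pairing m n a (scale s y) = s * pairing m n a y"
  by (simp add: pairing_def scale_def algebra_simps)

text \<open>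
  All three bijections have the same shape: they multiply by \<open>k t\<close> on \<open>S\<close> and by \<open>t\<close> outside. The equations between the
  constants say that each of the other two differs from the first one by a multiplication with one constant on the
  whole group, namely \<open>t' - t\<close> or \<open>t'' - t\<close>.
\<close>

lemma scaled_phase_mated:
  fixes t t' t'' k k' k'' :: int
  assumes mn: "m > 0" "n > 0" and z: "z \<in> grid m n" "z \<noteq> 0"
    and S: "\<And>y l. l \<in> {k, k', k''} \<Longrightarrow> y \<in> S \<Longrightarrow> y \<in> grid m n \<Longrightarrow> red m n (scale l y) \<in> S"
    and cop: "\<And>c. c \<in> {t, t', t'', k, k', k'', t' - t, t'' - t, t' - t''} \<Longrightarrow> coprime c m \<and> coprime c n"
    and eq: "k' * t' - t' = k * t - t" "k'' * t'' - t'' = k * t - t"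
    and sep: "\<And>a d. (\<And>y. y \<in> grid m n \<Longrightarrow> y \<in> S \<Longrightarrow> m * n dvd pairing m n (scale (k * t) a + d) y) \<Longrightarrow>
        (\<And>y. y \<in> grid m n \<Longrightarrow> y \<notin> S \<Longrightarrow> m * n dvd pairing m n (scale t a + d) y) \<Longrightarrow>
        red m n a = 0 \<and> red m n d = 0"
  shows "mated (nat (m * n))"
proof -
  let ?G = "grid m n"
  let ?\<pi> = "\<lambda>y. red m n (scale (if y \<in> S then k * t else t) y)"
  have bij: "bij_betw (\<lambda>y. red m n (scale (if y \<in> S then l * u else u) y)) ?G ?G"
    if "l \<in> {k, k', k''}" "u \<in> {t, t', t''}" for l u
    using mn S that cop[of l] cop[of u] by (intro two_scalings_bij) auto
  have shift: "red m n (?\<pi> y + scale s y) = red m n (scale (if y \<in> S then l * u else u) y)"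
    if "s = u - t" "s = l * u - k * t" for s l u y
  proof -
    have "red m n (?\<pi> y + scale s y) = red m n (scale (if y \<in> S then k * t + s else t + s) y)"
      by (simp add: red_def scale_def mod_add_left_eq distrib_right)
    moreover have "k * t + s = l * u" "t + s = u" using that by simp_all
    ultimately show ?thesis by (simp only:)
  qed
  have inj: "inj_on (\<lambda>a. red m n (scale s a)) ?G" if "s \<in> {t' - t, t'' - t, t' - t''}" for s
    by (rule inj_onI, rule red_scale_cancel[of s]) (use cop[of s] that in auto)
  have "two_mates ?G ?G ?G (phase_array m n ?\<pi> z) (shifted m n (scale (t' - t))) (shifted m n (scale (t'' - t)))"
  proof (rule phase_two_mates[OF mn z])
    show "bij_betw ?\<pi> ?G ?G" by (rule bij) simp_all
    show "?\<pi> 0 = 0" by (simp add: red_def scale_def zero_prod_def)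
    show "pairing m n a (scale (t' - t) y) = pairing m n (scale (t' - t) a) y" for a y
      by (simp add: pairing_scale pairing_commute[of m n "scale _ a"] pairing_commute[of m n y])
    show "pairing m n a (scale (t'' - t) y) = pairing m n (scale (t'' - t) a) y" for a y
      by (simp add: pairing_scale pairing_commute[of m n "scale _ a"] pairing_commute[of m n y])
    have "(\<lambda>y. red m n (?\<pi> y + scale (t' - t) y)) = (\<lambda>y. red m n (scale (if y \<in> S then k' * t' else t') y))"
      by (rule ext, rule shift) (use eq in simp_all)
    then show "bij_betw (\<lambda>y. red m n (?\<pi> y + scale (t' - t) y)) ?G ?G"
      using bij[of k' t'] by (simp only: insertI1 insertI2)
    have "(\<lambda>y. red m n (?\<pi> y + scale (t'' - t) y)) = (\<lambda>y. red m n (scale (if y \<in> S then k'' * t'' else t'') y))"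
      by (rule ext, rule shift) (use eq in simp_all)
    then show "bij_betw (\<lambda>y. red m n (?\<pi> y + scale (t'' - t) y)) ?G ?G"
      using bij[of k'' t''] by (simp only: insertI1 insertI2)
    show "inj_on (\<lambda>a. red m n (scale (t' - t) a)) ?G" "inj_on (\<lambda>a. red m n (scale (t'' - t) a)) ?G"
      by (rule inj; simp)+
    have "scale (t' - t) a - scale (t'' - t) a = scale (t' - t'') a" for a
      by (simp add: scale_def algebra_simps)
    then show "inj_on (\<lambda>a. red m n (scale (t' - t) a - scale (t'' - t) a)) ?G"
      using inj[of "t' - t''"] by simp
    fix a d assume *: "\<And>y. y \<in> ?G \<Longrightarrow> m * n dvd pairing m n a (?\<pi> y) + pairing m n d y"
    have e: "m * n dvd pairing m n (scale (if y \<in> S then k * t else t) a + d) y" if "y \<in> ?G" for y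
    proof -
      define u where "u = (if y \<in> S then k * t else t)"
      have "m * n dvd (pairing m n a (red m n (scale u y)) + pairing m n d y)
          - (pairing m n a (red m n (scale u y)) - pairing m n a (scale u y))"
        unfolding u_def by (intro dvd_diff *[OF that] pairing_red_right)
      also have "\<dots> = pairing m n (scale u a + d) y"
        by (simp add: pairing_def scale_def algebra_simps)
      finally show ?thesis unfolding u_def .
    qed
    show "red m n a = 0 \<and> red m n d = 0"
    proof (rule sep)
      fix y assume y: "y \<in> ?G"
      show "m * n dvd pairing m n (scale (k * t) a + d) y" if "y \<in> S" using e[OF y] that by simp
      show "m * n dvd pairing m n (scale t a + d) y" if "y \<notin> S" using e[OF y] that by simp
    qed
  qed
  from two_mates_imp_mated[OF this] show ?thesis using mn by (simp add: card_grid)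
qed

text \<open>
  Squaring modulo \<open>p\<close> identifies 1 and \<open>-1\<close>, so it is not surjective.
\<close>

lemma ex_quadratic_nonresidue:
  fixes p :: int
  assumes "p > 2"
  obtains u where "0 \<le> u" "u < p" "\<And>x. \<not> p dvd u - x\<^sup>2"
proof -
  let ?f = "\<lambda>x :: int. x\<^sup>2 mod p"
  have "(p - 1)\<^sup>2 - 1\<^sup>2 = p * (p - 2)" by (simp add: power2_eq_square algebra_simps)
  then have "?f (p - 1) = ?f 1" by (simp only: mod_eq_dvd_iff) simp
  then have "\<not> inj_on ?f {0..<p}" using assms inj_onD[of ?f "{0..<p}" "p - 1" 1] by auto
  then have "\<not> {0..<p} \<subseteq> ?f ` {0..<p}" using finite_surj_inj[of "{0..<p}" ?f] by auto
  then obtain u where u: "u \<in> {0..<p}" "u \<notin> ?f ` {0..<p}" by blast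
  have "\<not> p dvd u - x\<^sup>2" for x
  proof
    assume "p dvd u - x\<^sup>2"
    then have "u mod p = x\<^sup>2 mod p" by (simp add: mod_eq_dvd_iff)
    then have "u = ?f (x mod p)" using u(1) by (simp add: power_mod)
    moreover have "x mod p \<in> {0..<p}" using assms by simp
    ultimately show False using u(2) by blast
  qed
  then show thesis using u(1) by (intro that) auto
qed

lemma int_prime_coprime:
  assumes "prime p" "c \<in> {1..<int p}"
  shows "coprime c (int p)"
proof -
  have "\<not> int p dvd c" using assms(2) by (auto dest: zdvd_imp_le)
  moreover have "prime (int p)" using assms(1) by simp
  ultimately show ?thesis using prime_imp_coprime coprime_commute by blast
qed

text \<open>
  \<open>S\<close> is the set of squares modulo \<open>p\<close>. The constants are
  \<open>160 = 4 \<cdot> 40\<close>, \<open>135 = 9 \<cdot> 15\<close> and \<open>128 = 16 \<cdot> 8\<close>: the ratios are squares, and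
  \<open>160 - 135 = 40 - 15 = 25\<close> and \<open>160 - 128 = 40 - 8 = 32\<close> with difference 7. None of these numbers has a prime factor above 7.
\<close>

lemma mated_prime:
  assumes p: "prime p" "p \<ge> 11"
  shows "mated p"
proof -
  let ?p = "int p"
  define S :: "(int \<times> int) set" where "S = {y. \<exists>x. ?p dvd fst y - x\<^sup>2}"
  obtain u where u: "0 \<le> u" "u < ?p" "\<And>x. \<not> ?p dvd u - x\<^sup>2"
    using p(2) by (auto intro: ex_quadratic_nonresidue[of ?p])
  have c: "coprime 2 ?p" "coprime 3 ?p" "coprime 5 ?p" "coprime 7 ?p" "coprime u ?p"
  proof -
    have "u \<noteq> 0" using u(3)[of 0] by auto
    then show "coprime u ?p" using u(1,2) by (intro int_prime_coprime[OF p(1)]) auto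
    show "coprime 2 ?p" "coprime 3 ?p" "coprime 5 ?p" "coprime 7 ?p"
      by (rule int_prime_coprime[OF p(1)], use p(2) in simp)+
  qed
  have cc: "coprime (2 * (2 * (2 * 5))) ?p" "coprime (3 * 5) ?p" "coprime (2 * (2 * 2)) ?p" "coprime (2 * 2) ?p"
    "coprime (3 * 3) ?p" "coprime (2 * (2 * (2 * 2))) ?p" "coprime (5 * 5) ?p" "coprime (2 * (2 * (2 * (2 * 2)))) ?p"
    "coprime (2 * (2 * (2 * (3 * 5)))) ?p"
    unfolding coprime_mult_left_iff using c by blast+
  have "mated (nat (?p * 1))"
  proof (rule scaled_phase_mated[where z = "(1, 0)" and S = S and t = 40 and k = 4 and t' = 15 and k' = 9 and t'' = 8 and k'' = 16])
    show "(1, 0) \<in> grid ?p 1" "(1 :: int, 0 :: int) \<noteq> 0" using p by (auto simp: grid_def zero_prod_def)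
    show "red ?p 1 (scale l y) \<in> S" if l: "l \<in> {4, 9, 16}" and y: "y \<in> S" for y l
    proof -
      obtain x where x: "?p dvd fst y - x\<^sup>2" using y by (auto simp: S_def)
      have "l \<in> {2\<^sup>2, 3\<^sup>2, 4\<^sup>2}" using l by simp
      then obtain r where r: "l = r\<^sup>2" by blast
      have "?p dvd l * (fst y - x\<^sup>2) - ?p * (l * fst y div ?p)" using x by simp
      also have "l * (fst y - x\<^sup>2) - ?p * (l * fst y div ?p) = l * fst y mod ?p - (r * x)\<^sup>2"
        by (simp add: r power_mult_distrib minus_mult_div_eq_mod[symmetric] algebra_simps)
      finally show ?thesis by (auto simp: S_def red_def scale_def)
    qed
    show "coprime c ?p \<and> coprime c 1" if "c \<in> {40, 15, 8, 4, 9, 16, 15 - 40, 8 - 40, 15 - 8}" for c :: int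
      using that cc c by auto
  next
    fix a d :: "int \<times> int"
    assume h1: "\<And>y. y \<in> grid ?p 1 \<Longrightarrow> y \<in> S \<Longrightarrow> ?p * 1 dvd pairing ?p 1 (scale (4 * 40) a + d) y"
      and h2: "\<And>y. y \<in> grid ?p 1 \<Longrightarrow> y \<notin> S \<Longrightarrow> ?p * 1 dvd pairing ?p 1 (scale 40 a + d) y"
    have "(1, 0) \<in> S" unfolding S_def by (auto intro: exI[of _ 1])
    then have e1: "?p dvd 160 * fst a + fst d"
      using h1[of "(1, 0)"] p by (simp add: grid_def pairing_def scale_def)
    have "(u, 0) \<notin> S" using u(3) by (auto simp: S_def)
    then have "?p dvd (40 * fst a + fst d) * u"
      using h2[of "(u, 0)"] u by (simp add: grid_def pairing_def scale_def)
    then have e2: "?p dvd 40 * fst a + fst d"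
      using c(5) by (simp add: coprime_dvd_mult_left_iff coprime_commute)
    have "?p dvd 120 * fst a" using dvd_diff[OF e1 e2] by simp
    then have a: "?p dvd fst a" using cc(9) by (simp add: coprime_dvd_mult_right_iff coprime_commute)
    then have "?p dvd fst d" using e2 by (simp add: dvd_add_right_iff)
    with a show "red ?p 1 a = 0 \<and> red ?p 1 d = 0" by (simp add: red_def zero_prod_def)
  qed (use p in auto)
  then show ?thesis by simp
qed

text \<open>
  In \<open>\<int>\<^sub>p \<times> \<int>\<^sub>n\<close> with \<open>n = p\<^sup>j\<close> the union of the two coordinate axes is closed under every
  multiplication, so the ratios 2, 3 and 4 need not be squares: the constants are \<open>12 = 2 \<cdot> 6\<close>, \<open>9 = 3 \<cdot> 3\<close> and \<open>8 = 4 \<cdot> 2\<close>,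
  with \<open>12 - 9 = 6 - 3\<close> and \<open>12 - 8 = 6 - 2\<close>. Both the axes and their complement generate the group.
\<close>

lemma mated_prime_power:
  assumes p: "prime p" "p \<ge> 5" and j: "j \<ge> 1"
  shows "mated (p * p ^ j)"
proof -
  let ?m = "int p" and ?n = "int (p ^ j)"
  define S :: "(int \<times> int) set" where "S = {y. fst y = 0 \<or> snd y = 0}"
  have pos: "?m > 0" "?n > 0" using p by (auto simp: prime_gt_0_nat)
  have "p ^ 1 \<le> p ^ j" using p j by (intro power_increasing) auto
  then have n5: "?n \<ge> 5" and m5: "?m \<ge> 5" using p by (simp_all only: power_one_right)
  have c: "coprime 2 ?m" "coprime 3 ?m" by (rule int_prime_coprime[OF p(1)], use p(2) in simp)+
  have cm: "coprime (2 * 3) ?m" "coprime (3 * 1) ?m" "coprime (2 * 1) ?m" "coprime (2 * 2) ?m" "coprime (1 :: int) ?m"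
    unfolding coprime_mult_left_iff using c by simp_all
  have cop: "coprime x ?m \<and> coprime x ?n" if "x \<in> {6, 3, 2, 4, - 3, - 4, 1}" for x
  proof -
    have "coprime x ?m" using that cm by auto
    then show ?thesis by (simp add: coprime_power_right_iff)
  qed
  have "mated (nat (?m * ?n))"
  proof (rule scaled_phase_mated[where z = "(1, 0)" and S = S and t = 6 and k = 2 and t' = 3 and k' = 3 and t'' = 2 and k'' = 4])
    show "(1, 0) \<in> grid ?m ?n" "(1 :: int, 0 :: int) \<noteq> 0" using m5 n5 by (auto simp: grid_def zero_prod_def)
    show "red ?m ?n (scale l y) \<in> S" if "y \<in> S" for y l
      using that by (auto simp: S_def red_def scale_def)
    show "coprime x ?m \<and> coprime x ?n" if "x \<in> {6, 3, 2, 2, 3, 4, 3 - 6, 2 - 6, 3 - 2}" for x :: int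
      using that by (intro cop) auto
  next
    fix a d :: "int \<times> int"
    assume h1: "\<And>y. y \<in> grid ?m ?n \<Longrightarrow> y \<in> S \<Longrightarrow> ?m * ?n dvd pairing ?m ?n (scale (2 * 6) a + d) y"
      and h2: "\<And>y. y \<in> grid ?m ?n \<Longrightarrow> y \<notin> S \<Longrightarrow> ?m * ?n dvd pairing ?m ?n (scale 6 a + d) y"
    let ?v = "scale 12 a + d" and ?w = "scale 6 a + d"
    have g: "(1, 0) \<in> grid ?m ?n" "(0, 1) \<in> grid ?m ?n" "(1, 1) \<in> grid ?m ?n" "(1, 2) \<in> grid ?m ?n"
      using m5 n5 by (auto simp: grid_def)
    have "?m * ?n dvd fst ?v * ?n" using h1[OF g(1)] by (simp add: S_def pairing_def mult.commute)
    then have v1: "?m dvd fst ?v" using pos by simp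
    have "?m * ?n dvd ?m * snd ?v" using h1[OF g(2)] by (simp add: S_def pairing_def)
    then have v2: "?n dvd snd ?v" using pos by simp
    have w11: "?m * ?n dvd ?n * fst ?w + ?m * snd ?w" using h2[OF g(3)] by (simp add: S_def pairing_def)
    have w12: "?m * ?n dvd ?n * fst ?w + 2 * (?m * snd ?w)" using h2[OF g(4)] by (simp add: S_def pairing_def algebra_simps)
    have "?m * ?n dvd ?m * snd ?w" using dvd_diff[OF w12 w11] by simp
    then have w2: "?n dvd snd ?w" using pos by simp
    then have "?m * ?n dvd ?m * snd ?w" by simp
    from dvd_diff[OF w11 this] have "?m * ?n dvd fst ?w * ?n" by (simp add: mult.commute)
    then have w1: "?m dvd fst ?w" using pos by simp
    have "?m dvd 6 * fst a" "?n dvd 6 * snd a"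
      using dvd_diff[OF v1 w1] dvd_diff[OF v2 w2] by (simp_all add: scale_def)
    then have a: "?m dvd fst a" "?n dvd snd a"
      using cop[of 6] by (simp_all add: coprime_dvd_mult_right_iff coprime_commute)
    then have "?m dvd fst d" "?n dvd snd d" using w1 w2 by (simp_all add: scale_def dvd_add_right_iff)
    with a show "red ?m ?n a = 0 \<and> red ?m ?n d = 0" by (simp add: red_def zero_prod_def)
  qed (use pos in auto)
  then show ?thesis by (simp only: of_nat_mult[symmetric] nat_int)
qed

section \<open>Tables of order 9, 16 and 27\<close>

text \<open>
  The entries of the list are the pairs \<open>(y, \<pi> y)\<close>. The last
  condition states for all pairs of labels that the graph of \<open>\<pi>\<close> separates them.
\<close>

definition phase_table ::
    "int \<Rightarrow> int \<Rightarrow> (int \<times> int \<Rightarrow> int \<times> int) \<Rightarrow> (int \<times> int \<Rightarrow> int \<times> int) \<Rightarrow>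
     ((int \<times> int) \<times> (int \<times> int)) list \<Rightarrow> bool" where
  "phase_table m n T T' ys \<longleftrightarrow>
     ys \<noteq> [] \<and> hd ys = ((0, 0), (0, 0)) \<and> int (length ys) = m * n \<and>
     list_all (\<lambda>((a, b), (c, d)). 0 \<le> a \<and> a < m \<and> 0 \<le> b \<and> b < n \<and> 0 \<le> c \<and> c < m \<and> 0 \<le> d \<and> d < n) ys \<and>
     list_all (\<lambda>f. distinct (map f ys))
       [fst, snd, \<lambda>(y, x). red m n (x + T y), \<lambda>(y, x). red m n (x + T' y),
        \<lambda>(y, x). red m n (T y), \<lambda>(y, x). red m n (T' y), \<lambda>(y, x). red m n (T y - T' y)] \<and>
     list_all (\<lambda>(a, u). list_all (\<lambda>(d, v). (a = (0, 0) \<and> d = (0, 0)) \<or>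
       list_ex (\<lambda>(y, x). (pairing m n a x + pairing m n d y) mod (m * n) \<noteq> 0) ys) ys) ys"

lemma phase_table_mated:
  assumes mn: "m > 1" "n > 0" and tab: "phase_table m n T T' ys"
    and T: "\<And>a y. pairing m n a (T y) = pairing m n (T a) y" "\<And>a y. pairing m n a (T' y) = pairing m n (T' a) y"
  shows "mated (nat (m * n))"
proof -
  let ?G = "grid m n"
  have pos: "m > 0" "n > 0" using mn by auto
  have len: "length ys = nat (m * n)" and hd: "ys \<noteq> []" "hd ys = (0, 0)"
    using tab unfolding phase_table_def zero_prod_def by (auto simp: zero_prod_def)
  have rng: "y \<in> ?G \<and> x \<in> ?G" if "(y, x) \<in> set ys" for y x
    using tab that unfolding phase_table_def list_all_iff grid_def by fastforce
  have dist: "distinct (map f ys)"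
    if "f \<in> {fst, snd, \<lambda>(y, x). red m n (x + T y), \<lambda>(y, x). red m n (x + T' y),
        \<lambda>(y, x). red m n (T y), \<lambda>(y, x). red m n (T' y), \<lambda>(y, x). red m n (T y - T' y)}" for f
    using tab that unfolding phase_table_def by auto
  have keys: "fst ` set ys = ?G"
  proof (rule card_subset_eq)
    show "fst ` set ys \<subseteq> ?G" using rng by auto
    have "card (fst ` set ys) = length ys"
      using distinct_card[OF dist[of fst]] by simp
    then show "card (fst ` set ys) = card ?G" using len pos by (simp add: card_grid)
  qed (rule finite_grid)
  define \<pi> where "\<pi> y = the (map_of ys y)" for y
  have d1: "distinct (map fst ys)" by (rule dist) simp
  have \<pi>: "\<pi> y = x" if "(y, x) \<in> set ys" for y x
    using map_of_is_SomeI[OF d1 that] by (simp add: \<pi>_def)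
  have mem: "(y, \<pi> y) \<in> set ys" if "y \<in> ?G" for y
  proof -
    from that have "y \<in> fst ` set ys" unfolding keys .
    then obtain x where "(y, x) \<in> set ys" by auto
    with \<pi>[OF this] show ?thesis by simp
  qed
  have inj: "inj_on (\<lambda>y. f (y, \<pi> y)) ?G" if "distinct (map f ys)" for f :: "_ \<Rightarrow> int \<times> int"
  proof (rule inj_onI)
    fix y z assume yz: "y \<in> ?G" "z \<in> ?G" "f (y, \<pi> y) = f (z, \<pi> z)"
    have "inj_on f (set ys)" using that by (simp add: distinct_map)
    then have "(y, \<pi> y) = (z, \<pi> z)" using yz(3) mem[OF yz(1)] mem[OF yz(2)] by (rule inj_onD)
    then show "y = z" by simp
  qed
  have bij: "bij_betw f ?G ?G" if "inj_on f ?G" "\<And>y. y \<in> ?G \<Longrightarrow> f y \<in> ?G" for f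
  proof -
    have "f ` ?G \<subseteq> ?G" using that(2) by blast
    from endo_inj_surj[OF finite_grid this that(1)] that(1) show ?thesis by (simp add: bij_betw_def)
  qed
  have "two_mates ?G ?G ?G (phase_array m n \<pi> (1, 0)) (shifted m n T) (shifted m n T')"
  proof (rule phase_two_mates[OF pos])
    show "(1, 0) \<in> ?G" "(1 :: int, 0 :: int) \<noteq> 0" using mn by (auto simp: grid_def zero_prod_def)
    have "inj_on (\<lambda>y. snd (y, \<pi> y)) ?G" by (intro inj dist) simp
    moreover have "\<pi> y \<in> ?G" if "y \<in> ?G" for y using rng[OF mem[OF that]] by simp
    ultimately show "bij_betw \<pi> ?G ?G" by (intro bij) simp_all
    have "(0, 0) \<in> set ys" using hd by (metis list.set_sel(1))
    then show "\<pi> 0 = 0" by (rule \<pi>)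
    have "inj_on (\<lambda>y. (\<lambda>(y, x). red m n (x + T y)) (y, \<pi> y)) ?G" by (intro inj dist) simp
    then show "bij_betw (\<lambda>y. red m n (\<pi> y + T y)) ?G ?G" using pos by (intro bij) (auto intro: red_grid)
    have "inj_on (\<lambda>y. (\<lambda>(y, x). red m n (x + T' y)) (y, \<pi> y)) ?G" by (intro inj dist) simp
    then show "bij_betw (\<lambda>y. red m n (\<pi> y + T' y)) ?G ?G" using pos by (intro bij) (auto intro: red_grid)
    have "inj_on (\<lambda>y. (\<lambda>(y, x). red m n (T y)) (y, \<pi> y)) ?G" by (intro inj dist) simp
    then show "inj_on (\<lambda>a. red m n (T a)) ?G" by simp
    have "inj_on (\<lambda>y. (\<lambda>(y, x). red m n (T' y)) (y, \<pi> y)) ?G" by (intro inj dist) simp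
    then show "inj_on (\<lambda>a. red m n (T' a)) ?G" by simp
    have "inj_on (\<lambda>y. (\<lambda>(y, x). red m n (T y - T' y)) (y, \<pi> y)) ?G" by (intro inj dist) simp
    then show "inj_on (\<lambda>a. red m n (T a - T' a)) ?G" by simp
  next
    fix a d assume *: "\<And>y. y \<in> ?G \<Longrightarrow> m * n dvd pairing m n a (\<pi> y) + pairing m n d y"
    let ?a = "red m n a" and ?d = "red m n d"
    have z: "m * n dvd pairing m n ?a x + pairing m n ?d y" if yx: "(y, x) \<in> set ys" for y x
    proof -
      have "m * n dvd pairing m n a x + pairing m n d y" using *[of y] rng[OF yx] \<pi>[OF yx] by simp
      from dvd_add[OF this dvd_add[OF pairing_red_left[of m n a x] pairing_red_left[of m n d y]]]
      show ?thesis by (simp add: algebra_simps)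
    qed
    have "?a \<in> ?G" "?d \<in> ?G" using pos by (auto intro: red_grid)
    from mem[OF this(1)] mem[OF this(2)]
    have "?a = (0, 0) \<and> ?d = (0, 0) \<or> list_ex (\<lambda>(y, x). (pairing m n ?a x + pairing m n ?d y) mod (m * n) \<noteq> 0) ys"
      using tab unfolding phase_table_def list_all_iff by blast
    then show "?a = 0 \<and> ?d = 0"
      using z by (auto simp: list_ex_iff zero_prod_def dvd_eq_mod_eq_0)
  qed (fact T)+
  from two_mates_imp_mated[OF this] show ?thesis using pos by (simp add: card_grid)
qed

lemma mated_9: "mated 9"
proof -
  have "phase_table 3 3 (\<lambda>y. y) (\<lambda>y. - y)
  [((0,0),(0,0)), ((0,1),(2,0)), ((0,2),(1,1)), ((1,0),(1,2)), ((1,1),(0,1)), ((1,2),(2,2)),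
   ((2,0),(2,1)), ((2,1),(0,2)), ((2,2),(1,0))]"
    by code_simp
  from phase_table_mated[OF _ _ this] show ?thesis by (simp add: pairing_def)
qed

text \<open>
  There is no scalar \<open>T'\<close> for which \<open>T'\<close> and \<open>T' - 1\<close> are both invertible modulo 4. The matrix with rows
  \<open>(0, 1)\<close> and \<open>(1, 1)\<close> has this property, and it is self-adjoint because it is symmetric.
\<close>

lemma mated_16: "mated 16"
proof -
  have "phase_table 4 4 (\<lambda>y. y) (\<lambda>y. (snd y, fst y + snd y))
  [((0,0),(0,0)), ((0,1),(0,2)), ((0,2),(2,3)), ((0,3),(3,2)), ((1,0),(3,1)), ((1,1),(1,2)),
   ((1,2),(0,3)), ((1,3),(3,3)), ((2,0),(1,3)), ((2,1),(0,1)), ((2,2),(1,0)), ((2,3),(1,1)),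
   ((3,0),(3,0)), ((3,1),(2,1)), ((3,2),(2,2)), ((3,3),(2,0))]"
    by code_simp
  from phase_table_mated[OF _ _ this] show ?thesis by (simp add: pairing_def algebra_simps)
qed

lemma mated_27: "mated 27"
proof -
  have "phase_table 3 9 (\<lambda>y. y) (\<lambda>y. - y)
  [((0,0),(0,0)), ((0,1),(2,8)), ((0,2),(0,8)), ((0,3),(0,5)), ((0,4),(2,3)), ((0,5),(2,5)),
   ((0,6),(1,2)), ((0,7),(1,8)), ((0,8),(1,5)), ((1,0),(1,3)), ((1,1),(0,4)), ((1,2),(1,6)),
   ((1,3),(2,2)), ((1,4),(2,7)), ((1,5),(0,6)), ((1,6),(1,7)), ((1,7),(2,0)), ((1,8),(0,1)),
   ((2,0),(1,4)), ((2,1),(2,6)), ((2,2),(2,1)), ((2,3),(1,0)), ((2,4),(0,2)), ((2,5),(1,1)),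
   ((2,6),(2,4)), ((2,7),(0,7)), ((2,8),(0,3))]"
    by code_simp
  from phase_table_mated[OF _ _ this] show ?thesis by (simp add: pairing_def)
qed

text \<open>
  The exponents are at least 2, so they are sums of 2s and 3s.
\<close>

lemma mated_three_power: "mated (3 ^ (h + 2))"
proof (induction h rule: nat_induct2)
  case 0
  show ?case using mated_9 by simp
next
  case 1
  show ?case using mated_27 by simp
next
  case (step h)
  have "(3::nat) ^ (h + 2 + 2) = 9 * 3 ^ (h + 2)" by simp
  then show ?case using mated_product[OF mated_9 step] by simp
qed

theorem mated_exist:
  assumes "primepow q \<and> odd q \<and> q \<ge> 9 \<or> q = 16"
  shows "mated q"
proof (cases "q = 16")
  case True
  then show ?thesis using mated_16 by simp
next
  case False
  with assms have q: "primepow q" "odd q" "q \<ge> 9" by auto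
  obtain p e where p: "prime p" "e > 0" "q = p ^ e"
    using q(1) unfolding primepow_def by blast
  have "odd p" using q(2) p by auto
  moreover have "p \<ge> 2" using p(1) by (rule prime_ge_2_nat)
  ultimately have "p = 3 \<or> p \<ge> 5" by presburger
  then show ?thesis
  proof
    assume 3: "p = 3"
    have "e \<ge> 2"
    proof (rule ccontr)
      assume "\<not> e \<ge> 2"
      with p(2) have "e = 1" by simp
      with p(3) 3 q(3) show False by simp
    qed
    then obtain h where "e = h + 2" using le_Suc_ex by (metis add.commute)
    then show ?thesis using mated_three_power[of h] p(3) 3 by simp
  next
    assume 5: "p \<ge> 5"
    show ?thesis
    proof (cases "e = 1")
      case True
      have "p \<ge> 9" "odd p" using True p q by auto
      moreover have "p \<noteq> 9"
        using prime_product[of 3 "3::nat"] p(1) by auto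
      ultimately have "p \<ge> 11" by presburger
      then show ?thesis using mated_prime[OF p(1)] True p(3) by simp
    next
      case False
      with p(2) obtain j where "e = Suc j" "j \<ge> 1" by (cases e) auto
      then show ?thesis using mated_prime_power[OF p(1) 5, of j] p(3) by simp
    qed
  qed
qed

section \<open>Pairs of orthogonal Latin squares\<close>

definition mols :: "nat \<Rightarrow> bool" where
  "mols n \<longleftrightarrow> (\<exists>A B :: nat \<times> nat \<Rightarrow> nat. latin {..<n} {..<n} A \<and> latin {..<n} {..<n} B \<and>
     inj_on (\<lambda>c. (A c, B c)) ({..<n} \<times> {..<n}))"

text \<open>
  An orthogonal array with \<open>k\<close> columns: any two columns determine the row. For \<open>k = 4\<close> this is a pair of orthogonal Latin squares in which
  rows, columns and both symbols play equal parts, which makes products and Wilson's construction uniform.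
\<close>

definition oa :: "nat \<Rightarrow> 'i set \<Rightarrow> 'x set \<Rightarrow> ('i \<Rightarrow> nat \<Rightarrow> 'x) \<Rightarrow> bool" where
  "oa k I X c \<longleftrightarrow> finite I \<and> finite X \<and> card I = card X * card X \<and> (\<forall>\<alpha>\<in>I. \<forall>i<k. c \<alpha> i \<in> X) \<and>
     (\<forall>\<alpha>\<in>I. \<forall>\<beta>\<in>I. \<forall>i<k. \<forall>j<k. i \<noteq> j \<longrightarrow> c \<alpha> i = c \<beta> i \<longrightarrow> c \<alpha> j = c \<beta> j \<longrightarrow> \<alpha> = \<beta>)"

lemma oaD: "oa k I X c \<Longrightarrow> \<alpha> \<in> I \<Longrightarrow> \<beta> \<in> I \<Longrightarrow> i < k \<Longrightarrow> j < k \<Longrightarrow> i \<noteq> j \<Longrightarrow>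
    c \<alpha> i = c \<beta> i \<Longrightarrow> c \<alpha> j = c \<beta> j \<Longrightarrow> \<alpha> = \<beta>"
  unfolding oa_def by blast

lemma oaI:
  assumes "finite I" "finite X" "card I = card X * card X"
    and "\<And>\<alpha> i. \<alpha> \<in> I \<Longrightarrow> i < k \<Longrightarrow> c \<alpha> i \<in> X"
    and "\<And>\<alpha> \<beta> i j. \<alpha> \<in> I \<Longrightarrow> \<beta> \<in> I \<Longrightarrow> i < k \<Longrightarrow> j < k \<Longrightarrow> i \<noteq> j \<Longrightarrow>
       c \<alpha> i = c \<beta> i \<Longrightarrow> c \<alpha> j = c \<beta> j \<Longrightarrow> \<alpha> = \<beta>"
  shows "oa k I X c"
  unfolding oa_def using assms by blast

lemma oa_imp_mols:
  assumes oa: "oa 4 I X c"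
  shows "mols (card X)"
proof -
  let ?n = "card X"
  have fin: "finite I" "finite X" and card: "card I = ?n * ?n"
    and X: "\<And>\<alpha> i. \<alpha> \<in> I \<Longrightarrow> i < 4 \<Longrightarrow> c \<alpha> i \<in> X"
    using oa unfolding oa_def by blast+
  obtain f where f: "bij_betw f X {..<?n}"
    using fin by (metis ex_bij_betw_finite_nat atLeast0LessThan)
  have finj: "f x = f y \<longleftrightarrow> x = y" if "x \<in> X" "y \<in> X" for x y
    using f that by (auto simp: bij_betw_def inj_on_def)
  have fX: "f x < ?n" if "x \<in> X" for x using f that by (auto simp: bij_betw_def)
  define g where "g \<alpha> = (f (c \<alpha> 0), f (c \<alpha> 1))" for \<alpha>
  have ginj: "inj_on g I"
    by (rule inj_onI) (rule oaD[OF oa, of _ _ 0 1], auto simp: g_def finj X)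
  have "g ` I \<subseteq> {..<?n} \<times> {..<?n}" using X fX by (auto simp: g_def)
  moreover have "card (g ` I) = card ({..<?n} \<times> {..<?n})"
    using ginj card by (simp add: card_image)
  ultimately have gim: "g ` I = {..<?n} \<times> {..<?n}" by (intro card_subset_eq) auto
  define k where "k = inv_into I g"
  have k: "k p \<in> I" "g (k p) = p" if "p \<in> {..<?n} \<times> {..<?n}" for p
    using that gim inv_into_into[of p g I] f_inv_into_f[of p g I] by (auto simp: k_def)
  have kk: "p = q" if "p \<in> {..<?n} \<times> {..<?n}" "q \<in> {..<?n} \<times> {..<?n}" "i < 4" "j < 4" "i \<noteq> j"
     "c (k p) i = c (k q) i" "c (k p) j = c (k q) j" for p q i j
  proof -
    have "k p = k q" by (rule oaD[OF oa, of _ _ i j]) (use that k in auto)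
    then show ?thesis using k(2) that by metis
  qed
  have fs: "fst p = f (c (k p) 0)" "snd p = f (c (k p) 1)" if "p \<in> {..<?n} \<times> {..<?n}" for p
    using k(2)[OF that] by (auto simp: g_def prod_eq_iff)
  have eq: "(f (c (k p) i) = f (c (k q) i)) = (c (k p) i = c (k q) i)"
    if "p \<in> {..<?n} \<times> {..<?n}" "q \<in> {..<?n} \<times> {..<?n}" "i < 4" for p q i
    using that by (intro finj X k)
  have lat: "latin {..<?n} {..<?n} (\<lambda>p. f (c (k p) i))" if "i < 4" "i \<ge> 2" for i
    unfolding latin_def
  proof (intro conjI ballI impI)
    fix p q assume pq: "p \<in> {..<?n} \<times> {..<?n}" "q \<in> {..<?n} \<times> {..<?n}" "p \<noteq> q" "fst p = fst q \<or> snd p = snd q"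
    show "f (c (k p) i) \<noteq> f (c (k q) i)"
    proof
      assume "f (c (k p) i) = f (c (k q) i)"
      then have e: "c (k p) i = c (k q) i" using eq pq that by blast
      from pq(4) show False
      proof
        assume "fst p = fst q"
        then have "c (k p) 0 = c (k q) 0" using eq[OF pq(1,2), of 0] fs pq by simp
        then show False using kk[OF pq(1,2), of 0 i] e pq that by simp
      next
        assume "snd p = snd q"
        then have "c (k p) 1 = c (k q) 1" using eq[OF pq(1,2), of 1] fs pq by simp
        then show False using kk[OF pq(1,2), of 1 i] e pq that by simp
      qed
    qed
  qed (use that k X fX in auto)
  moreover have "inj_on (\<lambda>p. (f (c (k p) 2), f (c (k p) 3))) ({..<?n} \<times> {..<?n})"
    by (rule inj_onI) (use kk[of _ _ 2 3] eq in auto)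
  ultimately show ?thesis
    unfolding mols_def using lat[of 2] lat[of 3] by (intro exI conjI) simp_all
qed

definition square_oa :: "('r \<times> 'r \<Rightarrow> 'r) \<Rightarrow> ('r \<times> 'r \<Rightarrow> 'r) \<Rightarrow> 'r \<times> 'r \<Rightarrow> nat \<Rightarrow> 'r" where
  "square_oa A B p i = (if i = 0 then fst p else if i = 1 then snd p else if i = 2 then A p else B p)"

lemma square_oa:
  fixes A B :: "nat \<times> nat \<Rightarrow> nat"
  assumes A: "latin {..<n} {..<n} A" and B: "latin {..<n} {..<n} B"
    and AB: "inj_on (\<lambda>c. (A c, B c)) ({..<n} \<times> {..<n})"
  shows "oa 4 ({..<n} \<times> {..<n}) {..<n} (square_oa A B)"
proof -
  let ?I = "{..<n} \<times> {..<n}" and ?c = "square_oa A B"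
  have lat: "p = q" if "latin {..<n} {..<n} J" "p \<in> ?I" "q \<in> ?I" "J p = J q" "fst p = fst q \<or> snd p = snd q"
    for p q and J :: "nat \<times> nat \<Rightarrow> nat"
    using that unfolding latin_def by blast
  have main: "p = q" if "p \<in> ?I" "q \<in> ?I" "i < j" "j < 4" "?c p i = ?c q i" "?c p j = ?c q j" for p q i j
  proof -
    have "(i = 0 \<and> j = 1) \<or> (i \<le> 1 \<and> j = 2) \<or> (i \<le> 1 \<and> j = 3) \<or> (i = 2 \<and> j = 3)"
      using that(3,4) by arith
    then consider "i = 0" "j = 1" | "i \<le> 1" "j = 2" | "i \<le> 1" "j = 3" | "i = 2" "j = 3"
      by blast
    then show ?thesis
    proof cases
      case 1
      then show ?thesis using that by (auto simp: square_oa_def prod_eq_iff)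
    next
      case 2
      then show ?thesis using that lat[OF A that(1,2)] by (auto simp: square_oa_def split: if_splits)
    next
      case 3
      then show ?thesis using that lat[OF B that(1,2)] by (auto simp: square_oa_def split: if_splits)
    next
      case 4
      then show ?thesis using that inj_onD[OF AB _ that(1,2)] by (auto simp: square_oa_def)
    qed
  qed
  show ?thesis
  proof (rule oaI)
    show "?c p i \<in> {..<n}" if "p \<in> ?I" "i < 4" for p i
    proof -
      have "A p < n" "B p < n" using A B that unfolding latin_def by blast+
      then show ?thesis using that by (auto simp: square_oa_def)
    qed
    show "p = q" if "p \<in> ?I" "q \<in> ?I" "i < 4" "j < 4" "i \<noteq> j" "?c p i = ?c q i" "?c p j = ?c q j" for p q i j
      using main[of p q i j] main[of p q j i] that by (cases "i < j") auto
  qed (auto simp: card_cartesian_product)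
qed

lemma mols_imp_oa:
  assumes "mols n"
  obtains c :: "nat \<times> nat \<Rightarrow> nat \<Rightarrow> nat" where "oa 4 ({..<n} \<times> {..<n}) {..<n} c"
  using assms square_oa unfolding mols_def by blast

lemma oa_product:
  assumes c: "oa k I X c" and d: "oa k J Y d"
  shows "oa k (I \<times> J) (X \<times> Y) (\<lambda>p i. (c (fst p) i, d (snd p) i))"
proof (rule oaI)
  fix p q i j assume *: "p \<in> I \<times> J" "q \<in> I \<times> J" "i < k" "j < k" "i \<noteq> j"
    "(c (fst p) i, d (snd p) i) = (c (fst q) i, d (snd q) i)"
    "(c (fst p) j, d (snd p) j) = (c (fst q) j, d (snd q) j)"
  have "fst p = fst q" by (rule oaD[OF c _ _ *(3-5)]) (use * in auto)
  moreover have "snd p = snd q" by (rule oaD[OF d _ _ *(3-5)]) (use * in auto)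
  ultimately show "p = q" by (rule prod_eqI)
qed (use c d in \<open>auto simp: oa_def card_cartesian_product\<close>)

lemma mols_product:
  assumes "mols a" "mols b"
  shows "mols (a * b)"
proof -
  obtain c :: "nat \<times> nat \<Rightarrow> nat \<Rightarrow> nat" where c: "oa 4 ({..<a} \<times> {..<a}) {..<a} c"
    by (rule mols_imp_oa[OF assms(1)])
  obtain d :: "nat \<times> nat \<Rightarrow> nat \<Rightarrow> nat" where d: "oa 4 ({..<b} \<times> {..<b}) {..<b} d"
    by (rule mols_imp_oa[OF assms(2)])
  show ?thesis
    using oa_imp_mols[OF oa_product[OF c d]] by (simp add: card_cartesian_product)
qed

text \<open>
  Any two of the linear forms have an invertible determinant modulo \<open>t\<close>, so they are independent.
\<close>

lemma linear_oa:
  fixes t :: nat and a b :: "nat \<Rightarrow> int"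
  assumes "t > 0" and det: "\<And>i j. i < k \<Longrightarrow> j < k \<Longrightarrow> i \<noteq> j \<Longrightarrow> coprime (a i * b j - a j * b i) (int t)"
  shows "oa k ({0..<int t} \<times> {0..<int t}) {0..<int t} (\<lambda>(x, y) i. (a i * x + b i * y) mod int t)"
proof -
  have inj: "x = x' \<and> y = y'"
    if mem: "x \<in> {0..<int t}" "y \<in> {0..<int t}" "x' \<in> {0..<int t}" "y' \<in> {0..<int t}"
      and ij: "i < k" "j < k" "i \<noteq> j"
      and e: "(a i * x + b i * y) mod int t = (a i * x' + b i * y') mod int t"
        "(a j * x + b j * y) mod int t = (a j * x' + b j * y') mod int t" for x y x' y' i j
  proof -
    have d: "int t dvd a i * (x - x') + b i * (y - y')" "int t dvd a j * (x - x') + b j * (y - y')"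
      using e by (simp_all add: mod_eq_dvd_iff algebra_simps)
    have "int t dvd b j * (a i * (x - x') + b i * (y - y')) - b i * (a j * (x - x') + b j * (y - y'))"
      using d by (intro dvd_diff dvd_mult)
    then have "int t dvd (a i * b j - a j * b i) * (x - x')" by (simp add: algebra_simps)
    then have x: "int t dvd x - x'" using det[OF ij] by (simp add: coprime_dvd_mult_right_iff coprime_commute)
    have "int t dvd a i * (a j * (x - x') + b j * (y - y')) - a j * (a i * (x - x') + b i * (y - y'))"
      using d by (intro dvd_diff dvd_mult)
    then have "int t dvd (a i * b j - a j * b i) * (y - y')" by (simp add: algebra_simps)
    then have y: "int t dvd y - y'" using det[OF ij] by (simp add: coprime_dvd_mult_right_iff coprime_commute)
    have "x mod int t = x' mod int t" "y mod int t = y' mod int t"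
      using x y by (simp_all add: mod_eq_dvd_iff)
    then show ?thesis using mem by simp
  qed
  show ?thesis
  proof (rule oaI, goal_cases)
    case (4 p i)
    then show ?case using \<open>t > 0\<close> by (simp add: split_def)
  next
    case (5 p q i j)
    then show ?case
      using inj[of "fst p" "snd p" "fst q" "snd q" i j] by (simp add: split_def prod_eq_iff mem_Times_iff)
  qed (simp_all add: card_cartesian_product)
qed

lemma mols_odd:
  assumes "odd n"
  shows "mols n"
proof -
  let ?a = "\<lambda>i. if i = 1 then 0 else 1 :: int" and ?b = "\<lambda>i :: nat. if i \<le> 1 then int i else int i - 1"
  have "oa 4 ({0..<int n} \<times> {0..<int n}) {0..<int n} (\<lambda>(x, y) i. (?a i * x + ?b i * y) mod int n)"
  proof (rule linear_oa)
    fix i j :: nat assume "i < 4" "j < 4" "i \<noteq> j"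
    then have "?a i * ?b j - ?a j * ?b i \<in> {1, -1, 2, -2}" by (auto simp: less_Suc_eq numeral_eq_Suc)
    moreover have "coprime D (int n)" if "D \<in> {1, -1, 2, -2}" for D :: int
      using that assms by (auto simp: coprime_left_2_iff_odd)
    ultimately show "coprime (?a i * ?b j - ?a j * ?b i) (int n)" by blast
  qed (use assms in \<open>auto intro: odd_pos\<close>)
  then show ?thesis using oa_imp_mols by fastforce
qed

text \<open>
  \<open>C\<close> is the inverse of the superposition of \<open>A\<close> and \<open>B\<close>: at the position given by the two symbols of the cell \<open>(i, j)\<close> it has the
  number \<open>n i + j\<close>. It makes the check of orthogonality linear in the number of cells.
\<close>

fun mols_table :: "nat \<Rightarrow> nat list list \<Rightarrow> nat list list \<Rightarrow> nat list list \<Rightarrow> bool" where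
  "mols_table n A B C \<longleftrightarrow>
     length A = n \<and> length B = n \<and>
     list_all (\<lambda>r. length r = n \<and> distinct r \<and> list_all (\<lambda>x. x < n) r) (A @ B) \<and>
     list_all (\<lambda>j. distinct (map (\<lambda>r. r ! j) A) \<and> distinct (map (\<lambda>r. r ! j) B)) [0..<n] \<and>
     list_all (\<lambda>i. list_all (\<lambda>j. C ! (A ! i ! j) ! (B ! i ! j) = n * i + j) [0..<n]) [0..<n]"

lemma mols_tableD:
  assumes "mols_table n A B C"
  shows "mols n"
    and "latin {..<n} {..<n} (\<lambda>(i, j). A ! i ! j)" "latin {..<n} {..<n} (\<lambda>(i, j). B ! i ! j)"
    and "inj_on (\<lambda>(i, j). (A ! i ! j, B ! i ! j)) ({..<n} \<times> {..<n})"
proof -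
  have lat: "latin {..<n} {..<n} (\<lambda>(i, j). A ! i ! j)"
    if l: "length A = n" and r: "\<And>r. r \<in> set A \<Longrightarrow> length r = n \<and> distinct r \<and> (\<forall>x\<in>set r. x < n)"
      and c: "\<And>j. j < n \<Longrightarrow> distinct (map (\<lambda>r. r ! j) A)" for A :: "nat list list"
  proof -
    have row: "length (A ! i) = n" "distinct (A ! i)" if "i < n" for i
      using r[of "A ! i"] that l by auto
    have lt: "A ! i ! j < n" if "i < n" "j < n" for i j
      using r[of "A ! i"] row(1)[OF that(1)] that l nth_mem[of i A] nth_mem[of j "A ! i"] by simp
    have rw: "A ! i ! j \<noteq> A ! i ! j'" if "i < n" "j < n" "j' < n" "j \<noteq> j'" for i j j'
      using row[OF that(1)] that by (simp add: nth_eq_iff_index_eq)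
    have cl: "A ! i ! j \<noteq> A ! i' ! j" if "i < n" "i' < n" "j < n" "i \<noteq> i'" for i i' j
      using c[OF that(3)] that l nth_eq_iff_index_eq[of "map (\<lambda>r. r ! j) A" i i'] by simp
    show ?thesis
      unfolding latin_def
    proof (intro conjI ballI impI)
      fix p q assume "p \<in> {..<n} \<times> {..<n}" "q \<in> {..<n} \<times> {..<n}" "p \<noteq> q" "fst p = fst q \<or> snd p = snd q"
      then show "(case p of (i, j) \<Rightarrow> A ! i ! j) \<noteq> (case q of (i, j) \<Rightarrow> A ! i ! j)"
        using rw[of "fst p" "snd p" "snd q"] cl[of "fst p" "fst q" "snd p"]
        by (auto simp: split_def prod_eq_iff)
    qed (use lt in auto)
  qed
  show A: "latin {..<n} {..<n} (\<lambda>(i, j). A ! i ! j)"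
    by (rule lat) (use assms in \<open>auto simp: list_all_iff\<close>)
  show B: "latin {..<n} {..<n} (\<lambda>(i, j). B ! i ! j)"
    by (rule lat) (use assms in \<open>auto simp: list_all_iff\<close>)
  show AB: "inj_on (\<lambda>(i, j). (A ! i ! j, B ! i ! j)) ({..<n} \<times> {..<n})"
  proof (rule inj_on_inverseI, clarify)
    fix i j assume "i < n" "j < n"
    moreover from this have "C ! (A ! i ! j) ! (B ! i ! j) = n * i + j"
      using assms by (simp add: list_all_iff)
    ultimately show "(\<lambda>(a, b). (C ! a ! b div n, C ! a ! b mod n)) (A ! i ! j, B ! i ! j) = (i, j)"
      by simp
  qed
  show "mols n"
    unfolding mols_def using A B AB by (intro exI conjI) (auto simp: split_def)
qed

lemma table_4: "mols_table 4
  [[3, 2, 1, 0],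
   [2, 3, 0, 1],
   [1, 0, 3, 2],
   [0, 1, 2, 3]]
  [[1, 3, 2, 0],
   [0, 2, 3, 1],
   [3, 1, 0, 2],
   [2, 0, 1, 3]]
  [[3, 9, 12, 6],
   [13, 7, 2, 8],
   [4, 14, 11, 1],
   [10, 0, 5, 15]]"
  by code_simp

definition first_square_8 :: "nat list list" where
  "first_square_8 = [[0, 6, 2, 4, 1, 7, 3, 5],
   [6, 0, 4, 2, 7, 1, 5, 3],
   [2, 4, 0, 6, 3, 5, 1, 7],
   [4, 2, 6, 0, 5, 3, 7, 1],
   [1, 7, 3, 5, 0, 6, 2, 4],
   [7, 1, 5, 3, 6, 0, 4, 2],
   [3, 5, 1, 7, 2, 4, 0, 6],
   [5, 3, 7, 1, 4, 2, 6, 0]]"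

definition second_square_8 :: "nat list list" where
  "second_square_8 = [[0, 3, 4, 7, 2, 1, 6, 5],
   [1, 2, 5, 6, 3, 0, 7, 4],
   [3, 0, 7, 4, 1, 2, 5, 6],
   [2, 1, 6, 5, 0, 3, 4, 7],
   [4, 7, 0, 3, 6, 5, 2, 1],
   [5, 6, 1, 2, 7, 4, 3, 0],
   [7, 4, 3, 0, 5, 6, 1, 2],
   [6, 5, 2, 1, 4, 7, 0, 3]]"

lemma table_8: "mols_table 8 first_square_8 second_square_8
  [[0, 54, 9, 63, 45, 27, 36, 18],
   [13, 59, 4, 50, 32, 22, 41, 31],
   [47, 25, 38, 16, 2, 52, 11, 61],
   [34, 20, 43, 29, 15, 57, 6, 48],
   [17, 39, 24, 46, 60, 10, 53, 3],
   [28, 42, 21, 35, 49, 7, 56, 14],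
   [62, 8, 55, 1, 19, 37, 26, 44],
   [51, 5, 58, 12, 30, 40, 23, 33]]"
  by code_simp

text \<open>
  The squares of order 10 and 14 are developed cyclically from base blocks, modulo 7 and modulo 11, with three fixed
  points.
\<close>

lemma table_10: "mols_table 10
  [[0, 9, 8, 4, 7, 2, 1, 5, 6, 3],
   [2, 1, 9, 8, 5, 7, 3, 6, 0, 4],
   [4, 3, 2, 9, 8, 6, 7, 0, 1, 5],
   [7, 5, 4, 3, 9, 8, 0, 1, 2, 6],
   [1, 7, 6, 5, 4, 9, 8, 2, 3, 0],
   [8, 2, 7, 0, 6, 5, 9, 3, 4, 1],
   [9, 8, 3, 7, 1, 0, 6, 4, 5, 2],
   [5, 6, 0, 1, 2, 3, 4, 7, 8, 9],
   [6, 0, 1, 2, 3, 4, 5, 8, 9, 7],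
   [3, 4, 5, 6, 0, 1, 2, 9, 7, 8]]
  [[0, 4, 1, 9, 2, 7, 8, 3, 5, 6],
   [8, 1, 5, 2, 9, 3, 7, 4, 6, 0],
   [7, 8, 2, 6, 3, 9, 4, 5, 0, 1],
   [5, 7, 8, 3, 0, 4, 9, 6, 1, 2],
   [9, 6, 7, 8, 4, 1, 5, 0, 2, 3],
   [6, 9, 0, 7, 8, 5, 2, 1, 3, 4],
   [3, 0, 9, 1, 7, 8, 6, 2, 4, 5],
   [2, 3, 4, 5, 6, 0, 1, 7, 9, 8],
   [1, 2, 3, 4, 5, 6, 0, 8, 7, 9],
   [4, 5, 6, 0, 1, 2, 3, 9, 8, 7]]
  [[0, 94, 81, 49, 72, 27, 18, 53, 65, 36],
   [28, 11, 95, 82, 59, 73, 37, 64, 6, 40],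
   [47, 38, 22, 96, 83, 69, 74, 5, 10, 51],
   [75, 57, 48, 33, 90, 84, 9, 16, 21, 62],
   [19, 76, 67, 58, 44, 91, 85, 20, 32, 3],
   [86, 29, 70, 7, 68, 55, 92, 31, 43, 14],
   [93, 80, 39, 71, 17, 8, 66, 42, 54, 25],
   [52, 63, 4, 15, 26, 30, 41, 77, 98, 89],
   [61, 2, 13, 24, 35, 46, 50, 99, 87, 78],
   [34, 45, 56, 60, 1, 12, 23, 88, 79, 97]]"
  by code_simp

lemma table_14: "mols_table 14
  [[0, 5, 7, 9, 11, 1, 13, 4, 10, 8, 12, 6, 3, 2],
   [12, 1, 6, 8, 10, 11, 2, 13, 5, 0, 9, 7, 4, 3],
   [10, 12, 2, 7, 9, 0, 11, 3, 13, 6, 1, 8, 5, 4],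
   [2, 0, 12, 3, 8, 10, 1, 11, 4, 13, 7, 9, 6, 5],
   [8, 3, 1, 12, 4, 9, 0, 2, 11, 5, 13, 10, 7, 6],
   [13, 9, 4, 2, 12, 5, 10, 1, 3, 11, 6, 0, 8, 7],
   [7, 13, 10, 5, 3, 12, 6, 0, 2, 4, 11, 1, 9, 8],
   [11, 8, 13, 0, 6, 4, 12, 7, 1, 3, 5, 2, 10, 9],
   [6, 11, 9, 13, 1, 7, 5, 12, 8, 2, 4, 3, 0, 10],
   [5, 7, 11, 10, 13, 2, 8, 6, 12, 9, 3, 4, 1, 0],
   [4, 6, 8, 11, 0, 13, 3, 9, 7, 12, 10, 5, 2, 1],
   [1, 2, 3, 4, 5, 6, 7, 8, 9, 10, 0, 11, 12, 13],
   [9, 10, 0, 1, 2, 3, 4, 5, 6, 7, 8, 12, 13, 11],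
   [3, 4, 5, 6, 7, 8, 9, 10, 0, 1, 2, 13, 11, 12]]
  [[0, 11, 3, 13, 10, 9, 8, 6, 4, 12, 2, 7, 1, 5],
   [3, 1, 11, 4, 13, 0, 10, 9, 7, 5, 12, 8, 2, 6],
   [12, 4, 2, 11, 5, 13, 1, 0, 10, 8, 6, 9, 3, 7],
   [7, 12, 5, 3, 11, 6, 13, 2, 1, 0, 9, 10, 4, 8],
   [10, 8, 12, 6, 4, 11, 7, 13, 3, 2, 1, 0, 5, 9],
   [2, 0, 9, 12, 7, 5, 11, 8, 13, 4, 3, 1, 6, 10],
   [4, 3, 1, 10, 12, 8, 6, 11, 9, 13, 5, 2, 7, 0],
   [6, 5, 4, 2, 0, 12, 9, 7, 11, 10, 13, 3, 8, 1],
   [13, 7, 6, 5, 3, 1, 12, 10, 8, 11, 0, 4, 9, 2],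
   [1, 13, 8, 7, 6, 4, 2, 12, 0, 9, 11, 5, 10, 3],
   [11, 2, 13, 9, 8, 7, 5, 3, 12, 1, 10, 6, 0, 4],
   [5, 6, 7, 8, 9, 10, 0, 1, 2, 3, 4, 11, 13, 12],
   [8, 9, 10, 0, 1, 2, 3, 4, 5, 6, 7, 12, 11, 13],
   [9, 10, 0, 1, 2, 3, 4, 5, 6, 7, 8, 13, 12, 11]]
  [[0, 81, 101, 139, 164, 23, 190, 62, 144, 124, 170, 91, 43, 33],
   [171, 15, 95, 116, 153, 154, 38, 191, 77, 5, 138, 106, 58, 48],
   [152, 172, 30, 109, 131, 13, 155, 42, 192, 92, 20, 121, 73, 63],
   [35, 12, 173, 45, 123, 146, 27, 156, 57, 182, 107, 136, 88, 78],
   [122, 50, 26, 174, 60, 137, 7, 41, 157, 72, 183, 140, 103, 93],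
   [184, 126, 65, 40, 175, 75, 151, 22, 55, 158, 87, 1, 118, 108],
   [102, 185, 141, 80, 54, 176, 90, 11, 37, 69, 159, 16, 133, 112],
   [160, 117, 186, 2, 84, 68, 177, 105, 25, 52, 83, 31, 148, 127],
   [97, 161, 132, 187, 17, 99, 82, 178, 120, 39, 56, 46, 9, 142],
   [71, 111, 162, 147, 188, 32, 114, 96, 168, 135, 53, 61, 24, 3],
   [67, 86, 125, 163, 8, 189, 47, 129, 110, 169, 150, 76, 28, 18],
   [19, 34, 49, 64, 79, 94, 98, 113, 128, 143, 4, 165, 194, 181],
   [134, 149, 10, 14, 29, 44, 59, 74, 89, 104, 119, 195, 179, 166],
   [51, 66, 70, 85, 100, 115, 130, 145, 6, 21, 36, 180, 167, 193]]"
  by code_simp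

lemma mols_4_dvd:
  assumes "4 dvd n" "n > 0"
  shows "mols n"
  using assms
proof (induction n rule: less_induct)
  case (less n)
  then obtain m where m: "n = 4 * m" "m > 0" by (auto elim: dvdE)
  show ?case
  proof (cases "odd m")
    case True
    then show ?thesis using m mols_product[OF mols_tableD(1)[OF table_4] mols_odd] by simp
  next
    case False
    then obtain l where l: "m = 2 * l" by (auto elim: evenE)
    show ?thesis
    proof (cases "odd l")
      case True
      then show ?thesis using m l mols_product[OF mols_tableD(1)[OF table_8] mols_odd] by simp
    next
      case False
      then have "4 dvd m" using l by (auto elim: evenE)
      then have "mols m" using less.IH[of m] m by simp
      then show ?thesis using m mols_product[OF mols_tableD(1)[OF table_4]] by simp
    qed
  qed
qed

section \<open>Wilson's construction\<close>

text \<open>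
  An orthogonal array \<open>\<beta>\<close> with five columns of order \<open>t\<close> is a transversal design with \<open>t\<^sup>2\<close> blocks;
  its fifth column is truncated to \<open>u\<close> points. Each point of the first four columns is tripled. A block that
  misses the truncated column is filled with an array of order 3, a block that meets it in a point \<open>\<infinity>\<close> is filled with an array of
  order 4 whose symbol 3 stands for \<open>\<infinity>\<close>, without its row \<open>\<omega>\<close> in which every entry is \<open>\<infinity>\<close>. An array of order \<open>u\<close> on
  the points \<open>\<infinity>\<close> supplies the missing pairs.
\<close>

lemma mols_wilson:
  assumes t: "coprime t 6" "t > 0" and u: "odd u" "u \<le> t"
  shows "mols (3 * t + u)"
proof -
  have "mols 3" by (rule mols_odd) simp
  then obtain \<mu> :: "nat \<times> nat \<Rightarrow> nat \<Rightarrow> nat" where \<mu>: "oa 4 ({..<3} \<times> {..<3}) {..<3} \<mu>"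
    by (rule mols_imp_oa)
  obtain \<sigma> :: "nat \<times> nat \<Rightarrow> nat \<Rightarrow> nat" where \<sigma>: "oa 4 ({..<u} \<times> {..<u}) {..<u} \<sigma>"
    by (rule mols_imp_oa[OF mols_odd[OF u(1)]])
  define \<omega> :: "nat \<times> nat" where "\<omega> = (3, 3)"
  (* The row (3, 3) of this square of order 4 has the symbol 3 in both squares. *)
  obtain \<nu> :: "nat \<times> nat \<Rightarrow> nat \<Rightarrow> nat" where \<nu>: "oa 4 ({..<4} \<times> {..<4}) {..<4} \<nu>"
    and \<omega>: "\<And>i. i < 4 \<Longrightarrow> \<nu> \<omega> i = 3"
  proof (rule that)
    show "oa 4 ({..<4} \<times> {..<4}) {..<4} (square_oa (\<lambda>(i, j). [[3, 2, 1, 0],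
         [2, 3, 0, 1],
         [1, 0, 3, 2],
         [0, 1, 2, 3]] ! i ! j) (\<lambda>(i, j). [[1, 3, 2, 0],
         [0, 2, 3, 1],
         [3, 1, 0, 2],
         [2, 0, 1, 3]] ! i ! j))"
      using mols_tableD(2-4)[OF table_4] by (intro square_oa) (simp_all only: split_def)
  qed (simp add: square_oa_def \<omega>_def)
  have \<omega>4: "\<omega> \<in> {..<4} \<times> {..<4}" by (simp add: \<omega>_def)
  let ?a = "\<lambda>i. if i = 1 then 0 else 1 :: int" and ?b = "\<lambda>i :: nat. if i \<le> 1 then int i else int i - 1"
  let ?T = "{0..<int t}"
  obtain \<beta> where \<beta>: "oa 5 (?T \<times> ?T) ?T \<beta>"
  proof (rule that, rule linear_oa)
    fix i j :: nat assume "i < 5" "j < 5" "i \<noteq> j"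
    then have "?a i * ?b j - ?a j * ?b i \<in> {1, -1, 2, -2, 3, -3}" by (auto simp: less_Suc_eq numeral_eq_Suc)
    moreover have "coprime D (int t)" if "D \<in> {1, -1, 2, -2, 3, -3}" for D :: int
    proof -
      have "coprime (int t) (int 6)" using t(1) by (simp only: coprime_int_iff)
      then have "coprime 6 (int t)" by (simp add: coprime_commute)
      then have "coprime 2 (int t)" "coprime 3 (int t)"
        by (auto intro: coprime_divisors[of _ 6 "int t" "int t"])
      then show ?thesis using that by auto
    qed
    ultimately show "coprime (?a i * ?b j - ?a j * ?b i) (int t)" by blast
  qed (use t in auto)
  have \<beta>T: "\<beta> b i \<in> ?T" if "b \<in> ?T \<times> ?T" "i < 5" for b i
    using \<beta> that unfolding oa_def by blast
  define Lo where "Lo = {b \<in> ?T \<times> ?T. \<beta> b 4 < int u}"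
  have Lo: "card Lo = t * u"
  proof -
    let ?f = "\<lambda>b. (\<beta> b 0, \<beta> b 4)"
    have inj: "inj_on ?f (?T \<times> ?T)"
      by (rule inj_onI) (rule oaD[OF \<beta>, of _ _ 0 4], auto)
    have "?f ` (?T \<times> ?T) = ?T \<times> ?T"
    proof (rule card_subset_eq)
      show "?f ` (?T \<times> ?T) \<subseteq> ?T \<times> ?T" using \<beta>T by auto
    qed (use card_image[OF inj] in simp_all)
    moreover have "?f ` Lo = {y \<in> ?f ` (?T \<times> ?T). snd y < int u}" by (auto simp: Lo_def)
    ultimately have "?f ` Lo = {y \<in> ?T \<times> ?T. snd y < int u}" by simp
    also have "\<dots> = ?T \<times> {0..<int u}" using u(2) by auto
    finally have im: "?f ` Lo = ?T \<times> {0..<int u}" .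
    have "inj_on ?f Lo" using inj by (rule inj_on_subset) (auto simp: Lo_def)
    from card_image[OF this, unfolded im] show ?thesis by (simp add: card_cartesian_product)
  qed
  let ?I = "((?T \<times> ?T - Lo) \<times> ({..<3::nat} \<times> {..<3::nat})) <+> ((Lo \<times> ({..<4::nat} \<times> {..<4::nat} - {\<omega>})) <+> ({..<u} \<times> {..<u}))"
  let ?X = "({..<3::nat} \<times> ?T) <+> {..<u}"
  define c where "c \<alpha> i = (case \<alpha> of
       Inl (b, \<tau>) \<Rightarrow> Inl (\<mu> \<tau> i, \<beta> b i)
     | Inr (Inl (b, \<tau>)) \<Rightarrow> if \<nu> \<tau> i = 3 then Inr (nat (\<beta> b 4)) else Inl (\<nu> \<tau> i, \<beta> b i)
     | Inr (Inr \<tau>) \<Rightarrow> Inr (\<sigma> \<tau> i))" for \<alpha> and i :: nat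
  have card_X: "card ?X = 3 * t + u" by (simp add: card_Plus card_cartesian_product)
  have "oa 4 ?I ?X c"
  proof (rule oaI)
    obtain v where v: "t = u + v" using u(2) le_Suc_ex by blast
    have fLo: "finite Lo" "Lo \<subseteq> ?T \<times> ?T" by (auto simp: Lo_def)
    have c1: "card (?T \<times> ?T - Lo) = t * t - t * u"
      using Lo by (simp add: card_Diff_subset[OF fLo] card_cartesian_product)
    have c2: "card ({..<4::nat} \<times> {..<4::nat} - {\<omega>}) = 15" using \<omega>4 by simp
    have "card ?I = (t * t - t * u) * 9 + (t * u * 15 + u * u)"
    proof -
      have f: "finite ((?T \<times> ?T - Lo) \<times> ({..<3::nat} \<times> {..<3::nat}))"
        "finite (Lo \<times> ({..<4::nat} \<times> {..<4::nat} - {\<omega>}))" "finite ({..<u} \<times> {..<u})"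
        using fLo(1) by auto
      show ?thesis
        unfolding card_Plus[OF f(1) finite_Plus[OF f(2,3)]] card_Plus[OF f(2,3)] card_cartesian_product c1 c2 Lo
        by simp
    qed
    also have "\<dots> = (3 * t + u) * (3 * t + u)" by (simp add: v algebra_simps)
    finally show "card ?I = card ?X * card ?X" by (simp only: card_X)
  next
    fix \<alpha> i assume \<alpha>: "\<alpha> \<in> ?I" and i: "i < (4::nat)"
    have \<mu>3: "\<mu> \<tau> i \<in> {..<3}" if "\<tau> \<in> {..<3} \<times> {..<3}" for \<tau>
      using \<mu> i that unfolding oa_def by blast
    have \<nu>4: "\<nu> \<tau> i \<in> {..<4}" if "\<tau> \<in> {..<4} \<times> {..<4}" for \<tau>
      using \<nu> i that unfolding oa_def by blast
    have \<sigma>u: "\<sigma> \<tau> i \<in> {..<u}" if "\<tau> \<in> {..<u} \<times> {..<u}" for \<tau>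
      using \<sigma> i that unfolding oa_def by blast
    consider (1) b \<tau> where "\<alpha> = Inl (b, \<tau>)" | (2) b \<tau> where "\<alpha> = Inr (Inl (b, \<tau>))"
      | (3) \<tau> where "\<alpha> = Inr (Inr \<tau>)"
      by (metis surj_pair sum.exhaust)
    then show "c \<alpha> i \<in> ?X"
    proof cases
      case 1
      then have "b \<in> ?T \<times> ?T" "\<tau> \<in> {..<3} \<times> {..<3}" using \<alpha> by auto
      then have "\<mu> \<tau> i \<in> {..<3}" "\<beta> b i \<in> ?T" using \<mu>3 \<beta>T i by simp_all
      then have "(\<mu> \<tau> i, \<beta> b i) \<in> {..<3} \<times> ?T" by blast
      then have "Inl (\<mu> \<tau> i, \<beta> b i) \<in> ?X" by (rule InlI)
      then show ?thesis by (simp only: 1 c_def sum.case prod.case)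
    next
      case 2
      then have "b \<in> ?T \<times> ?T" "\<tau> \<in> {..<4} \<times> {..<4}" "\<beta> b 4 < int u" "0 \<le> \<beta> b 4"
        using \<alpha> \<beta>T[of b 4] by (auto simp: Lo_def)
      moreover from this have "\<nu> \<tau> i < 4" "\<beta> b i \<in> ?T" using \<nu>4[of \<tau>] \<beta>T[of b i] i by simp_all
      ultimately have "\<nu> \<tau> i \<noteq> 3 \<Longrightarrow> (\<nu> \<tau> i, \<beta> b i) \<in> {..<3} \<times> ?T" "nat (\<beta> b 4) \<in> {..<u}" by auto
      then have "\<nu> \<tau> i \<noteq> 3 \<Longrightarrow> Inl (\<nu> \<tau> i, \<beta> b i) \<in> ?X" "Inr (nat (\<beta> b 4)) \<in> ?X"
        by (blast intro: InlI InrI)+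
      then show ?thesis by (simp only: 2 c_def sum.case prod.case split: if_split) blast
    next
      case 3
      then have "\<sigma> \<tau> i \<in> {..<u}" using \<alpha> by (intro \<sigma>u) blast
      then have "Inr (\<sigma> \<tau> i) \<in> ?X" by (rule InrI)
      then show ?thesis by (simp only: 3 c_def sum.case prod.case)
    qed
  next
    fix \<alpha> \<gamma> i j assume mem: "\<alpha> \<in> ?I" "\<gamma> \<in> ?I" and ij: "i < (4::nat)" "j < (4::nat)" "i \<noteq> j"
      and e: "c \<alpha> i = c \<gamma> i" "c \<alpha> j = c \<gamma> j"
    have eq_block: "b = b'" if "b \<in> ?T \<times> ?T" "b' \<in> ?T \<times> ?T" "k < 5" "l < 5" "k \<noteq> l"
      "\<beta> b k = \<beta> b' k" "\<beta> b l = \<beta> b' l" for b b' k l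
      using that by (rule oaD[OF \<beta>])
    have not_\<omega>: "\<not> (\<nu> \<tau> i = 3 \<and> \<nu> \<tau> j = 3)" if "\<tau> \<in> {..<4} \<times> {..<4}" "\<tau> \<noteq> \<omega>" for \<tau>
      using oaD[OF \<nu> that(1) \<omega>4 ij] \<omega> ij that by auto
    have sub: "Lo \<subseteq> ?T \<times> ?T" by (auto simp: Lo_def)
    consider (11) b \<tau> b' \<tau>' where "\<alpha> = Inl (b, \<tau>)" "\<gamma> = Inl (b', \<tau>')"
      | (12) b \<tau> b' \<tau>' where "\<alpha> = Inl (b, \<tau>)" "\<gamma> = Inr (Inl (b', \<tau>'))"
      | (13) b \<tau> \<tau>' where "\<alpha> = Inl (b, \<tau>)" "\<gamma> = Inr (Inr \<tau>')"
      | (21) b \<tau> b' \<tau>' where "\<alpha> = Inr (Inl (b, \<tau>))" "\<gamma> = Inl (b', \<tau>')"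
      | (22) b \<tau> b' \<tau>' where "\<alpha> = Inr (Inl (b, \<tau>))" "\<gamma> = Inr (Inl (b', \<tau>'))"
      | (23) b \<tau> \<tau>' where "\<alpha> = Inr (Inl (b, \<tau>))" "\<gamma> = Inr (Inr \<tau>')"
      | (31) \<tau> b' \<tau>' where "\<alpha> = Inr (Inr \<tau>)" "\<gamma> = Inl (b', \<tau>')"
      | (32) \<tau> b' \<tau>' where "\<alpha> = Inr (Inr \<tau>)" "\<gamma> = Inr (Inl (b', \<tau>'))"
      | (33) \<tau> \<tau>' where "\<alpha> = Inr (Inr \<tau>)" "\<gamma> = Inr (Inr \<tau>')"
      by (metis surj_pair sum.exhaust)
    then show "\<alpha> = \<gamma>"
    proof cases
      case 11
      have "\<tau> = \<tau>'" by (rule oaD[OF \<mu> _ _ ij]) (use 11 mem e in \<open>auto simp: c_def\<close>)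
      moreover have "b = b'" by (rule eq_block[of _ _ i j]) (use 11 mem e ij in \<open>auto simp: c_def\<close>)
      ultimately show ?thesis using 11 by simp
    next
      case 12
      then have "b = b'"
        using mem e ij sub by (intro eq_block[of _ _ i j]) (auto simp: c_def split: if_splits)
      then show ?thesis using 12 mem by auto
    next
      case 13
      then show ?thesis using e by (simp add: c_def)
    next
      case 21
      then have "b = b'"
        using mem e ij sub by (intro eq_block[of _ _ i j]) (auto simp: c_def split: if_splits)
      then show ?thesis using 21 mem by auto
    next
      case 22
      have b: "b \<in> ?T \<times> ?T" "b' \<in> ?T \<times> ?T" and \<tau>: "\<tau> \<in> {..<4} \<times> {..<4}" "\<tau> \<noteq> \<omega>" "\<tau>' \<in> {..<4} \<times> {..<4}"
        using 22 mem sub by auto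
      have \<nu>eq: "\<nu> \<tau> k = \<nu> \<tau>' k \<and> (if \<nu> \<tau> k = 3 then \<beta> b 4 = \<beta> b' 4 else \<beta> b k = \<beta> b' k)"
        if "c \<alpha> k = c \<gamma> k" for k
        using that 22 \<beta>T[OF b(1), of 4] \<beta>T[OF b(2), of 4] by (auto simp: c_def split: if_splits)
      have "\<tau> = \<tau>'" by (rule oaD[OF \<nu> \<tau>(1,3) ij]) (use \<nu>eq e in auto)
      moreover have "b = b'"
      proof (cases "\<nu> \<tau> i = 3")
        case True
        then show ?thesis using \<nu>eq[OF e(1)] \<nu>eq[OF e(2)] not_\<omega>[OF \<tau>(1,2)] ij eq_block[OF b, of 4 j] by auto
      next
        case i: False
        show ?thesis
        proof (cases "\<nu> \<tau> j = 3")
          case True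
          then show ?thesis using \<nu>eq[OF e(1)] \<nu>eq[OF e(2)] i ij eq_block[OF b, of 4 i] by auto
        next
          case False
          then show ?thesis using \<nu>eq[OF e(1)] \<nu>eq[OF e(2)] i ij eq_block[OF b, of i j] by auto
        qed
      qed
      ultimately show ?thesis using 22 by simp
    next
      case 23
      then show ?thesis using e mem not_\<omega>[of \<tau>] by (auto simp: c_def split: if_splits)
    next
      case 31
      then show ?thesis using e by (simp add: c_def)
    next
      case 32
      then show ?thesis using e mem not_\<omega>[of \<tau>'] by (auto simp: c_def split: if_splits)
    next
      case 33
      have "\<tau> = \<tau>'" by (rule oaD[OF \<sigma> _ _ ij]) (use 33 mem e in \<open>auto simp: c_def\<close>)
      then show ?thesis using 33 by simp
    qed
  qed (auto simp: Lo_def)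
  from oa_imp_mols[OF this] show ?thesis by (simp add: card_X)
qed

lemma coprime_6_between:
  fixes a b :: nat
  assumes "a + 3 \<le> b"
  obtains t where "a \<le> t" "t \<le> b" "coprime t 6"
proof -
  have "(a mod 6 = 1 \<or> a mod 6 = 5) \<or> ((a + 1) mod 6 = 1 \<or> (a + 1) mod 6 = 5) \<or>
      (a + 2) mod 6 = 5 \<or> (a + 3) mod 6 = 5"
    by presburger
  then obtain t where t: "t \<in> {a, a + 1, a + 2, a + 3}" "t mod 6 = 1 \<or> t mod 6 = 5" by blast
  have "coprime t 6"
  proof -
    have "gcd t 6 = gcd (t mod 6) 6" by (metis gcd.commute gcd_red_nat)
    moreover have "gcd (1::nat) 6 = 1" "gcd (5::nat) 6 = 1" by code_simp+
    ultimately show ?thesis using t(2) unfolding coprime_iff_gcd_eq_1 by metis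
  qed
  then show thesis using t(1) assms by (intro that[of t]) auto
qed

text \<open>
  Only the orders that are 2 modulo 4 need Wilson's construction, with \<open>t\<close> coprime to 6 and \<open>u = n - 3 t \<le> t\<close>. From 52 on the
  interval from \<open>n / 4\<close> to \<open>n / 3\<close> contains such a number \<open>t\<close>; below, \<open>t\<close> is one of 5, 7, 11 and 13, and 10, 14 and 30 are done directly.
\<close>

theorem mols_exist:
  assumes "n > 0" "n \<noteq> 2" "n \<noteq> 6"
  shows "mols n"
proof -
  have "odd n \<or> 4 dvd n \<or> n mod 4 = 2" by presburger
  then consider "odd n" | "4 dvd n" | "n mod 4 = 2" by blast
  then show ?thesis
  proof cases
    case 1
    then show ?thesis by (rule mols_odd)
  next
    case 2
    then show ?thesis using assms by (intro mols_4_dvd)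
  next
    case 3
    have wilson: "mols n" if "coprime t 6" "t > 0" "odd t" "3 * t < n" "n \<le> 4 * t" for t
    proof -
      have "odd (n - 3 * t)" using that 3 by presburger
      then have "mols (3 * t + (n - 3 * t))" using that by (intro mols_wilson) auto
      then show ?thesis using that by simp
    qed
    show ?thesis
    proof (cases "n \<ge> 52")
      case True
      define a where "a = (n + 3) div 4"
      have a: "4 * a \<le> n + 3" "n + 3 < 4 + 4 * a"
        unfolding a_def by (simp_all add: dividend_less_times_div)
      then have "3 * a + 9 < n" using True by linarith
      then have "(a + 3) * 3 \<le> n - 1" by arith
      then have "a + 3 \<le> (n - 1) div 3" by (simp only: less_eq_div_iff_mult_less_eq zero_less_numeral)
      then obtain t where t: "a \<le> t" "t \<le> (n - 1) div 3" "coprime t 6"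
        by (rule coprime_6_between)
      have "odd t"
      proof
        assume "even t"
        then show False using coprime_common_divisor[OF t(3), of 2] by simp
      qed
      moreover have "t * 3 \<le> n - 1" using t(2) by (simp only: less_eq_div_iff_mult_less_eq zero_less_numeral)
      then have "3 * t < n" using True by arith
      moreover have "n \<le> 4 * t" "t > 0" using t(1) a(2) True by linarith+
      ultimately show ?thesis using t(3) by (intro wilson)
    next
      case False
      have "coprime 5 (6::nat)" "coprime 7 (6::nat)" "coprime 11 (6::nat)" "coprime 13 (6::nat)" by code_simp+
      then have w: "n = 18 \<Longrightarrow> ?thesis" "n \<in> {22, 26} \<Longrightarrow> ?thesis" "n \<in> {34, 38, 42} \<Longrightarrow> ?thesis"
        "n \<in> {46, 50} \<Longrightarrow> ?thesis"
        using wilson[of 5] wilson[of 7] wilson[of 11] wilson[of 13] by auto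
      have "n = 4 * (n div 4) + 2" "n div 4 < 13" using 3 False div_mult_mod_eq[of n 4] by linarith+
      moreover have "k \<in> {0, 1, 2, 3, 4, 5, 6, 7, 8, 9, 10, 11, 12}" if "k < 13" for k :: nat
        using that by (simp add: numeral_eq_Suc less_Suc_eq)
      ultimately obtain k where "n = 4 * k + 2" "k \<in> {0, 1, 2, 3, 4, 5, 6, 7, 8, 9, 10, 11, 12}" by blast
      then have "n \<in> {2, 6, 10, 14, 18, 22, 26, 30, 34, 38, 42, 46, 50}" by auto
      moreover have "mols 10" "mols 14" by (rule mols_tableD(1)[OF table_10], rule mols_tableD(1)[OF table_14])
      moreover have "mols (3 * 10)" by (rule mols_product[OF mols_odd]) (simp_all add: \<open>mols 10\<close>)
      ultimately show ?thesis using w assms(2,3) by auto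
    qed
  qed
qed

section \<open>Blocked arrays\<close>

lemma mated_blocked:
  assumes "mated a" "a \<ge> 2"
  obtains x K where "blocked {..<a} {..<a} {..<a :: nat} (x :: nat \<times> nat \<Rightarrow> nat \<Rightarrow> complex) K (\<lambda>_. 0)"
proof -
  let ?A = "{..<a}"
  obtain m and L L' :: "nat \<times> nat \<Rightarrow> nat" where t: "two_mates ?A ?A ?A (m :: nat \<Rightarrow> nat \<times> nat \<Rightarrow> nat \<Rightarrow> complex) L L'"
    using assms(1) unfolding mated_def by blast
  have "latin ?A ?A L" "qarray ?A ?A (m 0)" "mate ?A ?A (m 0) L"
    and ray: "\<And>c d. c \<in> ?A \<times> ?A \<Longrightarrow> d \<in> ?A \<times> ?A \<Longrightarrow> same_ray ?A (m 0 c) (m 0 d) \<Longrightarrow> c = d"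
    using t unfolding two_mates_def by blast+
  moreover have "\<exists>y\<in>?A. y \<noteq> k" for k
    using assms(2) by (intro bexI[of _ "if k = 0 then 1 else 0"]) auto
  ultimately have "blocked ?A ?A ?A (m 0) L (\<lambda>_. 0)"
    unfolding blocked_def by (intro conjI ballI impI) (auto intro: ray)
  then show thesis by (rule that)
qed

text \<open>
  The tensor product with an array of standard basis vectors \<open>e\<close>, labelled by the first Latin square \<open>A\<close>; the new mate
  records the symbol of the second one, \<open>B\<close>. The symbols of \<open>B\<close> refine the blocks, so that inside a block \<open>A\<close> and \<open>B\<close> together
  show the cell of the second factor.
\<close>

lemma blocked_inflate:
  fixes R :: "'r set" and X :: "'x set" and S :: "'s set"
  assumes b: "blocked R X S x K h" and k: "mols k"
  obtains x' K' h' where "blocked (R \<times> {..<k}) (X \<times> {..<k}) (S \<times> {..<k})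
    (x' :: ('r \<times> nat) \<times> ('r \<times> nat) \<Rightarrow> 'x \<times> nat \<Rightarrow> complex) (K' :: _ \<Rightarrow> 's \<times> nat) h'"
proof -
  let ?k = "{..<k}"
  have fin: "finite R" "finite X" "card X = card R" and x: "qarray R X x" and K: "latin R S K" and xK: "mate R X x K"
    and two: "\<And>s. s \<in> S \<Longrightarrow> \<exists>y\<in>S. y \<noteq> s \<and> h y = h s"
    and ray: "\<And>c d. c \<in> R \<times> R \<Longrightarrow> d \<in> R \<times> R \<Longrightarrow> h (K c) = h (K d) \<Longrightarrow> same_ray X (x c) (x d) \<Longrightarrow> c = d"
    using b unfolding blocked_def by blast+
  obtain A B :: "nat \<times> nat \<Rightarrow> nat" where A: "latin ?k ?k A" and B: "latin ?k ?k B"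
    and AB: "inj_on (\<lambda>c. (A c, B c)) (?k \<times> ?k)"
    using k unfolding mols_def by blast
  let ?h = "\<lambda>(s, t). prod_encode (h s, t)"
  note qA = basis_array_qarray[OF A]
  have "blocked (R \<times> ?k) (X \<times> ?k) (S \<times> ?k) (tensor_array x (basis_array A)) (\<lambda>c. (K (pr1 c), B (pr2 c))) ?h"
    unfolding blocked_def
  proof (intro conjI ballI impI qarray_product x qA latin_product K B mate_product xK basis_array_mate A AB)
    fix s assume s: "s \<in> S \<times> ?k"
    then obtain y where "y \<in> S" "y \<noteq> fst s" "h y = h (fst s)" using two[of "fst s"] by auto
    then show "\<exists>y\<in>S \<times> ?k. y \<noteq> s \<and> ?h y = ?h s"
      using s by (intro bexI[of _ "(y, snd s)"]) (auto simp: split_def)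
  next
    fix c d assume cd: "c \<in> (R \<times> ?k) \<times> (R \<times> ?k)" "d \<in> (R \<times> ?k) \<times> (R \<times> ?k)"
      and h: "?h (K (pr1 c), B (pr2 c)) = ?h (K (pr1 d), B (pr2 d))"
      and r: "same_ray (X \<times> ?k) (tensor_array x (basis_array A) c) (tensor_array x (basis_array A) d)"
    have r': "same_ray X (x (pr1 c)) (x (pr1 d)) \<and> same_ray ?k (basis_array A (pr2 c)) (basis_array A (pr2 d))"
      by (rule same_ray_tensor_array[OF x x qA qA cd r])
    have h': "h (K (pr1 c)) = h (K (pr1 d))" "B (pr2 c) = B (pr2 d)" using h by (simp_all add: prod_encode_eq)
    have "pr1 c = pr1 d"
      using r' h' by (intro ray[OF pr_mem(1)[OF cd(1)] pr_mem(1)[OF cd(2)]]) simp_all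
    moreover have "A (pr2 c) = A (pr2 d)"
      using r' latin_mem[OF A pr_mem(2)[OF cd(1)]] by (intro same_ray_basis[of A _ ?k]) simp_all
    then have "pr2 c = pr2 d"
      by (intro inj_onD[OF AB _ pr_mem(2)[OF cd(1)] pr_mem(2)[OF cd(2)]]) (simp add: h')
    ultimately show "c = d" by (simp only: pr_eq_iff)
  qed (use fin in \<open>simp_all add: card_cartesian_product\<close>)
  then show thesis by (rule that)
qed

text \<open>
  Standard basis vectors of \<open>\<complex>\<^sup>8\<close>, or those of a second basis, obtained by a reflection in each of the four planes that belong to
  the pairs of coordinates \<open>2 i\<close>, \<open>2 i + 1\<close>.
\<close>

definition turned :: "bool \<Rightarrow> nat \<Rightarrow> nat \<Rightarrow> complex" where
  "turned b a t = (if \<not> b then (if t = a then 1 else 0)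
     else if t div 2 = a div 2 then (if t \<noteq> a then 4 / 5 else if even a then 3 / 5 else - 3 / 5) else 0)"

lemma ip_turned:
  assumes "a < 8" "a' < 8"
  shows "ip {..<8} (turned b a) (turned b a') = (if a = a' then 1 else 0)"
    and "a div 2 \<noteq> a' div 2 \<Longrightarrow> ip {..<8} (turned b a) (turned b' a') = 0"
proof -
  have s: "{..<8 :: nat} = {0, 1, 2, 3, 4, 5, 6, 7}" by auto
  have a: "a \<in> {0, 1, 2, 3, 4, 5, 6, 7}" "a' \<in> {0, 1, 2, 3, 4, 5, 6, 7}" using assms unfolding s[symmetric] by auto
  show "ip {..<8} (turned b a) (turned b a') = (if a = a' then 1 else 0)"
    using a unfolding ip_def s by (elim insertE emptyE; hypsubst; cases b; simp add: turned_def)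
  show "ip {..<8} (turned b a) (turned b' a') = 0" if "a div 2 \<noteq> a' div 2"
    unfolding ip_def
  proof (rule sum.neutral, rule ballI)
    fix t show "turned b a t * cnj (turned b' a' t) = 0"
      using that by (auto simp: turned_def)
  qed
qed

lemma not_same_ray_turned:
  assumes "a < 8" "a' < 8" "same_ray {..<8} (turned b a) (turned b' a')"
  shows "b = b'"
proof -
  have zero: "turned b a t = 0 \<longleftrightarrow> turned b' a' t = 0" if "t < 8" for t
    using assms(3) that by (auto simp: same_ray_def)
  have s: "{..<8 :: nat} = {0, 1, 2, 3, 4, 5, 6, 7}" by auto
  define f where "f x = (if even x then x + 1 else x - 1)" for x :: nat
  have f: "x < 8 \<Longrightarrow> f x < 8" "f x \<noteq> x" "f x div 2 = x div 2" for x
    unfolding f_def by presburger+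
  have one: "False" if "\<And>t. t < 8 \<Longrightarrow> turned True x t = 0 \<longleftrightarrow> turned False y t = 0" "x < 8" for x y
  proof -
    have "turned True x x \<noteq> 0" "turned True x (f x) \<noteq> 0" by (simp_all add: turned_def f)
    then have "turned False y x \<noteq> 0" "turned False y (f x) \<noteq> 0" using that f(1)[of x] by simp_all
    moreover have "t = y" if "turned False y t \<noteq> 0" for t using that by (simp add: turned_def split: if_splits)
    ultimately show False using f(2)[of x] by metis
  qed
  show ?thesis using zero one[of a a'] one[of a' a] assms(1,2) by (cases b; cases b') auto
qed

lemma same_ray_not_orthogonal:
  assumes "same_ray X f g" "ip X f f = 1"
  shows "ip X f g \<noteq> 0"
proof -
  obtain \<theta> where \<theta>: "\<And>x. x \<in> X \<Longrightarrow> g x = cis \<theta> * f x" using assms(1) unfolding same_ray_def by blast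
  have "ip X f g = cnj (cis \<theta>) * ip X f f"
    by (simp add: ip_def sum_distrib_left \<theta> mult_ac cong: sum.cong)
  then show ?thesis using assms(2) by (simp add: cis_cnj)
qed

text \<open>
  In a row or a column, the cells whose symbols of the first square form a pair \<open>2 i\<close>, \<open>2 i + 1\<close> have symbols of the second square with
  the same parity. Hence a plane is turned for both of its vectors in this line, or for none.
\<close>

lemma table_8_lines: "list_all (\<lambda>i. list_all (\<lambda>j. list_all (\<lambda>k.
    (first_square_8 ! i ! j div 2 = first_square_8 ! i ! k div 2 \<longrightarrow> even (second_square_8 ! i ! j) = even (second_square_8 ! i ! k)) \<and>
    (first_square_8 ! j ! i div 2 = first_square_8 ! k ! i div 2 \<longrightarrow> even (second_square_8 ! j ! i) = even (second_square_8 ! k ! i)))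
    [0..<8]) [0..<8]) [0..<8]"
  by code_simp

text \<open>
  The vector is a standard basis vector or its turned version, according to the parity of the mate, and the symbols \<open>2 i\<close>, \<open>2 i + 1\<close> of
  the mate form a block. Cells with different symbols in one block carry vectors of different bases, and these have no ray in common.
\<close>

lemma blocked_8:
  "blocked {..<8} {..<8} {..<8} (\<lambda>(i, j). turned (odd (second_square_8 ! i ! j)) (first_square_8 ! i ! j)) (\<lambda>(i, j). second_square_8 ! i ! j) (\<lambda>s. s div 2)"
proof -
  let ?I = "{..<8::nat}"
  define A where "A = (\<lambda>(i, j). first_square_8 ! i ! j)"
  define K where "K = (\<lambda>(i, j). second_square_8 ! i ! j)"
  note A = mols_tableD(2)[OF table_8, folded A_def] and K = mols_tableD(3)[OF table_8, folded K_def]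
  have AK: "inj_on (\<lambda>c. (A c, K c)) (?I \<times> ?I)"
    using mols_tableD(4)[OF table_8] by (simp add: A_def K_def split_def)
  have lt8: "A c < 8" if "c \<in> ?I \<times> ?I" for c using latin_mem[OF A that] by simp
  have par: "odd (K c) = odd (K d)"
    if "c \<in> ?I \<times> ?I" "d \<in> ?I \<times> ?I" "fst c = fst d \<or> snd c = snd d" "A c div 2 = A d div 2" for c d
  proof -
    have m: "i \<in> set [0..<8]" if "i < 8" for i :: nat
      using that by (simp only: set_upt atLeastLessThan_iff le0 simp_thms)
    note T = table_8_lines[unfolded list_all_iff, rule_format, OF m m m]
    have t: "first_square_8 ! i ! j div 2 = first_square_8 ! i ! k div 2 \<Longrightarrow> even (second_square_8 ! i ! j) = even (second_square_8 ! i ! k)"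
      "first_square_8 ! j ! i div 2 = first_square_8 ! k ! i div 2 \<Longrightarrow> even (second_square_8 ! j ! i) = even (second_square_8 ! k ! i)"
      if "i < 8" "j < 8" "k < 8" for i j k
      using T[OF that] by blast+
    have c: "fst c < 8" "snd c < 8" "fst d < 8" "snd d < 8" using that(1,2) by auto
    show ?thesis
      using that(3)
    proof
      assume "fst c = fst d"
      then show ?thesis using that(4) t(1)[OF c(1,2,4)] by (simp add: A_def K_def split_def)
    next
      assume "snd c = snd d"
      then show ?thesis using that(4) t(2)[OF c(2,1,3)] by (simp add: A_def K_def split_def)
    qed
  qed
  let ?x = "\<lambda>c. turned (odd (K c)) (A c)"
  have norm: "ip ?I (?x c) (?x c) = 1" if "c \<in> ?I \<times> ?I" for c
    using ip_turned(1)[OF lt8[OF that] lt8[OF that]] by simp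
  have same: "ip ?I (?x c) (?x d) = 0"
    if "c \<in> ?I \<times> ?I" "d \<in> ?I \<times> ?I" "c \<noteq> d" "K c = K d" for c d
  proof -
    have "A c \<noteq> A d" using inj_onD[OF AK, of c d] that by auto
    then show ?thesis using ip_turned(1)[OF lt8[OF that(1)] lt8[OF that(2)]] that(4) by simp
  qed
  have "blocked ?I ?I ?I ?x K (\<lambda>s. s div 2)"
    unfolding blocked_def
  proof (intro conjI ballI impI K)
    show "qarray ?I ?I ?x"
      unfolding qarray_def
    proof (intro conjI ballI impI norm)
      fix c d assume cd: "c \<in> ?I \<times> ?I" "d \<in> ?I \<times> ?I" "c \<noteq> d" "fst c = fst d \<or> snd c = snd d"
      have ne: "A c \<noteq> A d" by (rule latinD[OF A cd])
      show "ip ?I (?x c) (?x d) = 0"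
      proof (cases "A c div 2 = A d div 2")
        case True
        then have "odd (K c) = odd (K d)" by (rule par[OF cd(1,2,4)])
        then show ?thesis using ip_turned(1)[OF lt8[OF cd(1)] lt8[OF cd(2)]] ne by simp
      next
        case False
        then show ?thesis by (rule ip_turned(2)[OF lt8[OF cd(1)] lt8[OF cd(2)]])
      qed
    qed
    show "mate ?I ?I ?x K" unfolding mate_def using same by blast
    show "\<exists>y\<in>?I. y \<noteq> s \<and> y div 2 = s div 2" if "s \<in> ?I" for s
    proof (rule bexI)
      show "(if even s then s + 1 else s - 1) \<noteq> s \<and> (if even s then s + 1 else s - 1) div 2 = s div 2"
        by presburger
      show "(if even s then s + 1 else s - 1) \<in> ?I" using that unfolding lessThan_iff by presburger
    qed
    fix c d assume cd: "c \<in> ?I \<times> ?I" "d \<in> ?I \<times> ?I" and h: "K c div 2 = K d div 2" and r: "same_ray ?I (?x c) (?x d)"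
    have "odd (K c) = odd (K d)" by (rule not_same_ray_turned[OF lt8[OF cd(1)] lt8[OF cd(2)] r])
    with h have "K c = K d" by presburger
    then show "c = d" using same[OF cd] same_ray_not_orthogonal[OF r norm[OF cd(1)]] by blast
  qed simp_all
  then show ?thesis by (simp add: A_def K_def split_def)
qed

section \<open>Arrays of order 64 from the fifth power map\<close>

text \<open>
  The triple \<open>(a, b, c)\<close> is the element \<open>a + b X + c X\<^sup>2\<close> of the field \<open>F\<^sub>2[X] / (X\<^sup>3 + X + 1)\<close>, and the pair \<open>(u, v)\<close> is
  \<open>u + v \<omega>\<close> in its quadratic extension by \<open>\<omega>\<close> with \<open>\<omega>\<^sup>2 = \<omega> + 1\<close>, the field with 64 elements.
\<close>

type_synonym f8 = "bool \<times> bool \<times> bool"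

fun add8 :: "f8 \<Rightarrow> f8 \<Rightarrow> f8" where
  "add8 (a, b, c) (d, e, f) = (a \<noteq> d, b \<noteq> e, c \<noteq> f)"

fun mul8 :: "f8 \<Rightarrow> f8 \<Rightarrow> f8" where
  "mul8 (a, b, c) (d, e, f) =
     (let p = (b \<and> f) \<noteq> (c \<and> e); q = c \<and> f
      in ((a \<and> d) \<noteq> p, ((a \<and> e) \<noteq> (b \<and> d)) \<noteq> (p \<noteq> q), ((a \<and> f) \<noteq> (b \<and> e)) \<noteq> ((c \<and> d) \<noteq> q)))"

fun fourth8 :: "f8 \<Rightarrow> f8" where
  "fourth8 (a, b, c) = (a, b \<noteq> c, b)"

fun add64 :: "f8 \<times> f8 \<Rightarrow> f8 \<times> f8 \<Rightarrow> f8 \<times> f8" where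
  "add64 (u, v) (u', v') = (add8 u u', add8 v v')"

fun omega64 :: "f8 \<times> f8 \<Rightarrow> f8 \<times> f8" where
  "omega64 (u, v) = (v, add8 u v)"

text \<open>
  The fifth power, as \<open>(u + v \<omega>)\<^sup>5 = (u + v \<omega>) (u\<^sup>4 + v\<^sup>4 \<omega>)\<close>. It is a bijection, because 5 is coprime to 63, and a quadratic map over the field with two elements.
\<close>

fun fifth64 :: "f8 \<times> f8 \<Rightarrow> f8 \<times> f8" where
  "fifth64 (u, v) = (let u4 = fourth8 u; v4 = fourth8 v; w = mul8 v v4 in
     (add8 (mul8 u u4) w, add8 w (add8 (mul8 u v4) (mul8 u4 v))))"

fun dot8 :: "f8 \<Rightarrow> f8 \<Rightarrow> bool" where
  "dot8 (a, b, c) (d, e, f) = ((a \<and> d) \<noteq> ((b \<and> e) \<noteq> (c \<and> f)))"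

fun dot64 :: "f8 \<times> f8 \<Rightarrow> f8 \<times> f8 \<Rightarrow> bool" where
  "dot64 (u, v) (u', v') = (dot8 u u' \<noteq> dot8 v v')"

definition zero64 :: "f8 \<times> f8" where
  "zero64 = ((False, False, False), (False, False, False))"

lemma fifth64_inj: "distinct (map fifth64 Enum.enum)"
  by code_simp

lemma dot8_add: "dot8 x (add8 y z) \<longleftrightarrow> dot8 x y \<noteq> dot8 x z"
  by (cases x; cases y; cases z) auto

lemma dot64_add: "dot64 x (add64 y z) \<longleftrightarrow> dot64 x y \<noteq> dot64 x z"
  by (cases x rule: prod.exhaust; cases y rule: prod.exhaust; cases z rule: prod.exhaust) (auto simp: dot8_add)

text \<open>
  The bilinear map \<open>(t, s) \<mapsto> t\<^sup>4 s + t s\<^sup>4\<close> of the quadratic map \<open>t\<^sup>5\<close>.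
\<close>

fun polar64 :: "f8 \<times> f8 \<Rightarrow> f8 \<times> f8 \<Rightarrow> f8 \<times> f8" where
  "polar64 (u, v) (r, s) =
     (let w = add8 (mul8 v (fourth8 s)) (mul8 s (fourth8 v)) in
      (add8 (add8 (mul8 u (fourth8 r)) (mul8 r (fourth8 u))) w,
       add8 w (add8 (add8 (mul8 u (fourth8 s)) (mul8 r (fourth8 v)))
         (add8 (mul8 (fourth8 u) s) (mul8 (fourth8 r) v)))))"

lemma add8_comm: "add8 x y = add8 y x"
  by (cases x; cases y) auto

lemma add8_assoc: "add8 (add8 x y) z = add8 x (add8 y z)"
  by (cases x; cases y; cases z) auto

lemma add8_left_comm: "add8 x (add8 y z) = add8 y (add8 x z)"
  by (metis add8_comm add8_assoc)

lemmas add8_ac = add8_assoc add8_comm add8_left_comm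

lemma mul8_add: "\<forall>x y z. mul8 (add8 x y) z = add8 (mul8 x z) (mul8 y z) \<and> mul8 z (add8 x y) = add8 (mul8 z x) (mul8 z y)"
  by code_simp

lemma fourth8_add: "fourth8 (add8 x y) = add8 (fourth8 x) (fourth8 y)"
  by (cases x; cases y) auto

lemma fifth64_add: "fifth64 (add64 x y) = add64 (add64 (fifth64 x) (fifth64 y)) (polar64 x y)"
  by (cases x rule: prod.exhaust; cases y rule: prod.exhaust) (simp add: mul8_add fourth8_add Let_def add8_ac)

lemma polar64_add: "polar64 (add64 x y) z = add64 (polar64 x z) (polar64 y z)"
  by (cases x rule: prod.exhaust; cases y rule: prod.exhaust; cases z rule: prod.exhaust) (simp add: mul8_add fourth8_add Let_def add8_ac)

definition basis64 :: "(f8 \<times> f8) list" where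
  "basis64 = (let z = (False, False, False); b = [(True, False, False), (False, True, False), (False, False, True)]
     in map (\<lambda>u. (u, z)) b @ map (\<lambda>v. (z, v)) b)"

lemma span_basis64:
  assumes "\<And>x. x \<in> set basis64 \<Longrightarrow> P x" "P zero64" "\<And>x y. P x \<Longrightarrow> P y \<Longrightarrow> P (add64 x y)"
  shows "P t"
proof -
  obtain a b c d e f where t: "t = ((a, b, c), (d, e, f))" by (metis prod.exhaust)
  let ?z = "(False, False, False)"
  let ?i = "\<lambda>b x. if b then x else zero64"
  have "t = add64 (?i a ((True, False, False), ?z)) (add64 (?i b ((False, True, False), ?z))
     (add64 (?i c ((False, False, True), ?z)) (add64 (?i d (?z, (True, False, False)))
     (add64 (?i e (?z, (False, True, False))) (?i f (?z, (False, False, True)))))))"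
    by (simp add: t zero64_def)
  moreover have "P (?i b x)" if "x \<in> set basis64" for b x using assms(1)[OF that] assms(2) by simp
  ultimately show ?thesis
    by (simp only:) (intro assms(3); simp add: basis64_def Let_def assms(1,2))
qed

lemma fifth64_nonadditive:
  "\<forall>\<zeta>. \<zeta> = zero64 \<or> (\<exists>s t. dot64 \<zeta> (polar64 t s))"
  by code_simp

text \<open>
  For \<open>\<zeta> \<noteq> 0\<close> the form \<open>\<zeta> \<cdot> (t\<^sup>4 s + t s\<^sup>4)\<close> in \<open>t\<close> and \<open>s\<close> has a radical that is a line over the field \<open>{0, 1, \<omega>, \<omega>\<^sup>2}\<close>: it
  contains a nonzero \<open>s\<close>, and \<open>\<omega> s\<close> with it. On the radical \<open>\<zeta> \<cdot> t\<^sup>5\<close> is additive, and it is not identically 0 there. By additivity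
  in \<open>t\<close> it suffices to test the basis.
\<close>

lemma fifth64_directions:
  "\<forall>\<zeta>. \<zeta> = zero64 \<or> (\<exists>s.
     list_all (\<lambda>t. \<not> dot64 \<zeta> (polar64 t s)) basis64 \<and>
     list_all (\<lambda>t. \<not> dot64 \<zeta> (polar64 t (omega64 s))) basis64 \<and>
     (dot64 \<zeta> (fifth64 s) \<or> dot64 \<zeta> (fifth64 (omega64 s))))"
  by code_simp

text \<open>
  The members of two sequences are placed along a pair of orthogonal Latin squares of order \<open>k\<close>: the cell \<open>\<gamma>\<close> of the squares selects the
  member, and the two symbols at \<open>\<gamma>\<close> select one of \<open>k\<close> orthogonal copies for \<open>p\<close> and for \<open>q\<close>. Different cells \<open>\<gamma>\<close> differ in one of
  their symbols, and no ray occurs in two members, so that copies with the same symbol remain different.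
\<close>

lemma family_inflate:
  fixes p q :: "nat \<Rightarrow> 'r \<times> 'r \<Rightarrow> 'x \<Rightarrow> complex"
  assumes fin: "finite R" "finite X" "card R = n" "card X = n"
    and qa: "\<And>g. qarray R X (p g)" "\<And>g. qarray R X (q g)"
    and orth: "\<And>g c d. c \<in> R \<times> R \<Longrightarrow> d \<in> R \<times> R \<Longrightarrow> c \<noteq> d \<Longrightarrow> ip X (p g c) (p g d) = 0 \<or> ip X (q g c) (q g d) = 0"
    and rp: "\<And>g g' c d. c \<in> R \<times> R \<Longrightarrow> d \<in> R \<times> R \<Longrightarrow> same_ray X (p g c) (p g' d) \<Longrightarrow> g = g' \<and> c = d"
    and rq: "\<And>g g' c d. c \<in> R \<times> R \<Longrightarrow> d \<in> R \<times> R \<Longrightarrow> same_ray X (q g c) (q g' d) \<Longrightarrow> g = g' \<and> c = d"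
    and k: "mols k"
  shows "\<exists>P Q. is_MCOQLS (n * k) P Q"
proof -
  let ?k = "{..<k}" and ?R = "R \<times> {..<k}" and ?X = "X \<times> {..<k}"
  obtain A B :: "nat \<times> nat \<Rightarrow> nat" where A: "latin ?k ?k A" and B: "latin ?k ?k B"
    and AB: "inj_on (\<lambda>c. (A c, B c)) (?k \<times> ?k)"
    using k unfolding mols_def by blast
  have arr: "qarray ?R ?X (\<lambda>c. tensor_array (v (prod_encode (pr2 c))) (basis_array C) c)"
    if C: "latin ?k ?k C" and v: "\<And>g. qarray R X (v g)" for v :: "nat \<Rightarrow> 'r \<times> 'r \<Rightarrow> 'x \<Rightarrow> complex" and C :: "nat \<times> nat \<Rightarrow> nat"
    unfolding qarray_def
  proof (intro conjI ballI impI)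
    fix c assume "c \<in> ?R \<times> ?R"
    then show "ip ?X (tensor_array (v (prod_encode (pr2 c))) (basis_array C) c) (tensor_array (v (prod_encode (pr2 c))) (basis_array C) c) = 1"
      by (rule qarray_norm[OF qarray_product[OF v basis_array_qarray[OF C]]])
  next
    fix c d assume cd: "c \<in> ?R \<times> ?R" "d \<in> ?R \<times> ?R" "c \<noteq> d" "fst c = fst d \<or> snd c = snd d"
    show "ip ?X (tensor_array (v (prod_encode (pr2 c))) (basis_array C) c) (tensor_array (v (prod_encode (pr2 d))) (basis_array C) d) = 0"
    proof (cases "pr2 c = pr2 d")
      case True
      show ?thesis
        unfolding True[symmetric]
        by (rule qarray_orthogonal[OF qarray_product[OF v basis_array_qarray[OF C]] cd])
    next
      case False
      have "ip ?k (basis_array C (pr2 c)) (basis_array C (pr2 d)) = 0"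
        by (rule qarray_orthogonal[OF basis_array_qarray[OF C] pr_mem(2)[OF cd(1)] pr_mem(2)[OF cd(2)] False pr_line(2)[OF cd(4)]])
      then show ?thesis by (simp add: ip_tensor_array)
    qed
  qed
  have ray: "c = d"
    if C: "latin ?k ?k C" and v: "\<And>g. qarray R X (v g)"
      and vr: "\<And>g g' c d. c \<in> R \<times> R \<Longrightarrow> d \<in> R \<times> R \<Longrightarrow> same_ray X (v g c) (v g' d) \<Longrightarrow> g = g' \<and> c = d"
      and cd: "c \<in> ?R \<times> ?R" "d \<in> ?R \<times> ?R"
      and r: "same_ray ?X (tensor_array (v (prod_encode (pr2 c))) (basis_array C) c) (tensor_array (v (prod_encode (pr2 d))) (basis_array C) d)"
    for v :: "nat \<Rightarrow> 'r \<times> 'r \<Rightarrow> 'x \<Rightarrow> complex" and C :: "nat \<times> nat \<Rightarrow> nat" and c d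
  proof -
    have "same_ray X (v (prod_encode (pr2 c)) (pr1 c)) (v (prod_encode (pr2 d)) (pr1 d))"
      using same_ray_tensor_array[OF v v basis_array_qarray[OF C] basis_array_qarray[OF C] cd r] by blast
    from vr[OF pr_mem(1)[OF cd(1)] pr_mem(1)[OF cd(2)] this]
    show "c = d" by (simp only: pr_eq_iff prod_encode_eq simp_thms)
  qed
  let ?p = "\<lambda>c. tensor_array (p (prod_encode (pr2 c))) (basis_array A) c"
  let ?q = "\<lambda>c. tensor_array (q (prod_encode (pr2 c))) (basis_array B) c"
  have "mc_pair (n * k) ?R ?X ?X ?p ?q"
    unfolding mc_pair_def
  proof (intro conjI ballI impI arr A B qa)
    fix c d assume cd: "c \<in> ?R \<times> ?R" "d \<in> ?R \<times> ?R"
    show "c = d" if "same_ray ?X (?p c) (?p d)" by (rule ray[OF A qa(1) rp cd that])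
    show "c = d" if "same_ray ?X (?q c) (?q d)" by (rule ray[OF B qa(2) rq cd that])
    assume ne: "c \<noteq> d"
    show "ip ?X (?p c) (?p d) = 0 \<or> ip ?X (?q c) (?q d) = 0"
    proof (cases "pr2 c = pr2 d")
      case True
      then have "pr1 c \<noteq> pr1 d" using ne by (simp add: pr_eq_iff)
      from orth[OF pr_mem(1)[OF cd(1)] pr_mem(1)[OF cd(2)] this, of "prod_encode (pr2 d)"]
      show ?thesis unfolding True ip_tensor_array by auto
    next
      case False
      have "A (pr2 c) \<noteq> A (pr2 d) \<or> B (pr2 c) \<noteq> B (pr2 d)"
        using inj_onD[OF AB _ pr_mem(2)[OF cd(1)] pr_mem(2)[OF cd(2)]] False by auto
      moreover have "A (pr2 c) \<in> ?k" "B (pr2 c) \<in> ?k"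
        using latin_mem[OF A pr_mem(2)[OF cd(1)]] latin_mem[OF B pr_mem(2)[OF cd(1)]] by blast+
      ultimately show ?thesis by (auto simp: ip_tensor_array ip_basis[OF finite_lessThan])
    qed
  qed (use fin in \<open>simp_all add: card_cartesian_product\<close>)
  then show ?thesis by (rule mc_pair_imp_MCOQLS)
qed

definition sgn64 :: "f8 \<times> f8 \<Rightarrow> f8 \<times> f8 \<Rightarrow> complex" where
  "sgn64 x y = (if dot64 x y then -1 else 1)"

lemma add8_self: "add8 x x = (False, False, False)" by (cases x) auto
lemma add8_zero: "add8 x (False, False, False) = x" "add8 (False, False, False) x = x" by (cases x; auto)+

lemma add64_comm: "add64 x y = add64 y x"
  by (cases x rule: prod.exhaust; cases y rule: prod.exhaust) (simp add: add8_comm)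

lemma add64_assoc: "add64 (add64 x y) z = add64 x (add64 y z)"
  by (cases x rule: prod.exhaust; cases y rule: prod.exhaust; cases z rule: prod.exhaust) (simp add: add8_assoc)

lemma add64_self: "add64 x x = zero64"
  by (cases x rule: prod.exhaust) (simp add: add8_self zero64_def)

lemma add64_zero: "add64 x zero64 = x"
  by (cases x rule: prod.exhaust) (simp add: add8_zero zero64_def)

lemma add64_cancel: "add64 (add64 x y) y = x"
  by (simp add: add64_assoc add64_self add64_zero)

lemma add64_eq_zero_iff: "add64 x y = zero64 \<longleftrightarrow> x = y"
  by (metis add64_cancel add64_self add64_comm add64_zero)

lemma dot64_comm: "dot64 x y = dot64 y x"
proof -
  have "dot8 x y = dot8 y x" for x y by (cases x; cases y) auto
  then show ?thesis by (cases x rule: prod.exhaust; cases y rule: prod.exhaust) simp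
qed

lemma dot64_zero: "\<not> dot64 x zero64"
  using dot64_add[of x x x] dot64_add[of x zero64 zero64] by (simp add: add64_self add64_zero)

lemma dot64_nondegenerate: "x \<noteq> zero64 \<Longrightarrow> \<exists>y. dot64 x y"
proof -
  have "\<forall>x. x = zero64 \<or> (\<exists>y. dot64 x y)" by code_simp
  then show "x \<noteq> zero64 \<Longrightarrow> \<exists>y. dot64 x y" by blast
qed

lemma sgn64_add_right: "sgn64 x (add64 y z) = sgn64 x y * sgn64 x z"
  by (simp add: sgn64_def dot64_add)

lemma sgn64_add_left: "sgn64 (add64 x y) z = sgn64 x z * sgn64 y z"
  by (simp add: sgn64_def dot64_comm[of _ z] dot64_add)

lemma sgn64_zero: "sgn64 zero64 x = 1" "sgn64 x zero64 = 1"
  by (simp_all add: sgn64_def dot64_zero dot64_comm[of zero64])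

lemma sum_shift64: "(\<Sum>t\<in>UNIV. f (add64 t s)) = (\<Sum>t\<in>UNIV. f t)"
  by (rule sum.reindex_bij_betw, rule bij_betw_byWitness[where f' = "\<lambda>t. add64 t s"])
     (simp_all add: add64_cancel)

lemma sum_sgn64:
  assumes "x \<noteq> zero64"
  shows "(\<Sum>t\<in>UNIV. sgn64 x t) = 0"
proof -
  obtain s where s: "dot64 x s" using dot64_nondegenerate[OF assms] by blast
  have "(\<Sum>t\<in>UNIV. sgn64 x t) = (\<Sum>t\<in>UNIV. sgn64 x (add64 t s))" by (simp only: sum_shift64)
  also have "\<dots> = - (\<Sum>t\<in>UNIV. sgn64 x t)"
    using s by (simp add: sgn64_add_right) (simp add: sgn64_def sum_negf)
  finally show ?thesis by (simp add: eq_neg_iff_add_eq_0)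
qed

lemma card_UNIV64: "card (UNIV :: (f8 \<times> f8) set) = 64"
  by (simp only: UNIV_Times_UNIV[symmetric] card_cartesian_product card_UNIV_bool)

lemma bij_fifth64: "bij fifth64"
proof -
  have "inj fifth64"
    using fifth64_inj unfolding distinct_map enum_UNIV by blast
  then show ?thesis by (simp add: bij_def finite_UNIV_inj_surj)
qed

lemma fifth64_zero: "fifth64 zero64 = zero64" by code_simp

text \<open>
  The cell \<open>(\<xi>, \<zeta>)\<close> carries the signs with exponents \<open>\<xi> \<cdot> \<alpha> t + \<zeta> \<cdot> t\<^sup>5\<close>. As for phase arrays, the index \<open>g\<close> changes the phase of one coordinate,
  and the square of that coordinate still shows \<open>g\<close>.
\<close>

definition sign_array :: "(f8 \<times> f8 \<Rightarrow> f8 \<times> f8) \<Rightarrow> nat \<Rightarrow> (f8 \<times> f8) \<times> (f8 \<times> f8) \<Rightarrow> f8 \<times> f8 \<Rightarrow> complex" where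
  "sign_array \<alpha> g c t = (if t = ((True, False, False), (False, False, False)) then cis (1 / (2 * (real g + 1))) else 1) *
     (sgn64 (fst c) (\<alpha> t) * sgn64 (snd c) (fifth64 t)) / 8"

lemma ip_sign_array:
  "ip UNIV (sign_array \<alpha> g c) (sign_array \<alpha> g d) =
    (\<Sum>t\<in>UNIV. sgn64 (add64 (fst c) (fst d)) (\<alpha> t) * sgn64 (add64 (snd c) (snd d)) (fifth64 t)) / 64"
proof -
  have cs: "cnj (sgn64 x y) = sgn64 x y" for x y by (simp add: sgn64_def)
  have cc: "cis r * cnj (cis r) = 1" for r by (simp add: cis_cnj cis_mult)
  have "sign_array \<alpha> g c t * cnj (sign_array \<alpha> g d t) =
     sgn64 (add64 (fst c) (fst d)) (\<alpha> t) * sgn64 (add64 (snd c) (snd d)) (fifth64 t) / 64" for t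
  proof -
    let ?u = "if t = ((True, False, False), (False, False, False)) then cis (1 / (2 * (real g + 1))) else 1"
    have "sign_array \<alpha> g c t * cnj (sign_array \<alpha> g d t) =
      (?u * cnj ?u) * (sgn64 (fst c) (\<alpha> t) * sgn64 (snd c) (fifth64 t) * (sgn64 (fst d) (\<alpha> t) * sgn64 (snd d) (fifth64 t))) / 64"
      by (simp add: sign_array_def cs)
    also have "?u * cnj ?u = 1" using cc by simp
    finally show ?thesis by (simp add: sgn64_add_left mult_ac)
  qed
  then show ?thesis unfolding ip_def sum_divide_distrib by (intro sum.cong refl)
qed

lemma sign_array_qarray:
  assumes \<alpha>: "bij \<alpha>"
  shows "qarray UNIV UNIV (sign_array \<alpha> g)"
  unfolding qarray_def
proof (intro conjI ballI impI)
  fix c show "ip UNIV (sign_array \<alpha> g c) (sign_array \<alpha> g c) = 1"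
    by (simp add: ip_sign_array add64_self sgn64_zero card_UNIV64)
next
  fix c d :: "(f8 \<times> f8) \<times> (f8 \<times> f8)" assume "c \<noteq> d" and l: "fst c = fst d \<or> snd c = snd d"
  have z: "(\<Sum>t\<in>UNIV. sgn64 x (\<beta> t)) = 0" if "bij \<beta>" "x \<noteq> zero64" for \<beta> x
    using sum.reindex_bij_betw[OF that(1), of "sgn64 x"] sum_sgn64[OF that(2)] by simp
  from l show "ip UNIV (sign_array \<alpha> g c) (sign_array \<alpha> g d) = 0"
  proof
    assume 1: "fst c = fst d"
    then have "snd c \<noteq> snd d" using \<open>c \<noteq> d\<close> by (simp add: prod_eq_iff)
    then show ?thesis using z[OF bij_fifth64] by (simp add: ip_sign_array 1 add64_self sgn64_zero add64_eq_zero_iff)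
  next
    assume 1: "snd c = snd d"
    then have "fst c \<noteq> fst d" using \<open>c \<noteq> d\<close> by (simp add: prod_eq_iff)
    then show ?thesis using z[OF \<alpha>] by (simp add: ip_sign_array 1 add64_self sgn64_zero add64_eq_zero_iff)
  qed
qed

text \<open>
  Equal rays mean that \<open>\<zeta> \<cdot> t\<^sup>5\<close> is additive in \<open>t\<close> for the difference \<open>\<zeta>\<close> of the labels. This holds only for \<open>\<zeta> = 0\<close>.
\<close>

lemma sign_array_rays:
  assumes \<alpha>: "bij \<alpha>" "\<alpha> zero64 = zero64" "\<And>t s. \<alpha> (add64 t s) = add64 (\<alpha> t) (\<alpha> s)"
    and r: "same_ray UNIV (sign_array \<alpha> g c) (sign_array \<alpha> h d)"
  shows "g = h \<and> c = d"
proof -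
  let ?e = "((True, False, False), (False, False, False))"
  obtain \<theta> where \<theta>: "\<And>t. sign_array \<alpha> h d t = cis \<theta> * sign_array \<alpha> g c t"
    using r unfolding same_ray_def by blast
  have z: "sign_array \<alpha> g c zero64 = 1 / 8" for g c
  proof -
    have "zero64 \<noteq> ?e" by (simp add: zero64_def)
    then show ?thesis by (simp add: sign_array_def \<alpha>(2) fifth64_zero sgn64_zero)
  qed
  have one: "cis \<theta> = 1" using \<theta>[of zero64] unfolding z by simp
  have sq: "sgn64 x y ^ 2 = 1" for x y by (simp add: sgn64_def)
  have "(sign_array \<alpha> h d ?e) ^ 2 = (sign_array \<alpha> g c ?e) ^ 2" using \<theta>[of ?e] one by simp
  then have "cis (1 / (2 * (real h + 1))) ^ 2 = cis (1 / (2 * (real g + 1))) ^ 2"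
    by (simp add: sign_array_def power_mult_distrib power_divide sq)
  moreover have "cis (1 / (2 * (real g + 1))) ^ 2 = cis (1 / (real g + 1))" for g
  proof -
    have "real 2 * (1 / (2 * x)) = 1 / x" for x :: real by simp
    then show ?thesis by (simp only: DeMoivre)
  qed
  ultimately have "cis (1 / (real h + 1)) = cis (1 / (real g + 1))" by simp
  then have gh: "g = h" using cis_reciprocal_inj by blast
  let ?x = "add64 (fst d) (fst c)" and ?z = "add64 (snd d) (snd c)"
  have e: "dot64 ?x (\<alpha> t) = dot64 ?z (fifth64 t)" for t
  proof -
    have "sgn64 (fst d) (\<alpha> t) * sgn64 (snd d) (fifth64 t) = sgn64 (fst c) (\<alpha> t) * sgn64 (snd c) (fifth64 t)"
      using \<theta>[of t] one gh by (simp add: sign_array_def split: if_splits)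
    then show ?thesis
      by (auto simp: sgn64_def dot64_comm[of "add64 _ _"] dot64_add dot64_comm[of "\<alpha> t"] dot64_comm[of "fifth64 t"] split: if_splits)
  qed
  have "\<not> dot64 ?z (polar64 t s)" for t s
    using e[of "add64 t s"] e[of t] e[of s] by (auto simp: \<alpha>(3) fifth64_add dot64_add)
  then have zz: "?z = zero64" using fifth64_nonadditive by blast
  have nx: "\<not> dot64 ?x (\<alpha> t)" for t
  proof -
    have "\<not> dot64 ?z (fifth64 t)"
      unfolding zz dot64_comm[of zero64] by (rule dot64_zero)
    with e[of t] show ?thesis by blast
  qed
  have "\<not> dot64 ?x t" for t
  proof -
    obtain u where "t = \<alpha> u" using bij_is_surj[OF \<alpha>(1)] by (rule surjE)
    then show ?thesis using nx by simp
  qed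
  then have "?x = zero64" using dot64_nondegenerate by blast
  then have "fst d = fst c" by (simp only: add64_eq_zero_iff)
  moreover have "snd d = snd c" using zz by (simp only: add64_eq_zero_iff)
  ultimately have "d = c" by (rule prod_eqI)
  with gh show ?thesis by blast
qed

lemma bij_omega64: "bij omega64"
  and omega64_add: "omega64 (add64 t s) = add64 (omega64 t) (omega64 s)"
  and omega64_square: "omega64 (omega64 s) = add64 s (omega64 s)"
  and omega64_zero: "omega64 zero64 = zero64"
proof -
  have "distinct (map omega64 Enum.enum)" by code_simp
  then have "inj omega64" unfolding distinct_map enum_UNIV by blast
  then show "bij omega64" by (simp add: bij_def finite_UNIV_inj_surj)
  show "omega64 (add64 t s) = add64 (omega64 t) (omega64 s)"
    by (cases t rule: prod.exhaust; cases s rule: prod.exhaust) (simp add: add8_ac)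
  show "omega64 (omega64 s) = add64 s (omega64 s)"
    by (cases s rule: prod.exhaust) (simp add: add8_ac)
  show "omega64 zero64 = zero64" by code_simp
qed

text \<open>
  For \<open>s\<close> in the radical of the form, the translation by \<open>s\<close> multiplies every summand by the same sign.
\<close>

lemma nonzero_sum_character:
  assumes \<alpha>: "\<And>t s. \<alpha> (add64 t s) = add64 (\<alpha> t) (\<alpha> s)"
    and s: "\<And>t. \<not> dot64 z (polar64 t s)"
    and nz: "(\<Sum>t\<in>UNIV. sgn64 x (\<alpha> t) * sgn64 z (fifth64 t)) \<noteq> 0"
  shows "dot64 x (\<alpha> s) = dot64 z (fifth64 s)"
proof -
  let ?f = "\<lambda>t. sgn64 x (\<alpha> t) * sgn64 z (fifth64 t)"
  have "?f (add64 t s) = ?f s * ?f t" for t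
    using s[of t] by (simp add: \<alpha> fifth64_add sgn64_add_right) (simp add: sgn64_def)
  then have "(\<Sum>t\<in>UNIV. ?f t) = ?f s * (\<Sum>t\<in>UNIV. ?f t)"
    using sum_shift64[of ?f s] by (simp add: sum_distrib_left)
  then have "?f s = 1" using nz by simp
  then show ?thesis by (simp add: sgn64_def split: if_splits)
qed

text \<open>
  Let \<open>s\<close> be a direction for the difference \<open>\<zeta>\<close>, and \<open>f\<close>, \<open>f'\<close> the values of \<open>\<zeta> \<cdot> t\<^sup>5\<close> at \<open>s\<close> and \<open>\<omega> s\<close>. If neither
  inner product vanishes, the first array gives \<open>\<xi> \<cdot> s = f\<close> and \<open>\<xi> \<cdot> \<omega> s = f'\<close>, the second one \<open>\<xi> \<cdot> \<omega> s = f\<close> and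
  \<open>\<xi> \<cdot> \<omega>\<^sup>2 s = f'\<close>. From \<open>\<omega>\<^sup>2 s = s + \<omega> s\<close> follows \<open>f = f'\<close> and \<open>f' = f + f' = 0\<close>, but \<open>f\<close> and \<open>f'\<close> are not both 0.
\<close>

lemma sign_arrays_orthogonal:
  assumes "c \<noteq> d"
  shows "ip UNIV (sign_array id g c) (sign_array id g d) = 0 \<or>
    ip UNIV (sign_array omega64 g c) (sign_array omega64 g d) = 0"
proof (rule ccontr)
  assume neg: "\<not> ?thesis"
  let ?x = "add64 (fst c) (fst d)" and ?z = "add64 (snd c) (snd d)"
  have nz: "(\<Sum>t\<in>UNIV. sgn64 ?x (id t) * sgn64 ?z (fifth64 t)) \<noteq> 0"
    "(\<Sum>t\<in>UNIV. sgn64 ?x (omega64 t) * sgn64 ?z (fifth64 t)) \<noteq> 0"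
    using neg unfolding ip_sign_array by auto
  have "?z \<noteq> zero64"
  proof
    assume "?z = zero64"
    then have "snd c = snd d" by (simp add: add64_eq_zero_iff)
    then have "ip UNIV (sign_array id g c) (sign_array id g d) = 0"
      using assms by (intro qarray_orthogonal[OF sign_array_qarray[OF bij_id]]) auto
    with neg show False by blast
  qed
  then obtain s where s: "\<And>t. t \<in> set basis64 \<Longrightarrow> \<not> dot64 ?z (polar64 t s)"
      "\<And>t. t \<in> set basis64 \<Longrightarrow> \<not> dot64 ?z (polar64 t (omega64 s))"
      "dot64 ?z (fifth64 s) \<or> dot64 ?z (fifth64 (omega64 s))"
    using fifth64_directions unfolding list_all_iff by blast
  have span: "\<not> dot64 ?z (polar64 t r)" if "\<And>t. t \<in> set basis64 \<Longrightarrow> \<not> dot64 ?z (polar64 t r)" for t r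
  proof (rule span_basis64[of "\<lambda>t. \<not> dot64 ?z (polar64 t r)"])
    have "polar64 zero64 r = zero64" using polar64_add[of zero64 zero64 r] by (simp add: add64_self)
    then show "\<not> dot64 ?z (polar64 zero64 r)" by (simp add: dot64_zero)
  qed (use that in \<open>auto simp: polar64_add dot64_add\<close>)
  have "dot64 ?x s = dot64 ?z (fifth64 s)" "dot64 ?x (omega64 s) = dot64 ?z (fifth64 (omega64 s))"
    using nonzero_sum_character[of id, OF _ span[OF s(1)] nz(1)]
      nonzero_sum_character[of id, OF _ span[OF s(2)] nz(1)] by simp_all
  moreover have "dot64 ?x (omega64 s) = dot64 ?z (fifth64 s)"
    "dot64 ?x (omega64 (omega64 s)) = dot64 ?z (fifth64 (omega64 s))"
    using nonzero_sum_character[OF omega64_add span[OF s(1)] nz(2)]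
      nonzero_sum_character[OF omega64_add span[OF s(2)] nz(2)] by simp_all
  ultimately show False using s(3) unfolding omega64_square dot64_add by blast
qed

theorem MCOQLS_64_mols:
  assumes "mols k"
  shows "\<exists>P Q. is_MCOQLS (64 * k) P Q"
proof (rule family_inflate)
  show "finite (UNIV :: (f8 \<times> f8) set)" "finite (UNIV :: (f8 \<times> f8) set)" by simp_all
  show "card (UNIV :: (f8 \<times> f8) set) = 64" "card (UNIV :: (f8 \<times> f8) set) = 64" by (fact card_UNIV64)+
  show "qarray UNIV UNIV (sign_array id g)" "qarray UNIV UNIV (sign_array omega64 g)" for g
    by (intro sign_array_qarray bij_id bij_omega64)+
  show "ip UNIV (sign_array id g c) (sign_array id g d) = 0 \<or>
    ip UNIV (sign_array omega64 g c) (sign_array omega64 g d) = 0" if "c \<noteq> d" for g c d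
    using that by (rule sign_arrays_orthogonal)
  show "g = g' \<and> c = d" if "same_ray UNIV (sign_array id g c) (sign_array id g' d)" for g g' c d
    by (rule sign_array_rays[OF _ _ _ that]) simp_all
  show "g = g' \<and> c = d" if "same_ray UNIV (sign_array omega64 g c) (sign_array omega64 g' d)" for g g' c d
    by (rule sign_array_rays[OF bij_omega64 omega64_zero omega64_add that])
qed (rule assms)

section \<open>Existence\<close>

theorem theorem1p2:
  shows "(\<forall>q1 q2 k :: nat.
            (primepow q1 \<and> odd q1 \<and> q1 \<ge> 9 \<or> q1 = 16) \<and>
            (primepow q2 \<and> odd q2 \<and> q2 \<ge> 9 \<or> q2 = 16) \<and>
            k > 0 \<and> k \<noteq> 2 \<and> k \<noteq> 6 \<longrightarrow>
            (\<exists>P Q. is_MCOQLS (q1 * q2 * k) P Q)) \<and>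
         (\<forall>m :: nat. m > 0 \<longrightarrow> (\<exists>P Q. is_MCOQLS (64 * m) P Q))"
proof (intro conjI allI impI)
  fix q1 q2 k :: nat
  assume a: "(primepow q1 \<and> odd q1 \<and> q1 \<ge> 9 \<or> q1 = 16) \<and>
            (primepow q2 \<and> odd q2 \<and> q2 \<ge> 9 \<or> q2 = 16) \<and>
            k > 0 \<and> k \<noteq> 2 \<and> k \<noteq> 6"
  have q1: "mated q1" "q1 \<ge> 2" and q2: "mated q2" "q2 \<ge> 3" using a by (auto intro: mated_exist)
  have k: "mols k" using a by (intro mols_exist) auto
  obtain x :: "nat \<times> nat \<Rightarrow> nat \<Rightarrow> complex" and K where "blocked {..<q1} {..<q1} {..<q1} x K (\<lambda>_. 0)"
    by (rule mated_blocked[OF q1])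
  from blocked_inflate[OF this k] obtain x' :: "(nat \<times> nat) \<times> (nat \<times> nat) \<Rightarrow> nat \<times> nat \<Rightarrow> complex"
      and K' :: "(nat \<times> nat) \<times> (nat \<times> nat) \<Rightarrow> nat \<times> nat" and h'
    where "blocked ({..<q1} \<times> {..<k}) ({..<q1} \<times> {..<k}) ({..<q1} \<times> {..<k}) x' K' h'" .
  from blocked_imp_MCOQLS[OF this q2] show "\<exists>P Q. is_MCOQLS (q1 * q2 * k) P Q"
    by (simp add: card_cartesian_product mult_ac)
next
  fix m :: nat assume "m > 0"
  show "\<exists>P Q. is_MCOQLS (64 * m) P Q"
  proof (cases "m = 2 \<or> m = 6")
    case False
    then show ?thesis using \<open>m > 0\<close> by (intro MCOQLS_64_mols mols_exist) auto
  next
    case True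
    then show ?thesis
    proof
      assume "m = 2"
      then show ?thesis using blocked_imp_MCOQLS[OF blocked_8 mated_16] by simp
    next
      assume "m = 6"
      have "mols 3" by (rule mols_odd) simp
      from blocked_inflate[OF blocked_8 this] obtain x' :: "(nat \<times> nat) \<times> (nat \<times> nat) \<Rightarrow> nat \<times> nat \<Rightarrow> complex"
          and K' :: "(nat \<times> nat) \<times> (nat \<times> nat) \<Rightarrow> nat \<times> nat" and h'
        where "blocked ({..<8} \<times> {..<3}) ({..<8} \<times> {..<3}) ({..<8} \<times> {..<3}) x' K' h'" .
      from blocked_imp_MCOQLS[OF this mated_16] \<open>m = 6\<close> show ?thesis
        by (simp add: card_cartesian_product)
    qed
  qed
qed

end
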